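(* Let $\Omega\subset\mathbb{R}^3$ be a bounded polyhedral Lipschitz domain, $\mathcal{T}$ a triangulation of $\overline{\Omega}$ into tetrahedra, and $\mathcal{T}^{WF}$ a Worsey--Farin refinement of $\mathcal{T}$. Then the following spaces and operators form a complex: $$0\to\Upsilon^{WF}(\mathcal{T})\xrightarrow{\ \mathrm{def}\ }\Sigma^{WF}(\mathcal{T})\xrightarrow{\ \mathrm{inc}\ }\mathring{\mathrm{Reg}}^*_1(\mathcal{T}^{WF})\xrightarrow{\ \mathrm{div}\ }\mathring{\mathrm{Lag}}^*_2(\mathcal{T}^{WF})\otimes\mathbb{R}^3\to0 ,$$ that is, each operator maps the indicated space into the next one and consecutive operators compose to zero.
   Context: Worsey--Farin refinement: for each tetrahedron $T\in\mathcal{T}$ choose a point $x_T$ in its interior and for each face $f$ a point $x_f$ in its (relative) interior, such that if $f$ is shared by $T_1,T_2$ then $x_f$ lies on the segment $[x_{T_1},x_{T_2}]$; each face $f$ is split into three triangles by joining $x_f$ to the edges of $f$, and each $T$ is split into 12 tetrahedra by joining $x_T$ to the 12 resulting boundary triangles. $\mathrm{P}_m(s)$: polynomials of degree at most $m$ on a simplex $s$. $\mathbb{S}_3$: real symmetric $3\times3$ matrices. For a face $f$, $\mathbb{S}(f)$ is the span of the matrices $uv^T+vu^T$ with $u,v$ tangent to $f$; for an edge $e$ with unit tangent $\tau_e$, $\mathbb{S}(e)=\mathbb{R}\,\tau_e\tau_e^T$. $\Pi_f$ is orthogonal projection onto the tangent plane of $f$. $\mathrm{Lag}_m(\mathcal{T}^{WF})$: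 continuous functions, $\mathrm{P}_m$ on each tetrahedron of $\mathcal{T}^{WF}$. $\mathrm{Reg}_1(\mathcal{T}^{WF})$: $\sigma\in L^2(\Omega)\otimes\mathbb{S}_3$, $\mathrm{P}_1\otimes\mathbb{S}_3$ on each tetrahedron of $\mathcal{T}^{WF}$, with $\Pi_f\sigma\Pi_f$ continuous across each interior face $f$ of $\mathcal{T}^{WF}$. $\Upsilon^{WF}(\mathcal{T})=\{u\in\mathrm{Lag}_2(\mathcal{T}^{WF})\otimes\mathbb{R}^3:\mathrm{div}\,u\in\mathrm{Lag}_1(\mathcal{T}^{WF})\}$ and $\Sigma^{WF}(\mathcal{T})=\{\sigma\in\mathrm{Reg}_1(\mathcal{T}^{WF}):\mathrm{tr}\,\sigma\in\mathrm{Lag}_1(\mathcal{T}^{WF})\}$. Distributions on $\Omega$: $\langle\delta_x,\varphi\rangle=\varphi(x)$ and $\langle p\,\delta_s,\varphi\rangle=\int_s p\varphi$ (componentwise when $p$ is vector or matrix valued). With $e,f,x$ ranging over interior edges, faces and vertices of $\mathcal{T}^{WF}$, $\mathring{\mathrm{Reg}}_1^*(\mathcal{T}^{WF})=\bigoplus_{e}\mathrm{P}_1(e)\,\mathbb{S}(e)\,\delta_e\oplus\bigoplus_f\mathrm{P}_0(f)\,\mathbb{S}(f)\,\delta_f$ and $\mathring{\mathrm{Lag}}_2^*(\mathcal{T}^{WF})=\bigoplus_x\mathbb{R}\,\delta_x\oplus\bigoplus_e\mathrm{P}_0(e)\,\delta_e$. Operators (in the sense of distributions on $\Omega$): $\mathrm{def}\,u=\frac12(\nabla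 u+(\nabla u)^T)$; $\mathrm{inc}\,\sigma=\mathrm{curl}\big((\mathrm{curl}\,\sigma)^T\big)$; $\mathrm{curl}$ and $\mathrm{div}$ act row-wise on matrices. *)

theory Defs
  imports "HOL-Analysis.Analysis"
begin

text \<open>Near each boundary point, after a rotation of the axes, the domain is the part above the graph
  of a Lipschitz function. Here \<open>n\<close> is the direction of the last rotated axis, and the graph
  function lives on the plane orthogonal to \<open>n\<close>.\<close>

definition lipschitz_domain :: "(real^3) set \<Rightarrow> bool" where
  "lipschitz_domain \<Omega> \<longleftrightarrow> open \<Omega> \<and> connected \<Omega> \<and> \<Omega> \<noteq> {} \<and>
     (\<forall>x\<in>frontier \<Omega>. \<exists>r>0. \<exists>n. norm n = 1 \<and> (\<exists>L \<gamma>. L-lipschitz_on {z. z \<bullet> n = 0} \<gamma> \<and>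
        \<Omega> \<inter> ball x r = {y \<in> ball x r. \<gamma> (y - (y \<bullet> n) *\<^sub>R n) < y \<bullet> n}))"

definition polyhedral_domain :: "(real^3) set \<Rightarrow> bool" where
  "polyhedral_domain \<Omega> \<longleftrightarrow> (\<exists>\<P>. finite \<P> \<and> (\<forall>p\<in>\<P>. polytope p) \<and> closure \<Omega> = \<Union>\<P>)"

text \<open>A tetrahedral mesh is the set of its closed tetrahedra; the lower-dimensional simplices are
  their faces in the sense of \<^const>\<open>face_of\<close>.\<close>

definition tetrahedral_mesh :: "(real^3) set \<Rightarrow> (real^3) set set \<Rightarrow> bool" where
  "tetrahedral_mesh \<Omega> \<T> \<longleftrightarrow> triangulation \<T> \<and> (\<forall>T\<in>\<T>. 3 simplex T) \<and> \<Union>\<T> = closure \<Omega>"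

definition split_face :: "real^3 \<Rightarrow> (real^3) set \<Rightarrow> (real^3) set set" where
  "split_face z f = {convex hull (insert z e) | e. e edge_of f}"

definition worsey_farin_refinement :: "(real^3) set set \<Rightarrow> (real^3) set set \<Rightarrow> bool" where
  "worsey_farin_refinement \<T> \<W> \<longleftrightarrow> (\<exists>xT xf.
     (\<forall>T\<in>\<T>. xT T \<in> interior T) \<and>
     (\<forall>T\<in>\<T>. \<forall>f. f facet_of T \<longrightarrow> xf f \<in> rel_interior f) \<and>
     (\<forall>T\<in>\<T>. \<forall>T'\<in>\<T>. \<forall>f. T \<noteq> T' \<and> f facet_of T \<and> f facet_of T' \<longrightarrow>
        xf f \<in> closed_segment (xT T) (xT T')) \<and>
     \<W> = {convex hull (insert (xT T) t) | T f t. T \<in> \<T> \<and> f facet_of T \<and> t \<in> split_face (xf f) f})"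

text \<open>The \<open>d\<close>-dimensional simplices of a mesh that do not lie on the boundary of \<open>\<Omega>\<close>
  (vertices occur as singletons).\<close>

definition interior_cells :: "(real^3) set \<Rightarrow> (real^3) set set \<Rightarrow> int \<Rightarrow> (real^3) set set" where
  "interior_cells \<Omega> \<W> d = {s. (\<exists>T\<in>\<W>. s face_of T) \<and> aff_dim s = d \<and> \<not> s \<subseteq> frontier \<Omega>}"

definition tangent_space :: "(real^3) set \<Rightarrow> (real^3) set" where
  "tangent_space s = span {x - y | x y. x \<in> s \<and> y \<in> s}"

definition outer :: "real^3 \<Rightarrow> real^3 \<Rightarrow> real^3^3" where
  "outer u v = (\<chi> i j. u $ i * v $ j)"

definition sym_matrices :: "(real^3^3) set" where
  "sym_matrices = {A. transpose A = A}"

definition face_matrices :: "(real^3) set \<Rightarrow> (real^3^3) set" where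
  "face_matrices f = span {outer u v + outer v u | u v. u \<in> tangent_space f \<and> v \<in> tangent_space f}"

text \<open>There are two unit tangents, differing by a sign that cancels in the product.\<close>

definition edge_matrices :: "(real^3) set \<Rightarrow> (real^3^3) set" where
  "edge_matrices e = span {outer \<tau> \<tau> | \<tau>. \<tau> \<in> tangent_space e \<and> norm \<tau> = 1}"

definition orthogonal_proj :: "(real^3) set \<Rightarrow> real^3 \<Rightarrow> real^3" where
  "orthogonal_proj W v = (THE w. w \<in> W \<and> (\<forall>z\<in>W. orthogonal (v - w) z))"

definition proj_mat :: "(real^3) set \<Rightarrow> real^3^3" where
  "proj_mat f = matrix (orthogonal_proj (tangent_space f))"

text \<open>Polynomials of total degree at most \<open>m\<close> with coefficients in the linear space \<open>V\<close>, that is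
  \<open>P\<^sub>m \<otimes> V\<close>; the index \<open>\<alpha>\<close> ranges over multi-indices. The space \<open>P\<^sub>m(s) \<otimes> V\<close> on a simplex \<open>s\<close>
  consists of the restrictions of these functions to \<open>s\<close>.\<close>

definition polys :: "nat \<Rightarrow> 'v set \<Rightarrow> (real^3 \<Rightarrow> 'v::euclidean_space) set" where
  "polys m V = {\<lambda>x. \<Sum>\<alpha> | (\<Sum>i\<in>UNIV. \<alpha> i) \<le> m. (\<Prod>i\<in>UNIV. x $ i ^ \<alpha> i) *\<^sub>R c \<alpha>
     | c :: (3 \<Rightarrow> nat) \<Rightarrow> 'v. range c \<subseteq> V}"

definition pd :: "3 \<Rightarrow> (real^3 \<Rightarrow> real) \<Rightarrow> real^3 \<Rightarrow> real" where
  "pd i \<phi> x = frechet_derivative \<phi> (at x) (axis i 1)"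

text \<open>The functions in \<open>C\<^sub>c\<^sup>\<infinity>(\<Omega>)\<close>, extended by zero: every iterated partial derivative is
  differentiable (hence continuous).\<close>

definition test_fun :: "(real^3) set \<Rightarrow> (real^3 \<Rightarrow> real) set" where
  "test_fun \<Omega> = {\<phi>. (\<forall>is x. foldr pd is \<phi> differentiable (at x)) \<and>
     compact (closure {x. \<phi> x \<noteq> 0}) \<and> closure {x. \<phi> x \<noteq> 0} \<subseteq> \<Omega>}"

text \<open>A distribution with values in \<open>'v\<close> is applied componentwise to scalar test functions.
  All functionals below get the value \<open>0\<close> outside \<^term>\<open>test_fun \<Omega>\<close>, so that equality in
  HOL is equality of distributions on \<open>\<Omega>\<close> and the zero distribution is \<open>\<lambda>_. 0\<close>.\<close>

type_synonym 'v dist = "(real^3 \<Rightarrow> real) \<Rightarrow> 'v"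

definition on_test :: "(real^3) set \<Rightarrow> 'v dist \<Rightarrow> ('v::euclidean_space) dist" where
  "on_test \<Omega> F = (\<lambda>\<phi>. if \<phi> \<in> test_fun \<Omega> then F \<phi> else 0)"

definition reg_dist :: "(real^3) set \<Rightarrow> (real^3 \<Rightarrow> 'v) \<Rightarrow> ('v::euclidean_space) dist" where
  "reg_dist \<Omega> u = on_test \<Omega> (\<lambda>\<phi>. set_lebesgue_integral lebesgue \<Omega> (\<lambda>x. \<phi> x *\<^sub>R u x))"

text \<open>Integration over a flat set \<open>s\<close> of dimension \<open>DIM('d)\<close> with respect to the Lebesgue (length,
  area) measure of its affine hull, via an isometric chart \<open>y \<mapsto> a + L y\<close> of the affine hull. The
  result does not depend on the chart.\<close>

definition flat_integral ::
    "'d::euclidean_space itself \<Rightarrow> (real^3) set \<Rightarrow> (real^3 \<Rightarrow> 'v) \<Rightarrow> 'v::euclidean_space" where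
  "flat_integral D s g =
     (let (a, L) = (SOME (a, L). linear (L :: 'd \<Rightarrow> real^3) \<and> (\<forall>y. norm (L y) = norm y) \<and>
                      range (\<lambda>y. a + L y) = affine hull s)
      in set_lebesgue_integral lborel {y. a + L y \<in> s} (\<lambda>y. g (a + L y)))"

definition edge_delta :: "(real^3 \<Rightarrow> 'v) \<Rightarrow> (real^3) set \<Rightarrow> ('v::euclidean_space) dist" where
  "edge_delta p e = (\<lambda>\<phi>. flat_integral TYPE(real) e (\<lambda>x. \<phi> x *\<^sub>R p x))"

definition face_delta :: "(real^3 \<Rightarrow> 'v) \<Rightarrow> (real^3) set \<Rightarrow> ('v::euclidean_space) dist" where
  "face_delta p f = (\<lambda>\<phi>. flat_integral TYPE(real^2) f (\<lambda>x. \<phi> x *\<^sub>R p x))"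

definition vertex_delta :: "'v \<Rightarrow> real^3 \<Rightarrow> ('v::euclidean_space) dist" where
  "vertex_delta c x = (\<lambda>\<phi>. \<phi> x *\<^sub>R c)"

definition dpd :: "(real^3) set \<Rightarrow> 3 \<Rightarrow> 'v dist \<Rightarrow> ('v::euclidean_space) dist" where
  "dpd \<Omega> i F = on_test \<Omega> (\<lambda>\<phi>. - F (pd i \<phi>))"

definition dgrad :: "(real^3) set \<Rightarrow> (real^3) dist \<Rightarrow> (real^3^3) dist" where
  "dgrad \<Omega> U = (\<lambda>\<phi>. \<chi> i j. dpd \<Omega> j U \<phi> $ i)"

definition ddef :: "(real^3) set \<Rightarrow> (real^3) dist \<Rightarrow> (real^3^3) dist" where
  "ddef \<Omega> U = (\<lambda>\<phi>. (1/2) *\<^sub>R (dgrad \<Omega> U \<phi> + transpose (dgrad \<Omega> U \<phi>)))"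

definition ddiv_vec :: "(real^3) set \<Rightarrow> (real^3) dist \<Rightarrow> real dist" where
  "ddiv_vec \<Omega> U = (\<lambda>\<phi>. \<Sum>j\<in>UNIV. dpd \<Omega> j U \<phi> $ j)"

definition dcurl_vec :: "(real^3) set \<Rightarrow> (real^3) dist \<Rightarrow> (real^3) dist" where
  "dcurl_vec \<Omega> U = (\<lambda>\<phi>. vector [dpd \<Omega> 2 U \<phi> $ 3 - dpd \<Omega> 3 U \<phi> $ 2,
                                dpd \<Omega> 3 U \<phi> $ 1 - dpd \<Omega> 1 U \<phi> $ 3,
                                dpd \<Omega> 1 U \<phi> $ 2 - dpd \<Omega> 2 U \<phi> $ 1])"

definition ddiv :: "(real^3) set \<Rightarrow> (real^3^3) dist \<Rightarrow> (real^3) dist" where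
  "ddiv \<Omega> S = (\<lambda>\<phi>. \<chi> i. ddiv_vec \<Omega> (\<lambda>\<psi>. S \<psi> $ i) \<phi>)"

definition dcurl :: "(real^3) set \<Rightarrow> (real^3^3) dist \<Rightarrow> (real^3^3) dist" where
  "dcurl \<Omega> S = (\<lambda>\<phi>. \<chi> i. dcurl_vec \<Omega> (\<lambda>\<psi>. S \<psi> $ i) \<phi>)"

definition dinc :: "(real^3) set \<Rightarrow> (real^3^3) dist \<Rightarrow> (real^3^3) dist" where
  "dinc \<Omega> S = dcurl \<Omega> (\<lambda>\<phi>. transpose (dcurl \<Omega> S \<phi>))"

text \<open>Function spaces are identified with the corresponding spaces of regular distributions on \<open>\<Omega>\<close>.
  With values in a vector space \<open>'v\<close>, the following is \<open>Lag\<^sub>m \<otimes> 'v\<close>.\<close>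

definition Lag :: "(real^3) set \<Rightarrow> (real^3) set set \<Rightarrow> nat \<Rightarrow> ('v::euclidean_space) dist set" where
  "Lag \<Omega> \<W> m = {reg_dist \<Omega> u | u. continuous_on (closure \<Omega>) u \<and>
     (\<forall>T\<in>\<W>. \<exists>q\<in>polys m UNIV. \<forall>x\<in>T. u x = q x)}"

definition square_integrable_on :: "(real^3) set \<Rightarrow> (real^3 \<Rightarrow> 'v::euclidean_space) \<Rightarrow> bool" where
  "square_integrable_on \<Omega> \<sigma> \<longleftrightarrow> set_borel_measurable lebesgue \<Omega> \<sigma> \<and>
     set_integrable lebesgue \<Omega> (\<lambda>x. (norm (\<sigma> x))\<^sup>2)"

text \<open>The polynomial \<open>q T\<close> provides the trace of \<open>\<sigma>\<close> on the faces of \<open>T\<close> from inside \<open>T\<close>;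
  the values of \<open>\<sigma>\<close> on the faces themselves (a null set) are irrelevant.\<close>

definition Reg1 :: "(real^3) set \<Rightarrow> (real^3) set set \<Rightarrow> (real^3^3) dist set" where
  "Reg1 \<Omega> \<W> = {reg_dist \<Omega> \<sigma> | \<sigma>. square_integrable_on \<Omega> \<sigma> \<and>
     (\<exists>q. (\<forall>T\<in>\<W>. q T \<in> polys 1 sym_matrices \<and> (\<forall>x\<in>interior T. \<sigma> x = q T x)) \<and>
          (\<forall>f\<in>interior_cells \<Omega> \<W> 2. \<forall>T\<in>\<W>. \<forall>T'\<in>\<W>. f face_of T \<and> f face_of T' \<longrightarrow>
             (\<forall>x\<in>f. proj_mat f ** q T x ** proj_mat f = proj_mat f ** q T' x ** proj_mat f)))}"

definition Upsilon_WF :: "(real^3) set \<Rightarrow> (real^3) set set \<Rightarrow> (real^3) dist set" where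
  "Upsilon_WF \<Omega> \<W> = {U \<in> Lag \<Omega> \<W> 2. ddiv_vec \<Omega> U \<in> Lag \<Omega> \<W> 1}"

definition Sigma_WF :: "(real^3) set \<Rightarrow> (real^3) set set \<Rightarrow> (real^3^3) dist set" where
  "Sigma_WF \<Omega> \<W> = {S \<in> Reg1 \<Omega> \<W>. (\<lambda>\<phi>. trace (S \<phi>)) \<in> Lag \<Omega> \<W> 1}"

definition Reg1_star :: "(real^3) set \<Rightarrow> (real^3) set set \<Rightarrow> (real^3^3) dist set" where
  "Reg1_star \<Omega> \<W> = {on_test \<Omega> (\<lambda>\<phi>. (\<Sum>e\<in>interior_cells \<Omega> \<W> 1. edge_delta (p e) e \<phi>) +
                                  (\<Sum>f\<in>interior_cells \<Omega> \<W> 2. face_delta (q f) f \<phi>)) | p q.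
     (\<forall>e\<in>interior_cells \<Omega> \<W> 1. p e \<in> polys 1 (edge_matrices e)) \<and>
     (\<forall>f\<in>interior_cells \<Omega> \<W> 2. q f \<in> polys 0 (face_matrices f))}"

text \<open>With values in a vector space \<open>'v\<close>, this is the tensor product with \<open>'v\<close>.\<close>

definition Lag2_star :: "(real^3) set \<Rightarrow> (real^3) set set \<Rightarrow> ('v::euclidean_space) dist set" where
  "Lag2_star \<Omega> \<W> = {on_test \<Omega> (\<lambda>\<phi>. (\<Sum>x | {x} \<in> interior_cells \<Omega> \<W> 0. vertex_delta (c x) x \<phi>) +
                                  (\<Sum>e\<in>interior_cells \<Omega> \<W> 1. edge_delta (p e) e \<phi>)) | c p.
     \<forall>e\<in>interior_cells \<Omega> \<W> 1. p e \<in> polys 0 UNIV}"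

end

theory Submission imports Defs begin

text \<open>A Worsey--Farin refinement is again a conforming tetrahedral mesh, and conformity is all that is
  used. On such a mesh, integration by parts on each cell leaves integrals over facets weighted by
  conormals, and these cancel across interior facets for quantities without a jump.

  For \<open>inc \<sigma>\<close>, integrate by parts twice. Since \<open>\<sigma>\<close> is piecewise affine, its second derivatives
  vanish inside the tetrahedra. Tangential-tangential continuity forces the jump of
  \<open>\<nu> \<times> \<sigma>\<close> across a face to be normal to the face, so only tangential derivatives of the test
  function fall on it and these can be integrated by parts on the face, onto its edges. This gives
  densities on interior faces and edges that annihilate the normal of the face, respectively the normals of
  the edge, on one side. Because \<open>\<sigma>\<close> is symmetric, \<open>\<langle>inc \<sigma>, \<phi>\<rangle>\<close> is symmetric
  for every \<open>C\<^sup>2\<close> function \<open>\<phi>\<close>; localizing with bump functions, the densities are symmetric, hence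
  \<open>\<S>(f)\<close>- and \<open>\<S>(e)\<close>-valued.\<close>

section \<open>Smooth functions of compact support\<close>

text \<open>The symmetry of the densities cannot be read off their formulas: integration by parts
  treats the two indices of \<open>inc\<close> differently, so \<open>face_coeff\<close> and
  \<open>edge_coeff\<close> show their kernel on one side only. Testing recovers the other side, but
  it needs functions that can be written down. Hence the face and edge formula is proved for
  compactly supported functions of class \<open>C2\<close>: two derivatives are what
  \<open>inc\<close> consumes, and a truncated polynomial can then serve as a bump. The same device
  replaces the local geometry at a face. Which tetrahedra meet there, and on which side, never has
  to be decided: Green's formula on single tetrahedra, together with the vanishing of the integral
  of a compactly supported gradient, already forces the conormals at an interior face to sum to
  0.\<close>

definition grad :: "(real^3 \<Rightarrow> real) \<Rightarrow> real^3 \<Rightarrow> real^3" where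
  "grad f x = (\<chi> i. pd i f x)"

definition C1 :: "(real^3 \<Rightarrow> real) \<Rightarrow> bool" where
  "C1 f \<longleftrightarrow> (\<forall>x. f differentiable (at x)) \<and> continuous_on UNIV (grad f)"

definition C2 :: "(real^3 \<Rightarrow> real) \<Rightarrow> bool" where
  "C2 f \<longleftrightarrow> C1 f \<and> (\<forall>i. C1 (pd i f))"

text \<open>Any compact carrier is allowed, not just the closure of the support: derivatives keep
  the carrier of the function, and a closed ball carries a bump.\<close>

definition csupp :: "(real^3) set \<Rightarrow> (real^3 \<Rightarrow> real) \<Rightarrow> bool" where
  "csupp \<Omega> f \<longleftrightarrow> (\<exists>K. compact K \<and> K \<subseteq> \<Omega> \<and> (\<forall>x. x \<notin> K \<longrightarrow> f x = 0))"

lemma grad_nth [simp]: "grad f x $ i = pd i f x"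
  by (simp add: grad_def)

lemma vec3_expand: "x = (\<Sum>i\<in>UNIV. (x $ i) *\<^sub>R axis i 1)" for x :: "real^3"
  using basis_expansion[of x] by (simp add: scalar_mult_eq_scaleR)

lemma frechet_eq_grad:
  assumes "f differentiable (at x)"
  shows "frechet_derivative f (at x) h = h \<bullet> grad f x"
proof -
  have l: "linear (frechet_derivative f (at x))"
    using assms by (rule linear_frechet_derivative)
  have "frechet_derivative f (at x) h = frechet_derivative f (at x) (\<Sum>i\<in>UNIV. (h $ i) *\<^sub>R axis i 1)"
    by (subst vec3_expand[of h]) simp
  also have "\<dots> = (\<Sum>i\<in>UNIV. (h $ i) * pd i f x)"
    by (simp add: linear_sum[OF l] linear_cmul[OF l] pd_def)
  finally show ?thesis by (simp add: inner_vec_def)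
qed

lemma has_derivative_grad:
  assumes "f differentiable (at x)"
  shows "(f has_derivative (\<lambda>h. h \<bullet> grad f x)) (at x)"
  using assms frechet_derivative_works frechet_eq_grad[OF assms] by (metis (no_types, lifting) ext)

lemma C1_has_derivative: "C1 f \<Longrightarrow> (f has_derivative (\<lambda>h. h \<bullet> grad f x)) (at x)"
  by (simp add: C1_def has_derivative_grad)

lemma grad_unique:
  assumes "(f has_derivative (\<lambda>h. h \<bullet> G)) (at x)"
  shows "grad f x = G"
proof -
  have "frechet_derivative f (at x) = (\<lambda>h. h \<bullet> G)"
    using frechet_derivative_at[OF assms] by simp
  then show ?thesis
    by (simp add: vec_eq_iff pd_def inner_axis')
qed

lemma C1I:
  assumes "\<And>x. (f has_derivative (\<lambda>h. h \<bullet> G x)) (at x)" "continuous_on UNIV G"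
  shows "C1 f" "grad f = G"
proof -
  show g: "grad f = G" using grad_unique[OF assms(1)] by auto
  show "C1 f" unfolding C1_def g using assms differentiableI by blast
qed

lemma C1_continuous: "C1 f \<Longrightarrow> continuous_on S f"
  by (meson C1_has_derivative continuous_at_imp_continuous_on has_derivative_continuous)

lemma C1_continuous_grad: "C1 f \<Longrightarrow> continuous_on S (grad f)"
  unfolding C1_def using continuous_on_subset by blast

lemma C1_continuous_pd: "C1 f \<Longrightarrow> continuous_on S (pd i f)"
  using C1_continuous_grad[of f S] continuous_on_component[of S "grad f" i] by (simp add: grad_def)

lemma C1_mult:
  assumes "C1 f" "C1 g"
  shows "C1 (\<lambda>x. f x * g x)" "grad (\<lambda>x. f x * g x) = (\<lambda>x. f x *\<^sub>R grad g x + g x *\<^sub>R grad f x)"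
proof -
  have 1: "((\<lambda>x. f x * g x) has_derivative (\<lambda>h. h \<bullet> (f x *\<^sub>R grad g x + g x *\<^sub>R grad f x))) (at x)" for x
    by (rule has_derivative_eq_rhs[OF has_derivative_mult[OF C1_has_derivative[OF assms(1)] C1_has_derivative[OF assms(2)]]])
       (auto simp: inner_add_right algebra_simps)
  have 2: "continuous_on UNIV (\<lambda>x. f x *\<^sub>R grad g x + g x *\<^sub>R grad f x)"
    by (intro continuous_intros C1_continuous C1_continuous_grad assms)
  show "C1 (\<lambda>x. f x * g x)" "grad (\<lambda>x. f x * g x) = (\<lambda>x. f x *\<^sub>R grad g x + g x *\<^sub>R grad f x)"
    using C1I[OF 1 2] by auto
qed

lemma pd_mult:
  assumes "C1 f" "C1 g"
  shows "pd i (\<lambda>x. f x * g x) x = f x * pd i g x + pd i f x * g x"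
  using fun_cong[OF C1_mult(2)[OF assms], of x] by (simp add: vec_eq_iff)

lemma C2_C1: "C2 f \<Longrightarrow> C1 f" by (simp add: C2_def)
lemma C2_C1_pd: "C2 f \<Longrightarrow> C1 (pd i f)" by (simp add: C2_def)

lemma vanish_pd:
  assumes "open S" "x \<in> S" "\<And>y. y \<in> S \<Longrightarrow> f y = 0"
  shows "pd i f x = 0"
proof -
  have "(f has_derivative (\<lambda>h. 0)) (at x)"
    by (rule has_derivative_transform_within_open[of "\<lambda>_. 0" _ _ _ S]) (use assms in auto)
  then show ?thesis by (metis pd_def frechet_derivative_at)
qed

lemma csupp_pd:
  assumes "csupp \<Omega> f" shows "csupp \<Omega> (pd i f)"
proof -
  obtain K where K: "compact K" "K \<subseteq> \<Omega>" "\<And>x. x \<notin> K \<Longrightarrow> f x = 0"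
    using assms unfolding csupp_def by auto
  have "pd i f x = 0" if "x \<notin> K" for x
    by (rule vanish_pd[of "- K"]) (use K that compact_imp_closed in auto)
  then show ?thesis unfolding csupp_def using K by auto
qed

lemma csupp_zero: "csupp \<Omega> f \<Longrightarrow> x \<notin> \<Omega> \<Longrightarrow> f x = 0"
  unfolding csupp_def by auto

text \<open>Both mixed partial derivatives are limits of the same second difference quotient.\<close>

lemma second_difference:
  fixes a b :: "3"
  assumes "C2 f" "h > 0"
  shows "\<exists>p. dist p x \<le> 2 * h \<and>
    f (x + h *\<^sub>R axis a 1 + h *\<^sub>R axis b 1) - f (x + h *\<^sub>R axis a 1) - f (x + h *\<^sub>R axis b 1) + f x
      = h * h * pd b (pd a f) p"
proof -
  let ?a = "axis a (1::real)" and ?b = "axis b (1::real)"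
  have D: "((\<lambda>s. g (y + s *\<^sub>R axis i 1)) has_real_derivative pd i g (y + s *\<^sub>R axis i 1)) (at s)"
    if "C1 g" for g y s and i :: 3
  proof -
    have "((\<lambda>s. g (y + s *\<^sub>R axis i 1)) has_derivative (\<lambda>r. (r *\<^sub>R axis i 1) \<bullet> grad g (y + s *\<^sub>R axis i 1))) (at s)"
    proof (rule has_derivative_compose[OF _ C1_has_derivative[OF that]])
      show "((\<lambda>s. y + s *\<^sub>R axis i 1) has_derivative (\<lambda>r. r *\<^sub>R axis i 1)) (at s)"
        by (auto intro!: derivative_eq_intros)
    qed
    then show ?thesis
      by (simp add: has_field_derivative_def inner_axis' mult_commute_abs)
  qed
  \<comment> \<open>First difference in direction \<open>b\<close>, viewed as a function of the step
    in direction \<open>a\<close>: the mean value theorem in \<open>a\<close> and then in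
    \<open>b\<close> produces the mixed derivative at one point.\<close>
  define F where "F s = f (x + h *\<^sub>R ?b + s *\<^sub>R ?a) - f (x + s *\<^sub>R ?a)" for s
  have "(F has_real_derivative (pd a f (x + h *\<^sub>R ?b + s *\<^sub>R ?a) - pd a f (x + s *\<^sub>R ?a))) (at s)" for s
    unfolding F_def by (intro DERIV_diff D C2_C1 assms)
  then obtain s where s: "0 < s" "s < h" "F h - F 0 = (h - 0) * (pd a f (x + h *\<^sub>R ?b + s *\<^sub>R ?a) - pd a f (x + s *\<^sub>R ?a))"
    using MVT2[of 0 h F "\<lambda>s. pd a f (x + h *\<^sub>R ?b + s *\<^sub>R ?a) - pd a f (x + s *\<^sub>R ?a)"] assms by blast
  define G where "G t = pd a f (x + s *\<^sub>R ?a + t *\<^sub>R ?b)" for t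
  have "(G has_real_derivative (pd b (pd a f) (x + s *\<^sub>R ?a + t *\<^sub>R ?b))) (at t)" for t
    unfolding G_def by (intro D C2_C1_pd assms)
  then obtain t where t: "0 < t" "t < h" "G h - G 0 = (h - 0) * pd b (pd a f) (x + s *\<^sub>R ?a + t *\<^sub>R ?b)"
    using MVT2[of 0 h G "\<lambda>t. pd b (pd a f) (x + s *\<^sub>R ?a + t *\<^sub>R ?b)"] assms by blast
  let ?p = "x + s *\<^sub>R ?a + t *\<^sub>R ?b"
  have "dist ?p x \<le> norm (s *\<^sub>R ?a) + norm (t *\<^sub>R ?b)"
    by (simp only: dist_norm add.assoc add_diff_cancel_left' norm_triangle_ineq)
  then have "dist ?p x \<le> 2 * h" using s t by simp
  moreover have "F h - F 0 = h * (G h - G 0)"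
    using s(3) by (simp add: G_def add.assoc add.commute[of "h *\<^sub>R ?b"])
  moreover have "F h - F 0 = f (x + h *\<^sub>R ?a + h *\<^sub>R ?b) - f (x + h *\<^sub>R ?a) - f (x + h *\<^sub>R ?b) + f x"
    by (simp add: F_def add.assoc add.commute[of "h *\<^sub>R ?b"])
  moreover have "h * (G h - G 0) = h * h * pd b (pd a f) ?p"
    using t(3) by simp
  ultimately show ?thesis by (intro exI[of _ ?p]) simp
qed

text \<open>The second difference is symmetric in \<open>a\<close> and \<open>b\<close>, so both
  orders of the mean value argument evaluate the same number.\<close>

lemma mixed_partials_near:
  fixes a b :: "3"
  assumes "C2 f" "h > 0"
  shows "\<exists>p q. dist p x \<le> 2 * h \<and> dist q x \<le> 2 * h \<and> pd b (pd a f) p = pd a (pd b f) q"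
proof -
  let ?a = "h *\<^sub>R axis a (1::real)" and ?b = "h *\<^sub>R axis b (1::real)"
  obtain p where p: "dist p x \<le> 2 * h" "f (x + ?a + ?b) - f (x + ?a) - f (x + ?b) + f x = h * h * pd b (pd a f) p"
    using second_difference[OF assms, of x a b] by auto
  obtain q where q: "dist q x \<le> 2 * h" "f (x + ?b + ?a) - f (x + ?b) - f (x + ?a) + f x = h * h * pd a (pd b f) q"
    using second_difference[OF assms, of x b a] by auto
  have "x + ?b + ?a = x + ?a + ?b" by (simp only: add_ac)
  note q2 = q(2)[unfolded this]
  have "h * h * pd b (pd a f) p = h * h * pd a (pd b f) q" using p(2) q2 by linarith
  then have "pd b (pd a f) p = pd a (pd b f) q" using assms(2) by simp
  with p(1) q(1) show ?thesis by blast
qed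

lemma pd_commute:
  assumes "C2 f" shows "pd a (pd b f) = pd b (pd a f)"
proof
  fix x
  \<comment> \<open>Steps tending to 0 drive both intermediate points to \<open>x\<close>;
    continuity of the second derivatives then identifies the two limits.\<close>
  define h where "h n = 1 / real (Suc n)" for n
  have h: "h n > 0" for n by (simp add: h_def)
  have "\<forall>n. \<exists>p q. dist p x \<le> 2 * h n \<and> dist q x \<le> 2 * h n \<and> pd b (pd a f) p = pd a (pd b f) q"
    by (intro allI mixed_partials_near assms h)
  then obtain p q where pq: "\<And>n. dist (p n) x \<le> 2 * h n" "\<And>n. dist (q n) x \<le> 2 * h n"
    "\<And>n. pd b (pd a f) (p n) = pd a (pd b f) (q n)" by metis
  have h0: "(\<lambda>n. 2 * h n) \<longlonglongrightarrow> 0"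
    unfolding h_def using tendsto_mult_right_zero[OF LIMSEQ_Suc[OF lim_1_over_n], of 2] by simp
  have lim: "r \<longlonglongrightarrow> x" if "\<And>n. dist (r n) x \<le> 2 * h n" for r
  proof -
    have "(\<lambda>n. dist (r n) x) \<longlonglongrightarrow> 0"
      by (rule tendsto_sandwich[OF _ _ tendsto_const h0]) (use that in simp_all)
    then show ?thesis using tendsto_dist_iff by blast
  qed
  have c: "isCont (pd i (pd j f)) x" for i j
    using C1_continuous_pd[OF C2_C1_pd[OF assms], of UNIV] continuous_on_eq_continuous_at[OF open_UNIV] by blast
  have "(\<lambda>n. pd b (pd a f) (p n)) \<longlonglongrightarrow> pd b (pd a f) x"
    by (rule isCont_tendsto_compose[OF c lim[OF pq(1)]])
  moreover have "(\<lambda>n. pd b (pd a f) (p n)) \<longlonglongrightarrow> pd a (pd b f) x"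
    unfolding pq(3) by (rule isCont_tendsto_compose[OF c lim[OF pq(2)]])
  ultimately show "pd a (pd b f) x = pd b (pd a f) x"
    by (rule LIMSEQ_unique[symmetric])
qed

lemma closed_subset_compact: "compact S \<Longrightarrow> closure T \<subseteq> S \<Longrightarrow> compact (closure T)"
  for S T :: "'a::euclidean_space set"
  by (metis closed_Int_compact closed_closure inf.absorb_iff1)

lemma test_fun_pd:
  assumes "f \<in> test_fun \<Omega>" shows "pd i f \<in> test_fun \<Omega>"
proof -
  let ?K = "closure {x. f x \<noteq> 0}"
  \<comment> \<open>\<open>foldr\<close> applies the last entry of the list first, so the
    derivatives of \<open>pd i f\<close> along \<open>is\<close> are those of \<open>f\<close> along
    \<open>is @ [i]\<close>.\<close>
  have "foldr pd is (pd i f) differentiable (at x)" for "is" x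
    using assms[unfolded test_fun_def mem_Collect_eq, THEN conjunct1, rule_format, of "is @ [i]" x] by simp
  moreover have "pd i f x = 0" if "x \<notin> ?K" for x
    by (rule vanish_pd[of "- ?K"]) (use that closure_subset[of "{x. f x \<noteq> 0}"] in auto)
  then have "closure {x. pd i f x \<noteq> 0} \<subseteq> ?K"
    by (intro closure_minimal) auto
  ultimately show ?thesis
    using assms closed_subset_compact unfolding test_fun_def by blast
qed

text \<open>Continuity of the gradient comes for free: each partial derivative is again a test
  function, hence differentiable.\<close>

lemma test_fun_C1: "f \<in> test_fun \<Omega> \<Longrightarrow> C1 f"
proof -
  assume f: "f \<in> test_fun \<Omega>"
  have d: "g differentiable (at x)" if "g \<in> test_fun \<Omega>" for g x
    using that[unfolded test_fun_def mem_Collect_eq, THEN conjunct1, rule_format, of "[]" x] by simp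
  have "continuous_on UNIV (pd i f)" for i
    by (meson d test_fun_pd[OF f] continuous_at_imp_continuous_on differentiable_imp_continuous_within)
  then have "continuous_on UNIV (grad f)"
    unfolding grad_def by (intro continuous_on_vec_lambda)
  then show "C1 f" using d[OF f] by (simp add: C1_def)
qed

lemma test_fun_C2: "f \<in> test_fun \<Omega> \<Longrightarrow> C2 f"
  unfolding C2_def by (metis test_fun_C1 test_fun_pd)

lemma test_fun_csupp: "f \<in> test_fun \<Omega> \<Longrightarrow> csupp \<Omega> f"
  unfolding csupp_def test_fun_def
  by (intro exI[of _ "closure {x. f x \<noteq> 0}"]) (use closure_subset[of "{x. f x \<noteq> 0}"] in auto)

section \<open>Polynomial bump functions\<close>

lemma max_power_DERIV:
  "((\<lambda>s::real. max 0 s ^ Suc (Suc n)) has_real_derivative (real (Suc (Suc n)) * max 0 s ^ Suc n)) (at s)"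
proof -
  consider "s > 0" | "s < 0" | "s = 0" by linarith
  then show ?thesis
  proof cases
    case 1
    have "((\<lambda>s::real. s ^ Suc (Suc n)) has_real_derivative (real (Suc (Suc n)) * s ^ Suc n)) (at s)"
      by (rule DERIV_cong[OF DERIV_power[OF DERIV_ident]]) simp
    then have "((\<lambda>s::real. max 0 s ^ Suc (Suc n)) has_real_derivative (real (Suc (Suc n)) * s ^ Suc n)) (at s)"
      by (rule has_field_derivative_transform_within_open[where S="{0<..}"]) (use 1 in auto)
    then show ?thesis using 1 by simp
  next
    case 2
    have "((\<lambda>s::real. max 0 s ^ Suc (Suc n)) has_real_derivative 0) (at s)"
      by (rule has_field_derivative_transform_within_open[where S="{..<0}" and f="\<lambda>_. 0"]) (use 2 in auto)
    then show ?thesis using 2 by simp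
  next
    case 3
    \<comment> \<open>At the kink, an exponent of at least 2 leaves a positive power of the step in
      the difference quotient.\<close>
    have "(\<lambda>h. max 0 h ^ Suc (Suc n) / h) \<midarrow>0\<rightarrow> (0::real)"
    proof (rule Lim_null_comparison)
      show "\<forall>\<^sub>F h::real in at 0. norm (max 0 h ^ Suc (Suc n) / h) \<le> \<bar>h\<bar> ^ Suc n"
        by (rule always_eventually) (auto simp: max_def abs_mult mult_nonpos_nonneg)
      show "(\<lambda>h::real. \<bar>h\<bar> ^ Suc n) \<midarrow>0\<rightarrow> 0"
        by (rule tendsto_eq_intros refl | simp)+
    qed
    then show ?thesis using 3 by (simp add: DERIV_def)
  qed
qed

text \<open>The cube is the smallest integer power of the positive part that is twice continuously
  differentiable across the sphere.\<close>

definition bump :: "real^3 \<Rightarrow> real \<Rightarrow> real^3 \<Rightarrow> real" where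
  "bump c r x = max 0 (r\<^sup>2 - (x - c) \<bullet> (x - c)) ^ 3"

text \<open>Stated for all exponents from 2 on, since it serves for the cube and again for the
  square that appears in its derivative.\<close>

lemma bump_power:
  shows "C1 (\<lambda>x. max 0 (r\<^sup>2 - (x - c) \<bullet> (x - c)) ^ Suc (Suc n))"
    and "grad (\<lambda>x. max 0 (r\<^sup>2 - (x - c) \<bullet> (x - c)) ^ Suc (Suc n))
        = (\<lambda>x. (- 2 * real (Suc (Suc n)) * max 0 (r\<^sup>2 - (x - c) \<bullet> (x - c)) ^ Suc n) *\<^sub>R (x - c))"
proof -
  let ?G = "\<lambda>x. (- 2 * real (Suc (Suc n)) * max 0 (r\<^sup>2 - (x - c) \<bullet> (x - c)) ^ Suc n) *\<^sub>R (x - c)"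
  have 1: "((\<lambda>x. max 0 (r\<^sup>2 - (x - c) \<bullet> (x - c)) ^ Suc (Suc n)) has_derivative (\<lambda>h. h \<bullet> ?G x)) (at x)" for x
  proof -
    have "((\<lambda>x. r\<^sup>2 - (x - c) \<bullet> (x - c)) has_derivative (\<lambda>h. - 2 * (h \<bullet> (x - c)))) (at x)"
      by (auto intro!: derivative_eq_intros simp: inner_commute)
    from has_derivative_compose[OF this max_power_DERIV[unfolded has_field_derivative_def]]
    show ?thesis by (rule has_derivative_eq_rhs) (auto simp: algebra_simps)
  qed
  have 2: "continuous_on UNIV ?G" by (intro continuous_intros)
  show "C1 (\<lambda>x. max 0 (r\<^sup>2 - (x - c) \<bullet> (x - c)) ^ Suc (Suc n))"
    "grad (\<lambda>x. max 0 (r\<^sup>2 - (x - c) \<bullet> (x - c)) ^ Suc (Suc n)) = ?G"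
    using C1I[OF 1 2] by auto
qed

lemma C1_affine: "C1 (\<lambda>x. \<alpha> + x \<bullet> w)" "grad (\<lambda>x. \<alpha> + x \<bullet> w) = (\<lambda>_. w)"
proof -
  have 1: "((\<lambda>x. \<alpha> + x \<bullet> w) has_derivative (\<lambda>h. h \<bullet> w)) (at x)" for x
    by (auto intro!: derivative_eq_intros)
  show "C1 (\<lambda>x. \<alpha> + x \<bullet> w)" "grad (\<lambda>x. \<alpha> + x \<bullet> w) = (\<lambda>_. w)"
    using C1I[OF 1 continuous_on_const] by auto
qed

lemma C2_bump: "C2 (bump c r)"
proof -
  have e: "bump c r = (\<lambda>x. max 0 (r\<^sup>2 - (x - c) \<bullet> (x - c)) ^ Suc (Suc 1))"
    by (auto simp: bump_def eval_nat_numeral)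
  \<comment> \<open>Each partial derivative is written as an affine function, namely -6 times
    \<open>x $ i - c $ i\<close>, times a square, so that the product rule applies.\<close>
  have "pd i (bump c r) = (\<lambda>x. ((- 6) * c $ i * -1 + x \<bullet> ((-6) *\<^sub>R axis i 1)) * max 0 (r\<^sup>2 - (x - c) \<bullet> (x - c)) ^ Suc (Suc 0))" for i
  proof
    fix x
    have "pd i (bump c r) x = grad (bump c r) x $ i" by simp
    also have "grad (bump c r) = (\<lambda>x. (- 2 * real (Suc (Suc 1)) * max 0 (r\<^sup>2 - (x - c) \<bullet> (x - c)) ^ Suc 1) *\<^sub>R (x - c))"
      unfolding e by (rule bump_power(2))
    finally show "pd i (bump c r) x = ((- 6) * c $ i * -1 + x \<bullet> ((-6) *\<^sub>R axis i 1)) * max 0 (r\<^sup>2 - (x - c) \<bullet> (x - c)) ^ Suc (Suc 0)"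
      by (simp add: inner_axis algebra_simps)
  qed
  then have "C1 (pd i (bump c r))" for i
    by (simp only: C1_mult(1)[OF C1_affine(1) bump_power(1)])
  moreover have "C1 (bump c r)" unfolding e by (rule bump_power(1))
  ultimately show ?thesis by (simp add: C2_def)
qed

lemma bump_nonneg: "bump c r x \<ge> 0" by (simp add: bump_def)

lemma bump_center: "r > 0 \<Longrightarrow> bump c r c > 0" by (simp add: bump_def)

lemma bump_outside: "r > 0 \<Longrightarrow> x \<notin> ball c r \<Longrightarrow> bump c r x = 0"
proof -
  assume "r > 0" "x \<notin> ball c r"
  then have "r\<^sup>2 \<le> (norm (x - c))\<^sup>2"
    by (intro power_mono) (auto simp: dist_norm norm_minus_commute)
  then show ?thesis by (simp add: bump_def dot_square_norm)
qed

lemma csupp_bump: "r > 0 \<Longrightarrow> cball c r \<subseteq> \<Omega> \<Longrightarrow> csupp \<Omega> (bump c r)"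
  unfolding csupp_def by (intro exI[of _ "cball c r"]) (auto intro: bump_outside)

section \<open>Polynomials\<close>

lemma finite_multi_indices: "finite {\<alpha> :: 3 \<Rightarrow> nat. (\<Sum>i\<in>UNIV. \<alpha> i) \<le> m}"
proof (rule finite_subset)
  have "\<alpha> i \<le> m" if "sum \<alpha> UNIV \<le> m" for \<alpha> :: "3 \<Rightarrow> nat" and i
    using member_le_sum[of i UNIV \<alpha>] that by simp
  then show "{\<alpha> :: 3 \<Rightarrow> nat. (\<Sum>i\<in>UNIV. \<alpha> i) \<le> m} \<subseteq> {\<alpha>. \<forall>i. (i \<in> UNIV \<longrightarrow> \<alpha> i \<in> {..m}) \<and> (i \<notin> UNIV \<longrightarrow> \<alpha> i = 0)}"
    by blast
  show "finite {\<alpha> :: 3 \<Rightarrow> nat. \<forall>i. (i \<in> UNIV \<longrightarrow> \<alpha> i \<in> {..m}) \<and> (i \<notin> UNIV \<longrightarrow> \<alpha> i = 0)}"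
    by (rule finite_set_of_finite_funs) simp_all
qed

abbreviation monom3 :: "(3 \<Rightarrow> nat) \<Rightarrow> real^3 \<Rightarrow> real" where
  "monom3 \<alpha> x \<equiv> (\<Prod>i\<in>UNIV. x $ i ^ \<alpha> i)"

lemma polys_add:
  assumes "subspace V" "p \<in> polys m V" "q \<in> polys m V"
  shows "(\<lambda>x. p x + q x) \<in> polys m V"
proof -
  obtain c d where "range c \<subseteq> V" "range d \<subseteq> V"
    "p = (\<lambda>x. \<Sum>\<alpha> | (\<Sum>i\<in>UNIV. \<alpha> i) \<le> m. monom3 \<alpha> x *\<^sub>R c \<alpha>)"
    "q = (\<lambda>x. \<Sum>\<alpha> | (\<Sum>i\<in>UNIV. \<alpha> i) \<le> m. monom3 \<alpha> x *\<^sub>R d \<alpha>)"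
    using assms(2,3) unfolding polys_def by auto
  then show ?thesis unfolding polys_def mem_Collect_eq
    by (intro exI[of _ "\<lambda>\<alpha>. c \<alpha> + d \<alpha>"])
       (use assms(1) in \<open>auto simp: scaleR_add_right sum.distrib subspace_add image_subset_iff\<close>)
qed

lemma polys_mono:
  assumes "subspace V" "(\<Sum>i\<in>UNIV. \<alpha> i) \<le> m" "v \<in> V"
  shows "(\<lambda>x. monom3 \<alpha> x *\<^sub>R v) \<in> polys m V"
  unfolding polys_def mem_Collect_eq
proof (intro exI[of _ "\<lambda>\<beta>. if \<beta> = \<alpha> then v else 0"] conjI ext)
  fix x
  have "(\<Sum>\<beta> | (\<Sum>i\<in>UNIV. \<beta> i) \<le> m. monom3 \<beta> x *\<^sub>R (if \<beta> = \<alpha> then v else 0))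
      = (\<Sum>\<beta> | (\<Sum>i\<in>UNIV. \<beta> i) \<le> m. if \<beta> = \<alpha> then monom3 \<alpha> x *\<^sub>R v else 0)"
    by (intro sum.cong) auto
  also have "\<dots> = monom3 \<alpha> x *\<^sub>R v"
    using assms(2) by (subst sum.delta) (auto intro: finite_multi_indices)
  finally show "monom3 \<alpha> x *\<^sub>R v = (\<Sum>\<beta> | (\<Sum>i\<in>UNIV. \<beta> i) \<le> m. monom3 \<beta> x *\<^sub>R (if \<beta> = \<alpha> then v else 0))" ..
qed (use assms subspace_0 in auto)

lemma polys_0: "subspace V \<Longrightarrow> (\<lambda>_. 0) \<in> polys m V"
  using polys_mono[of V "\<lambda>_. 0" m 0] by (simp add: subspace_0)

lemma polys_const: "subspace V \<Longrightarrow> v \<in> V \<Longrightarrow> (\<lambda>_. v) \<in> polys m V"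
  using polys_mono[of V "\<lambda>_. 0" m v] by simp

lemma polys_sum:
  assumes "subspace V" "\<And>i. i \<in> I \<Longrightarrow> p i \<in> polys m V"
  shows "(\<lambda>x. \<Sum>i\<in>I. p i x) \<in> polys m V"
  using assms(2) by (induction I rule: infinite_finite_induct) (auto intro: polys_0 polys_add assms(1))

text \<open>The truncated exponent \<open>\<alpha> k - 1\<close> is harmless at
  \<open>\<alpha> k = 0\<close>, where the factor \<open>real (\<alpha> k)\<close> vanishes.\<close>

lemma monom3_has_derivative:
  "(monom3 \<alpha> has_derivative (\<lambda>h. \<Sum>k\<in>UNIV. h $ k * (real (\<alpha> k) * monom3 (\<alpha>(k := \<alpha> k - 1)) x))) (at x)"
proof -
  have "(monom3 \<alpha> has_derivative (\<lambda>h. \<Sum>k\<in>UNIV. (real (\<alpha> k) * (h $ k) * x $ k ^ (\<alpha> k - 1)) * (\<Prod>j\<in>UNIV - {k}. x $ j ^ \<alpha> j))) (at x)"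
    by (rule has_derivative_prod, rule has_derivative_eq_rhs, rule has_derivative_power, rule bounded_linear.has_derivative[OF bounded_linear_vec_nth], rule has_derivative_ident)
       (simp add: mult_ac)
  moreover have "monom3 (\<alpha>(k := \<alpha> k - 1)) x = x $ k ^ (\<alpha> k - 1) * (\<Prod>j\<in>UNIV - {k}. x $ j ^ \<alpha> j)" for k
    by (subst prod.remove[of UNIV k]) auto
  ultimately show ?thesis
    by (elim has_derivative_eq_rhs) (auto intro!: sum.cong ext simp only: mult_ac)
qed

text \<open>Differentiation only rescales coefficients, so they stay in \<open>V\<close>. For
  \<open>m = 0\<close> the truncated degree \<open>m - 1\<close> is again 0, which is right because
  all derivatives vanish.\<close>

lemma polys_has_derivative:
  assumes "subspace V" "q \<in> polys m V"
  shows "\<exists>dq. (\<forall>i. dq i \<in> polys (m - 1) V) \<and> (\<forall>x. (q has_derivative (\<lambda>h. \<Sum>i\<in>UNIV. h $ i *\<^sub>R dq i x)) (at x))"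
proof -
  let ?A = "{\<alpha> :: 3 \<Rightarrow> nat. (\<Sum>i\<in>UNIV. \<alpha> i) \<le> m}"
  obtain c where c: "range c \<subseteq> V" and q: "q = (\<lambda>x. \<Sum>\<alpha>\<in>?A. monom3 \<alpha> x *\<^sub>R c \<alpha>)"
    using assms(2) unfolding polys_def by auto
  define dq where "dq k x = (\<Sum>\<alpha>\<in>?A. monom3 (\<alpha>(k := \<alpha> k - 1)) x *\<^sub>R (real (\<alpha> k) *\<^sub>R c \<alpha>))" for k x
  have 1: "dq k \<in> polys (m - 1) V" for k
    unfolding dq_def
  proof (intro polys_sum assms(1))
    fix \<alpha> assume a: "\<alpha> \<in> ?A"
    have v: "real (\<alpha> k) *\<^sub>R c \<alpha> \<in> V" using c assms(1) by (auto intro: subspace_scale)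
    show "(\<lambda>x. monom3 (\<alpha>(k := \<alpha> k - 1)) x *\<^sub>R (real (\<alpha> k) *\<^sub>R c \<alpha>)) \<in> polys (m - 1) V"
    proof (cases "\<alpha> k = 0")
      case True then show ?thesis using polys_0[OF assms(1)] by simp
    next
      case False
      have "(\<Sum>i\<in>UNIV. (\<alpha>(k := \<alpha> k - 1)) i) = (\<Sum>i\<in>UNIV. \<alpha> i) - 1"
        using False by (subst (1 2) sum.remove[of UNIV k]) auto
      then show ?thesis using a by (intro polys_mono assms(1) v) auto
    qed
  qed
  have "(q has_derivative (\<lambda>h. \<Sum>\<alpha>\<in>?A. (\<Sum>k\<in>UNIV. h $ k * (real (\<alpha> k) * monom3 (\<alpha>(k := \<alpha> k - 1)) x)) *\<^sub>R c \<alpha>)) (at x)" for x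
    unfolding q by (intro has_derivative_sum has_derivative_scaleR_left monom3_has_derivative)
  moreover have "(\<Sum>\<alpha>\<in>?A. (\<Sum>k\<in>UNIV. h $ k * (real (\<alpha> k) * monom3 (\<alpha>(k := \<alpha> k - 1)) x)) *\<^sub>R c \<alpha>)
     = (\<Sum>i\<in>UNIV. h $ i *\<^sub>R dq i x)" for h x
    unfolding dq_def scaleR_sum_left scaleR_sum_right
    by (subst sum.swap) (intro sum.cong refl, simp)
  ultimately show ?thesis using 1 by auto
qed

lemma polys_0_iff:
  assumes "subspace V" shows "q \<in> polys 0 V \<longleftrightarrow> (\<exists>v\<in>V. q = (\<lambda>_. v))"
proof
  assume "q \<in> polys 0 V"
  then obtain c where "range c \<subseteq> V" "q = (\<lambda>x. \<Sum>\<alpha> | (\<Sum>i\<in>UNIV. \<alpha> i) \<le> 0. monom3 \<alpha> x *\<^sub>R c \<alpha>)"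
    unfolding polys_def by auto
  moreover have "{\<alpha> :: 3 \<Rightarrow> nat. (\<Sum>i\<in>UNIV. \<alpha> i) \<le> 0} = {\<lambda>_. 0}" by auto
  ultimately show "\<exists>v\<in>V. q = (\<lambda>_. v)" by (intro bexI[of _ "c (\<lambda>_. 0)"]) auto
qed (use assms polys_const in auto)

lemma polys_value: "subspace V \<Longrightarrow> q \<in> polys m V \<Longrightarrow> q x \<in> V"
  unfolding polys_def by (auto intro!: subspace_sum subspace_scale)

text \<open>The first derivatives have degree 0, hence are constants in \<open>V\<close>;
  subtracting the linear part leaves a function with zero derivative.\<close>

lemma polys_1_affine:
  assumes "subspace V" "q \<in> polys 1 V"
  shows "\<exists>c d. c \<in> V \<and> (\<forall>i. d i \<in> V) \<and> q = (\<lambda>x. c + (\<Sum>i\<in>UNIV. x $ i *\<^sub>R d i))"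
proof -
  obtain dq where dq: "\<And>i. dq i \<in> polys 0 V" "\<And>x. (q has_derivative (\<lambda>h. \<Sum>i\<in>UNIV. h $ i *\<^sub>R dq i x)) (at x)"
    using polys_has_derivative[OF assms] by auto
  have "\<forall>i. \<exists>v\<in>V. dq i = (\<lambda>_. v)" using dq(1) polys_0_iff[OF assms(1)] by blast
  then obtain d where d: "\<And>i. d i \<in> V" "\<And>i. dq i = (\<lambda>_. d i)" by metis
  have "((\<lambda>x. q x - (\<Sum>i\<in>UNIV. x $ i *\<^sub>R d i)) has_derivative (\<lambda>h. 0)) (at x within UNIV)" for x
  proof -
    have "((\<lambda>x. \<Sum>i\<in>UNIV. x $ i *\<^sub>R d i) has_derivative (\<lambda>h. \<Sum>i\<in>UNIV. h $ i *\<^sub>R d i)) (at x)"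
      by (intro has_derivative_sum has_derivative_scaleR_left bounded_linear.has_derivative[OF bounded_linear_vec_nth] has_derivative_ident)
    from has_derivative_diff[OF dq(2) this] show ?thesis by (simp add: d(2))
  qed
  then obtain c where c: "\<And>x. q x - (\<Sum>i\<in>UNIV. x $ i *\<^sub>R d i) = c"
    using has_derivative_zero_constant[OF convex_UNIV, of "\<lambda>x. q x - (\<Sum>i\<in>UNIV. x $ i *\<^sub>R d i)"] by blast
  have "c = q 0" using c[of 0] by simp
  then have "c \<in> V" using polys_value[OF assms] by simp
  moreover have "q = (\<lambda>x. c + (\<Sum>i\<in>UNIV. x $ i *\<^sub>R d i))"
    using c by (metis (no_types, lifting) ext diff_add_cancel)
  ultimately show ?thesis using d by blast
qed

section \<open>The Worsey--Farin refinement is a mesh\<close>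

text \<open>A point of the cone in the face \<open>G\<close> cannot lie strictly inside a segment
  from \<open>x\<close> to a base point: the face would then contain \<open>x\<close>, but a proper
  face misses the relative interior.\<close>

lemma cone_Int_face:
  fixes P :: "'a::euclidean_space set"
  assumes "convex P" "x \<in> rel_interior P" "convex B" "B \<subseteq> P" "G face_of P" "G \<noteq> P"
  shows "convex hull (insert x B) \<inter> G \<subseteq> B"
proof
  fix y assume y: "y \<in> convex hull (insert x B) \<inter> G"
  have xG: "x \<notin> G"
    using face_of_disjoint_rel_interior[OF assms(5,6)] assms(2) by blast
  show "y \<in> B"
  proof (cases "B = {}")
    case True then show ?thesis using y xG by auto
  next
    case False
    then obtain b where b: "b \<in> B" "y \<in> closed_segment x b"
      using y convex_hull_insert_segments[of x B] convex_hull_eq[of B] assms(3) by (auto simp: hull_same)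
    have "x \<in> P" using assms(2) rel_interior_subset by blast
    then have "y \<notin> open_segment x b"
      using face_ofD[OF assms(5), of y x b] b(1) assms(4) y xG by blast
    then show ?thesis using b xG y by (auto simp: open_segment_def)
  qed
qed

lemma cone_subset:
  fixes P :: "'a::euclidean_space set"
  assumes "convex P" "x \<in> rel_interior P" "B \<subseteq> P"
  shows "convex hull (insert x B) \<subseteq> P"
  by (rule hull_minimal) (use assms rel_interior_subset[of P] in auto)

lemma proper_face_subset_rel_frontier:
  fixes P :: "'a::euclidean_space set"
  assumes "polytope P" "G face_of P" "G \<noteq> P"
  shows "G \<subseteq> rel_frontier P"
  using face_of_subset_rel_frontier assms by blast

text \<open>One coning step, used twice: triangles are split over their edges, then tetrahedra over
  their split faces. Conformity of the bases passes to the cones.\<close>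

lemma star_refinement:
  fixes \<P> :: "'a::euclidean_space set set"
  assumes P: "\<And>P. P \<in> \<P> \<Longrightarrow> polytope P" and x: "\<And>P. P \<in> \<P> \<Longrightarrow> x P \<in> rel_interior P"
    and d: "\<And>P Q. P \<in> \<P> \<Longrightarrow> Q \<in> \<P> \<Longrightarrow> P \<noteq> Q \<Longrightarrow> P \<inter> Q face_of P \<and> P \<inter> Q \<noteq> P"
    and B: "\<And>P B. P \<in> \<P> \<Longrightarrow> B \<in> \<B> P \<Longrightarrow> polytope B \<and> (\<exists>G. G face_of P \<and> G \<noteq> P \<and> B \<subseteq> G)"
    and I: "\<And>P Q B C. P \<in> \<P> \<Longrightarrow> Q \<in> \<P> \<Longrightarrow> B \<in> \<B> P \<Longrightarrow> C \<in> \<B> Q \<Longrightarrow> B \<inter> C face_of B"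
    and PQ: "P \<in> \<P>" "Q \<in> \<P>" "B \<in> \<B> P" "C \<in> \<B> Q"
  shows "convex hull (insert (x P) B) \<inter> convex hull (insert (x Q) C) face_of convex hull (insert (x P) B)"
proof -
  obtain G where G: "G face_of P" "G \<noteq> P" "B \<subseteq> G" using B[OF PQ(1,3)] by auto
  obtain H where H: "H face_of Q" "H \<noteq> Q" "C \<subseteq> H" using B[OF PQ(2,4)] by auto
  have BP: "B \<subseteq> P" and CQ: "C \<subseteq> Q" using G H face_of_imp_subset by blast+
  have pB: "polytope B" "polytope C" using B PQ by blast+
  have cB: "convex B" "convex C" using pB polytope_imp_convex by auto
  have cP: "convex P" "convex Q" using P PQ polytope_imp_convex by auto
  have "x P \<notin> affine hull G"
    using affine_hull_face_of_disjoint_rel_interior[OF cP(1) G(1,2)] x[OF PQ(1)] by blast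
  then have xB: "x P \<notin> affine hull B"
    using hull_mono[OF G(3)] by blast
  show ?thesis
  proof (cases "P = Q")
    case True
    \<comment> \<open>With a common apex, the two cones meet in the cone over the intersection of
      the bases.\<close>
    have "convex hull (insert (x P) B) \<inter> convex hull (insert (x P) C) = convex hull (insert (x P) (B \<inter> C))"
      by (rule convex_hull_insert_Int_eq[OF x[OF PQ(1)]])
         (use proper_face_subset_rel_frontier[OF P] G H cB cP True PQ in blast)+
    then show ?thesis
      using face_of_polytope_insert2[OF pB(1) xB I[OF PQ]] True by simp
  next
    case False
    let ?S = "convex hull (insert (x P) B)" and ?S' = "convex hull (insert (x Q) C)"
    have S: "?S \<subseteq> P" "?S' \<subseteq> Q"
      using x PQ BP CQ cP cone_subset by blast+
    \<comment> \<open>Cones over different cells can only meet in the common proper face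
      \<open>P \<inter> Q\<close>, and there each cone is reduced to its base.\<close>
    have "?S \<inter> (P \<inter> Q) \<subseteq> B"
      using cone_Int_face[OF cP(1) x[OF PQ(1)] cB(1) BP] d[OF PQ(1,2) False] by blast
    moreover have "?S' \<inter> (P \<inter> Q) \<subseteq> C"
      using cone_Int_face[OF cP(2) x[OF PQ(2)] cB(2) CQ] d[OF PQ(2,1)] False by (metis Int_commute)
    ultimately have "?S \<inter> ?S' = B \<inter> C"
      using S hull_subset[of "insert (x P) B" convex] hull_subset[of "insert (x Q) C" convex] by blast
    then show ?thesis
      using face_of_polytope_insert[OF pB(1) xB I[OF PQ]] by simp
  qed
qed

text \<open>Prolonging the segment from \<open>x\<close> through a given point until it leaves
  \<open>P\<close> ends in a facet. Positive dimension excludes \<open>P = {x}\<close>, where there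
  is no such end point.\<close>

lemma star_cover:
  fixes P :: "'a::euclidean_space set"
  assumes "polytope P" "aff_dim P > 0" "x \<in> rel_interior P"
  shows "(\<Union>F\<in>{F. F facet_of P}. convex hull (insert x F)) = P"
proof
  have c: "convex P" using assms polytope_imp_convex by auto
  show "(\<Union>F\<in>{F. F facet_of P}. convex hull (insert x F)) \<subseteq> P"
    using facet_of_imp_subset cone_subset[OF c assms(3)] by blast
  show "P \<subseteq> (\<Union>F\<in>{F. F facet_of P}. convex hull (insert x F))"
  proof
    fix y assume y: "y \<in> P"
    have "P \<noteq> {x}" using assms(2) by auto
    then obtain z where z: "z \<in> rel_frontier P" "y \<in> closed_segment x z"
      using segment_to_rel_frontier[OF c polytope_imp_bounded[OF assms(1)] assms(3) y] by blast
    have "rel_frontier P = P - rel_interior P"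
      using polytope_imp_closed[OF assms(1)] by (simp add: rel_frontier_def closure_closed)
    then obtain F where F: "F facet_of P" "z \<in> F"
      using z rel_boundary_of_polyhedron[OF polytope_imp_polyhedron[OF assms(1)]] by blast
    have "closed_segment x z \<subseteq> convex hull (insert x F)"
      unfolding segment_convex_hull by (rule hull_mono) (use F in auto)
    then show "y \<in> (\<Union>F\<in>{F. F facet_of P}. convex hull (insert x F))"
      using z F by auto
  qed
qed

lemma simplex_face:
  fixes T :: "'a::euclidean_space set"
  assumes "n simplex T" "f face_of T" shows "aff_dim f simplex f"
proof -
  obtain C where C: "\<not> affine_dependent C" "T = convex hull C"
    using assms(1) by (auto simp: simplex_def)
  then obtain D where D: "D \<subseteq> C" "f = convex hull D"
    using assms(2) face_of_convex_hull_affine_independent by blast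
  then have "\<not> affine_dependent D" using C affine_dependent_subset by blast
  then show ?thesis
    using D by (auto simp: simplex_def aff_dim_convex_hull aff_dim_affine_independent)
qed

lemma tetrahedral_meshD:
  assumes "tetrahedral_mesh \<Omega> \<W>"
  shows "finite \<W>" "\<And>T. T \<in> \<W> \<Longrightarrow> 3 simplex T" "\<Union>\<W> = closure \<Omega>"
    "\<And>T T'. T \<in> \<W> \<Longrightarrow> T' \<in> \<W> \<Longrightarrow> T \<inter> T' face_of T"
    "\<And>T T'. T \<in> \<W> \<Longrightarrow> T' \<in> \<W> \<Longrightarrow> T \<inter> T' face_of T'"
  using assms unfolding tetrahedral_mesh_def triangulation_def by (blast, blast, blast, blast, metis Int_commute)

text \<open>Otherwise \<open>P\<close> would be a proper face of \<open>Q\<close>, and proper faces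
  have smaller dimension.\<close>

lemma same_dim_Int:
  fixes P :: "'a::euclidean_space set"
  assumes "convex P" "convex Q" "aff_dim P = aff_dim Q" "P \<noteq> Q" "P \<inter> Q face_of Q"
  shows "P \<inter> Q \<noteq> P"
  using face_of_aff_dim_lt[OF assms(2,5)] assms(3,4) by force

text \<open>The point \<open>xf f\<close> depends on the face alone, so tetrahedra sharing a face
  split it alike. Coning can therefore proceed by dimension: within the family of all faces, then
  within the family of tetrahedra.\<close>

theorem worsey_farin_mesh:
  assumes m: "tetrahedral_mesh \<Omega> \<T>" and wf: "worsey_farin_refinement \<T> \<W>"
  shows "tetrahedral_mesh \<Omega> \<W>"
proof -
  note T = tetrahedral_meshD[OF m]
  obtain xT xf where xT: "\<And>T. T \<in> \<T> \<Longrightarrow> xT T \<in> interior T"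
    and xf: "\<And>T f. T \<in> \<T> \<Longrightarrow> f facet_of T \<Longrightarrow> xf f \<in> rel_interior f"
    and W: "\<W> = {convex hull (insert (xT T) t) | T f t. T \<in> \<T> \<and> f facet_of T \<and> t \<in> split_face (xf f) f}"
    using wf unfolding worsey_farin_refinement_def by blast
  define \<F> where "\<F> = {f. \<exists>T\<in>\<T>. f facet_of T}"
  have pT: "polytope T" "aff_dim T = 3" "convex T" if "T \<in> \<T>" for T
    using T(2)[OF that] simplex_imp_polytope aff_dim_simplex convex_simplex by auto
  have F2: "aff_dim f = 2" if "f \<in> \<F>" for f
    using that pT by (auto simp: \<F>_def facet_of_def)
  have Fs: "2 simplex f" if f: "f \<in> \<F>" for f
  proof -
    obtain S where "S \<in> \<T>" "f face_of S" using f by (auto simp: \<F>_def facet_of_def)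
    then show ?thesis using simplex_face[OF T(2)] F2[OF f] by metis
  qed
  have pF: "polytope f" "convex f" if "f \<in> \<F>" for f
    using Fs[OF that] simplex_imp_polytope convex_simplex by auto
  have Int_faces: "a \<inter> b face_of a" "a \<inter> b face_of b"
    if "a face_of S" "b face_of S'" "S \<in> \<T>" "S' \<in> \<T>" for a b S S'
    using face_of_Int_subface[OF T(4,5)] that by blast+
  have edge: "e edge_of f \<longleftrightarrow> e facet_of f" if "f \<in> \<F>" for e f
    using F2[OF that] by (auto simp: edge_of_def facet_of_def)
  have edge': "polytope e" "e face_of f" "e \<noteq> f" "1 simplex e" if "e edge_of f" "f \<in> \<F>" for e f
    using that F2[of f] pF[of f] face_of_polytope_polytope simplex_face[OF Fs[OF that(2)], of e]
    by (auto simp: edge_of_def)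
  \<comment> \<open>First stage: triangles from possibly different faces of possibly different
    tetrahedra are cones over edges of the original mesh.\<close>
  have split_Int: "s \<inter> t face_of s" if fg: "f \<in> \<F>" "g \<in> \<F>" "s \<in> split_face (xf f) f" "t \<in> split_face (xf g) g" for f g s t
  proof -
    obtain e e' where e: "e edge_of f" "s = convex hull (insert (xf f) e)"
      and e': "e' edge_of g" "t = convex hull (insert (xf g) e')"
      using fg(3,4) unfolding split_face_def by blast
    have "convex hull (insert (xf f) e) \<inter> convex hull (insert (xf g) e') face_of convex hull (insert (xf f) e)"
    proof (rule star_refinement[where \<P>=\<F> and x=xf and \<B>="\<lambda>f. {e. e edge_of f}"])
      fix P Q assume PQ: "P \<in> \<F>" "Q \<in> \<F>" "P \<noteq> Q"
      obtain S S' where S: "P face_of S" "Q face_of S'" "S \<in> \<T>" "S' \<in> \<T>"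
        using PQ by (auto simp: \<F>_def facet_of_def)
      show "P \<inter> Q face_of P \<and> P \<inter> Q \<noteq> P"
        using Int_faces[OF S] same_dim_Int[of P Q] pF F2 PQ by metis
    next
      fix P Q B C assume PQ: "P \<in> \<F>" "Q \<in> \<F>" "B \<in> {e. e edge_of P}" "C \<in> {e. e edge_of Q}"
      obtain S S' where S: "P face_of S" "Q face_of S'" "S \<in> \<T>" "S' \<in> \<T>"
        using PQ by (auto simp: \<F>_def facet_of_def)
      show "B \<inter> C face_of B"
        using Int_faces(1)[of B S C S'] S PQ face_of_trans[of B P S] face_of_trans[of C Q S'] by (auto simp: edge_of_def)
    next
      fix P B assume "P \<in> \<F>" "B \<in> {e. e edge_of P}"
      then show "polytope B \<and> (\<exists>G. G face_of P \<and> G \<noteq> P \<and> B \<subseteq> G)"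
        using edge'(1,2,3)[of B P] by auto
    qed (use pF xf e e' fg in \<open>auto simp: \<F>_def\<close>)
    then show ?thesis using e e' by simp
  qed
  have split: "polytope t" "t \<subseteq> f" "2 simplex t" if t: "f \<in> \<F>" "t \<in> split_face (xf f) f" for f t
  proof -
    obtain e where e: "e edge_of f" "t = convex hull (insert (xf f) e)"
      using t unfolding split_face_def by blast
    have x: "xf f \<in> rel_interior f" using xf t(1) by (auto simp: \<F>_def)
    have "xf f \<notin> affine hull e"
      using affine_hull_face_of_disjoint_rel_interior[OF pF(2) edge'(2,3)] x e t by blast
    then show "2 simplex t"
      using simplex_insert_dimplus1[OF edge'(4)[OF e(1) t(1)]] e by simp
    then show "polytope t" by (rule simplex_imp_polytope)
    show "t \<subseteq> f" unfolding e(2)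
      using cone_subset[OF pF(2)[OF t(1)] x face_of_imp_subset[OF edge'(2)[OF e(1) t(1)]]] .
  qed
  have split_cover: "\<Union>(split_face (xf f) f) = f" if f: "f \<in> \<F>" for f
  proof -
    have "\<Union>(split_face (xf f) f) = (\<Union>e\<in>{e. e facet_of f}. convex hull (insert (xf f) e))"
      unfolding split_face_def using edge[OF f] by auto
    also have "\<dots> = f"
      using star_cover[OF pF(1)[OF f]] F2[OF f] xf f by (auto simp: \<F>_def)
    finally show ?thesis .
  qed
  have xT': "xT S \<in> rel_interior S" if "S \<in> \<T>" for S
    using xT[OF that] interior_subset_rel_interior by blast
  have fS: "f \<in> \<F>" "f face_of S" "f \<noteq> S" if "f facet_of S" "S \<in> \<T>" for f S
    using that by (auto simp: \<F>_def facet_of_def)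
  have Int_W: "K \<inter> L face_of K" if KL: "K \<in> \<W>" "L \<in> \<W>" for K L
  proof -
    obtain S f s where K: "S \<in> \<T>" "f facet_of S" "s \<in> split_face (xf f) f" "K = convex hull (insert (xT S) s)"
      using KL W by blast
    obtain S' g t where L: "S' \<in> \<T>" "g facet_of S'" "t \<in> split_face (xf g) g" "L = convex hull (insert (xT S') t)"
      using KL W by blast
    have "convex hull (insert (xT S) s) \<inter> convex hull (insert (xT S') t) face_of convex hull (insert (xT S) s)"
    \<comment> \<open>Second stage: the bases over a tetrahedron are the triangles of all its split
      faces.\<close>
    proof (rule star_refinement[where \<P>=\<T> and x=xT and \<B>="\<lambda>S. \<Union>f\<in>{f. f facet_of S}. split_face (xf f) f"])
      fix P Q assume PQ: "P \<in> \<T>" "Q \<in> \<T>" "P \<noteq> Q"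
      show "P \<inter> Q face_of P \<and> P \<inter> Q \<noteq> P"
        using T(4,5)[OF PQ(1,2)] same_dim_Int[of P Q] pT PQ by metis
    next
      fix P B assume PB: "P \<in> \<T>" "B \<in> (\<Union>f\<in>{f. f facet_of P}. split_face (xf f) f)"
      then obtain f where f: "f facet_of P" "B \<in> split_face (xf f) f" by auto
      show "polytope B \<and> (\<exists>G. G face_of P \<and> G \<noteq> P \<and> B \<subseteq> G)"
        using fS[OF f(1) PB(1)] split(1,2)[OF fS(1)[OF f(1) PB(1)] f(2)] by auto
    next
      fix P Q B C assume PQ: "P \<in> \<T>" "Q \<in> \<T>" "B \<in> (\<Union>f\<in>{f. f facet_of P}. split_face (xf f) f)"
        "C \<in> (\<Union>f\<in>{f. f facet_of Q}. split_face (xf f) f)"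
      then obtain f g where "f facet_of P" "B \<in> split_face (xf f) f" "g facet_of Q" "C \<in> split_face (xf g) g" by auto
      then show "B \<inter> C face_of B" using split_Int[of f g B C] fS(1) PQ(1,2) by auto
    qed (use pT xT' K L in auto)
    then show ?thesis using K L by simp
  qed
  have W3: "3 simplex K" if KW: "K \<in> \<W>" for K
  proof -
    obtain S f s where K: "S \<in> \<T>" "f facet_of S" "s \<in> split_face (xf f) f" "K = convex hull (insert (xT S) s)"
      using KW W by blast
    have "xT S \<notin> affine hull f"
      using affine_hull_face_of_disjoint_rel_interior[OF pT(3) fS(2,3)] xT' K by blast
    then have "xT S \<notin> affine hull s" using hull_mono[OF split(2)] fS K by blast
    then show ?thesis
      using simplex_insert_dimplus1[OF split(3)] fS K by fastforce
  qed
  have "\<Union>\<W> = \<Union>\<T>"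
  proof -
    have "(\<Union>f\<in>{f. f facet_of S}. \<Union>s\<in>split_face (xf f) f. convex hull (insert (xT S) s)) = S" if S: "S \<in> \<T>" for S
    proof
      show "(\<Union>f\<in>{f. f facet_of S}. \<Union>s\<in>split_face (xf f) f. convex hull (insert (xT S) s)) \<subseteq> S"
      proof clarify
        fix f s y assume a: "f facet_of S" "s \<in> split_face (xf f) f" "y \<in> convex hull (insert (xT S) s)"
        have "s \<subseteq> S"
          using split(2)[OF fS(1)[OF a(1) S] a(2)] facet_of_imp_subset[OF a(1)] by blast
        then show "y \<in> S" using a(3) cone_subset[OF pT(3)[OF S] xT'[OF S]] by blast
      qed
      \<comment> \<open>A point of \<open>S\<close> lies on a segment from the apex to a point of a
        face, and that point lies in one of the triangles of the face.\<close>
      show "S \<subseteq> (\<Union>f\<in>{f. f facet_of S}. \<Union>s\<in>split_face (xf f) f. convex hull (insert (xT S) s))"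
      proof
        fix y assume "y \<in> S"
        then obtain f where f: "f facet_of S" "y \<in> convex hull (insert (xT S) f)"
          using star_cover[OF pT(1)[OF S] _ xT'[OF S]] pT(2)[OF S] by auto
        then obtain z where z: "z \<in> f" "y \<in> closed_segment (xT S) z"
          using convex_hull_insert_segments[of "xT S" f] pF(2)[OF fS(1)[OF f(1) S]] f(1)
          by (auto simp: hull_same facet_of_def)
        obtain s where s: "s \<in> split_face (xf f) f" "z \<in> s"
          using z(1) split_cover[OF fS(1)[OF f(1) S]] by blast
        have "closed_segment (xT S) z \<subseteq> convex hull (insert (xT S) s)"
          unfolding segment_convex_hull by (rule hull_mono) (use s in auto)
        then show "y \<in> (\<Union>f\<in>{f. f facet_of S}. \<Union>s\<in>split_face (xf f) f. convex hull (insert (xT S) s))"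
          using z f s by blast
      qed
    qed
    then show ?thesis unfolding W by blast
  qed
  moreover have "finite \<W>"
  proof -
    have "finite {f. f facet_of S}" if "S \<in> \<T>" for S
      by (rule finite_subset[OF _ finite_polytope_faces[OF pT(1)[OF that]]]) (auto simp: facet_of_def)
    moreover have "finite (split_face (xf f) f)" if "f \<in> \<F>" for f
    proof -
      have "finite {e. e edge_of f}"
        by (rule finite_subset[OF _ finite_polytope_faces[OF pF(1)[OF that]]]) (auto simp: edge_of_def)
      then show ?thesis unfolding split_face_def by simp
    qed
    ultimately have "finite (\<Union>S\<in>\<T>. \<Union>f\<in>{f. f facet_of S}. (\<lambda>t. convex hull (insert (xT S) t)) ` split_face (xf f) f)"
      using T(1) fS(1) by blast
    moreover have "\<W> = (\<Union>S\<in>\<T>. \<Union>f\<in>{f. f facet_of S}. (\<lambda>t. convex hull (insert (xT S) t)) ` split_face (xf f) f)"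
      unfolding W by blast
    ultimately show ?thesis by simp
  qed
  ultimately show ?thesis
    unfolding tetrahedral_mesh_def triangulation_def
    using T(3) W3 Int_W by (metis Int_commute)
qed

section \<open>Cells of a mesh, and neighbourhoods that isolate a cell\<close>

definition cells :: "(real^3) set set \<Rightarrow> int \<Rightarrow> (real^3) set set" where
  "cells \<W> d = {s. (\<exists>T\<in>\<W>. s face_of T) \<and> aff_dim s = d}"

lemma interior_cells_eq: "interior_cells \<Omega> \<W> d = {s \<in> cells \<W> d. \<not> s \<subseteq> frontier \<Omega>}"
  by (auto simp: interior_cells_def cells_def)

context
  fixes \<Omega> :: "(real^3) set" and \<W> :: "(real^3) set set"
  assumes mesh: "tetrahedral_mesh \<Omega> \<W>"
begin

lemma finite_cells: "finite (cells \<W> d)"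
proof -
  have "finite (\<Union>T\<in>\<W>. {s. s face_of T})"
    using tetrahedral_meshD[OF mesh] finite_polytope_faces simplex_imp_polytope by blast
  then show ?thesis by (rule rev_finite_subset) (auto simp: cells_def)
qed

lemma cells_simplex: "s \<in> cells \<W> d \<Longrightarrow> d simplex s"
  using simplex_face tetrahedral_meshD(2)[OF mesh] by (auto simp: cells_def)

lemma cells_subset: "s \<in> cells \<W> d \<Longrightarrow> s \<subseteq> closure \<Omega>"
  using tetrahedral_meshD(3)[OF mesh] face_of_imp_subset by (fastforce simp: cells_def)

lemma face_of_cell: "s \<in> cells \<W> d \<Longrightarrow> t face_of s \<Longrightarrow> aff_dim t = k \<Longrightarrow> t \<in> cells \<W> k"
  using face_of_trans by (fastforce simp: cells_def)

text \<open>The intersection is a face of \<open>A\<close> that meets the relative interior of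
  \<open>A\<close>, hence it is all of \<open>A\<close>.\<close>

lemma cells_meet:
  assumes "A \<in> cells \<W> a" "B \<in> cells \<W> b" "x \<in> rel_interior A" "x \<in> B"
  shows "A face_of B"
proof -
  obtain T T' where T: "T \<in> \<W>" "T' \<in> \<W>" "A face_of T" "B face_of T'"
    using assms by (auto simp: cells_def)
  have I: "A \<inter> B face_of A" "A \<inter> B face_of B"
    using face_of_Int_subface[OF tetrahedral_meshD(4,5)[OF mesh T(1,2)] T(3,4)] by auto
  have "A \<inter> B \<inter> rel_interior A \<noteq> {}" using assms rel_interior_subset by blast
  then have "A \<inter> B = A" using subset_of_face_of[OF I(1) order_refl] by blast
  then show ?thesis using I by simp
qed

lemma cells_meet_eq:
  assumes "A \<in> cells \<W> a" "B \<in> cells \<W> b" "x \<in> rel_interior A" "x \<in> B" "b \<le> a"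
  shows "A = B"
proof (rule ccontr)
  assume "A \<noteq> B"
  then have "aff_dim A < aff_dim B"
    using face_of_aff_dim_lt cells_meet[OF assms(1-4)] cells_simplex[OF assms(2)] convex_simplex by blast
  then show False using assms by (auto simp: cells_def)
qed

text \<open>The other cells of dimension at most \<open>a\<close> are finitely many closed sets that
  miss \<open>x\<close>. A bump supported in the ball therefore sees \<open>A\<close> alone among
  them, while cells of higher dimension around \<open>A\<close> remain visible.\<close>

lemma cell_isolated:
  assumes A: "A \<in> cells \<W> a" and x: "x \<in> rel_interior A" "x \<in> \<Omega>" and "open \<Omega>"
  obtains r where "r > 0" "cball x r \<subseteq> \<Omega>" "\<And>b B. B \<in> cells \<W> b \<Longrightarrow> b \<le> a \<Longrightarrow> B \<noteq> A \<Longrightarrow> B \<inter> cball x r = {}"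
proof -
  define \<U> where "\<U> = {B. (\<exists>b\<le>a. B \<in> cells \<W> b) \<and> B \<noteq> A}"
  have "\<U> \<subseteq> (\<Union>T\<in>\<W>. {s. s face_of T})" by (auto simp: \<U>_def cells_def)
  moreover have "finite (\<Union>T\<in>\<W>. {s. s face_of T})"
    using tetrahedral_meshD[OF mesh] finite_polytope_faces simplex_imp_polytope by blast
  ultimately have "finite \<U>" by (rule finite_subset)
  moreover have "closed B" if "B \<in> \<U>" for B
    using that cells_simplex closed_simplex by (auto simp: \<U>_def)
  ultimately have "closed (\<Union>\<U>)" by auto
  moreover have "x \<notin> \<Union>\<U>"
    using cells_meet_eq[OF A _ x(1)] by (auto simp: \<U>_def)
  ultimately have "open (\<Omega> - \<Union>\<U>)" "x \<in> \<Omega> - \<Union>\<U>"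
    using assms by auto
  then obtain r where "r > 0" "cball x r \<subseteq> \<Omega> - \<Union>\<U>"
    using open_contains_cball by metis
  then show thesis by (intro that[of r]) (auto simp: \<U>_def)
qed

text \<open>The relative interior is dense in the closed convex cell, so the open set
  \<open>\<Omega>\<close>, which meets the cell, meets it as well.\<close>

lemma interior_cell_point:
  assumes "A \<in> interior_cells \<Omega> \<W> a" "open \<Omega>"
  shows "\<exists>x. x \<in> rel_interior A \<and> x \<in> \<Omega>"
proof -
  have A: "A \<in> cells \<W> a" "\<not> A \<subseteq> frontier \<Omega>" using assms by (auto simp: interior_cells_eq)
  then obtain y where y: "y \<in> A" "y \<in> \<Omega>"
    using cells_subset[OF A(1)] assms(2) by (auto simp: frontier_def interior_open)
  have "convex A" "closed A" using cells_simplex[OF A(1)] convex_simplex closed_simplex by auto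
  then have "y \<in> closure (rel_interior A)"
    using y by (simp add: convex_closure_rel_interior)
  then have "\<Omega> \<inter> rel_interior A \<noteq> {}"
    using y(2) open_Int_closure_eq_empty[OF assms(2), of "rel_interior A"] by blast
  then show ?thesis by blast
qed

end

section \<open>Integration over flat sets\<close>

text \<open>Checked on boxes, whose preimages are linear images with known volume. As an identity of
  measures it carries over to all integrals.\<close>

lemma lborel_eq_linear:
  fixes N :: "real^'n::{finite,wellorder} \<Rightarrow> real^'n::_"
  assumes "linear N" "inj N"
  shows "(lborel :: (real^'n::_) measure) = density (distr lborel borel N) (\<lambda>_. ennreal \<bar>det (matrix N)\<bar>)"
proof (rule lborel_eqI)
  fix l u :: "real^'n::_" assume le: "\<And>b. b \<in> Basis \<Longrightarrow> l \<bullet> b \<le> u \<bullet> b"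
  obtain M where M: "linear M" "\<And>x. M (N x) = x" "\<And>x. N (M x) = x"
    using linear_injective_isomorphism[OF assms] by blast
  have d: "det (matrix N) \<noteq> 0" using det_nz_iff_inj[OF assms(1)] assms(2) by simp
  have Nb: "N \<in> borel_measurable borel"
    using assms(1) by (intro borel_measurable_continuous_onI linear_continuous_on) (simp add: linear_conv_bounded_linear)
  have "N -` box l u = M ` box l u" using M by (auto simp: image_iff) metis
  moreover have "N ` (M ` box l u) = box l u" using M(3) by (simp add: image_image)
  moreover have Ms: "M ` box l u \<in> sets borel"
    using measurable_sets[OF Nb borel_open[OF open_box[of l u]]] calculation(1) by simp
  moreover have bM: "bounded (M ` box l u)"
    using M(1) by (intro bounded_linear_image) (auto simp: linear_conv_bounded_linear)
  ultimately have 1: "measure lebesgue (box l u) = \<bar>det (matrix N)\<bar> * measure lebesgue (M ` box l u)"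
    using measure_lebesgue_linear_transformation[OF bM _ assms(1)] by auto
  have "emeasure (density (distr lborel borel N) (\<lambda>_. ennreal \<bar>det (matrix N)\<bar>)) (box l u)
      = ennreal \<bar>det (matrix N)\<bar> * emeasure lborel (M ` box l u)"
    using Nb \<open>N -` box l u = M ` box l u\<close>
    by (subst emeasure_density) (auto simp: nn_integral_cmult emeasure_distr)
  also have "emeasure lborel (M ` box l u) = ennreal (measure lborel (M ` box l u))"
    using emeasure_bounded_finite[OF bM] by (intro emeasure_eq_ennreal_measure) auto
  also have "ennreal \<bar>det (matrix N)\<bar> * \<dots> = ennreal (measure lborel (box l u))"
    using 1 Ms by (simp add: ennreal_mult'[symmetric] measure_completion)
  also have "\<dots> = ennreal (\<Prod>b\<in>Basis. (u - l) \<bullet> b)"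
    using le by (simp add: measure_lborel_box_eq)
  finally show "emeasure (density (distr lborel borel N) (\<lambda>_. ennreal \<bar>det (matrix N)\<bar>)) (box l u) = ennreal (\<Prod>b\<in>Basis. (u - l) \<bullet> b)" .
qed simp

text \<open>Only the existence of a positive factor is recorded, uniform in the shift and the
  integrand. This hides the difference between the types \<open>real\<close> and
  \<open>real^'n\<close> and keeps determinants out of the later arguments; the factor is found
  afterwards from the integrand 1.\<close>

definition linear_cov :: "'d::euclidean_space itself \<Rightarrow> bool" where
  "linear_cov D \<longleftrightarrow> (\<forall>N :: 'd \<Rightarrow> 'd. linear N \<longrightarrow> inj N \<longrightarrow>
     (\<exists>\<kappa>>0. \<forall>z. \<forall>f\<in>borel_measurable borel. integral\<^sup>L lborel f = \<kappa> * integral\<^sup>L lborel (\<lambda>y. f (z + N y) :: real)))"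

lemma lborel_integral_translation:
  fixes f :: "'d::euclidean_space \<Rightarrow> real"
  assumes "f \<in> borel_measurable borel"
  shows "integral\<^sup>L lborel f = integral\<^sup>L lborel (\<lambda>y. f (z + y))"
  using assms by (subst lborel_distr_plus[of z, symmetric]) (simp add: integral_distr)

lemma linear_cov_vec: "linear_cov (TYPE(real^('n::{finite,wellorder})))"
  unfolding linear_cov_def
proof (intro allI impI)
  fix N :: "real^'n::_ \<Rightarrow> real^'n::_" assume N: "linear N" "inj N"
  have Nb: "N \<in> borel_measurable borel"
    using N(1) by (intro borel_measurable_continuous_onI linear_continuous_on) (simp add: linear_conv_bounded_linear)
  show "\<exists>\<kappa>>0. \<forall>z. \<forall>f\<in>borel_measurable borel. integral\<^sup>L lborel f = \<kappa> * integral\<^sup>L lborel (\<lambda>y. f (z + N y) :: real)"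
  proof (intro exI[of _ "\<bar>det (matrix N)\<bar>"] conjI allI ballI)
    show "\<bar>det (matrix N)\<bar> > 0" using det_nz_iff_inj[OF N(1)] N(2) by simp
    fix z :: "real^'n::_" and f :: "real^'n::_ \<Rightarrow> real" assume f[measurable]: "f \<in> borel_measurable borel"
    have "integral\<^sup>L lborel f = integral\<^sup>L lborel (\<lambda>y. f (z + y))"
      by (rule lborel_integral_translation[OF f])
    also have "\<dots> = integral\<^sup>L (density (distr lborel borel N) (\<lambda>_. ennreal \<bar>det (matrix N)\<bar>)) (\<lambda>y. f (z + y))"
      using lborel_eq_linear[OF N] by simp
    also have "\<dots> = integral\<^sup>L (distr lborel borel N) (\<lambda>y. \<bar>det (matrix N)\<bar> *\<^sub>R f (z + y))"
      by (subst integral_density) auto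
    also have "\<dots> = integral\<^sup>L lborel (\<lambda>y. \<bar>det (matrix N)\<bar> *\<^sub>R f (z + N y))"
      using Nb by (subst integral_distr) auto
    finally show "integral\<^sup>L lborel f = \<bar>det (matrix N)\<bar> * integral\<^sup>L lborel (\<lambda>y. f (z + N y))" by simp
  qed
qed

lemma linear_cov_real: "linear_cov TYPE(real)"
  unfolding linear_cov_def
proof (intro allI impI)
  fix N :: "real \<Rightarrow> real" assume N: "linear N" "inj N"
  define c where "c = N 1"
  have Nc: "N y = c * y" for y
    using linear_cmul[OF N(1), of y 1] by (simp add: c_def mult.commute)
  have "c \<noteq> 0" using N(2) Nc injD[OF N(2), of 0 1] by auto
  have "integral\<^sup>L lborel f = \<bar>c\<bar> * (\<integral>y. f (z + N y) \<partial>lborel)" for z and f :: "real \<Rightarrow> real"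
    using lborel_integral_real_affine[OF \<open>c \<noteq> 0\<close>, of f z] by (simp add: Nc)
  then show "\<exists>\<kappa>>0. \<forall>z. \<forall>f\<in>borel_measurable borel. integral\<^sup>L lborel f = \<kappa> * integral\<^sup>L lborel (\<lambda>y. f (z + N y) :: real)"
    using \<open>c \<noteq> 0\<close> by (intro exI[of _ "\<bar>c\<bar>"]) simp
qed

section \<open>Integrals of continuous functions over compact sets\<close>

abbreviation set_int :: "'d::euclidean_space set \<Rightarrow> ('d \<Rightarrow> 'v) \<Rightarrow> 'v::euclidean_space" where
  "set_int S g \<equiv> set_lebesgue_integral lborel S g"

lemma set_integrable_compact:
  fixes g :: "'d::euclidean_space \<Rightarrow> 'v::euclidean_space"
  assumes "compact S" "continuous_on S g" shows "set_integrable lborel S g"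
  unfolding set_integrable_def by (rule borel_integrable_compact[OF assms])

lemma set_int_cong: "(\<And>x. x \<in> S \<Longrightarrow> f x = g x) \<Longrightarrow> set_int S f = set_int S g"
  unfolding set_lebesgue_integral_def by (intro Bochner_Integration.integral_cong) (auto simp: indicator_def)

lemma set_int_linear:
  fixes f :: "'d::euclidean_space \<Rightarrow> 'v::euclidean_space" and h :: "'v \<Rightarrow> 'w::euclidean_space"
  assumes "bounded_linear h" "compact S" "continuous_on S f"
  shows "set_int S (\<lambda>x. h (f x)) = h (set_int S f)"
proof -
  have "set_int S (\<lambda>x. h (f x)) = integral\<^sup>L lborel (\<lambda>x. h (indicator S x *\<^sub>R f x))"
    unfolding set_lebesgue_integral_def
    by (intro Bochner_Integration.integral_cong) (auto simp: indicator_def linear_simps[OF assms(1)])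
  also have "\<dots> = h (set_int S f)"
    using integral_bounded_linear[OF assms(1) set_integrable_compact[OF assms(2,3), unfolded set_integrable_def]]
    by (simp add: set_lebesgue_integral_def)
  finally show ?thesis .
qed

text \<open>A nonnegative function with zero integral vanishes almost everywhere, but
  \<open>f\<close> is positive near \<open>x\<close>, and in a convex body every neighbourhood of
  \<open>x\<close> contains interior points.\<close>

lemma set_int_positive:
  fixes f :: "'d::euclidean_space \<Rightarrow> real"
  assumes S: "compact S" "convex S" "interior S \<noteq> {}" and f: "continuous_on S f" "\<And>x. x \<in> S \<Longrightarrow> f x \<ge> 0"
    and x: "x \<in> S" "f x > 0"
  shows "set_int S f > 0"
proof -
  have i: "integrable lborel (\<lambda>x. indicator S x *\<^sub>R f x)"
    by (rule borel_integrable_compact[OF S(1) f(1)])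
  have nn: "AE x in lborel. 0 \<le> indicator S x *\<^sub>R f x" using f(2) by (auto simp: indicator_def)
  have "set_int S f \<noteq> 0"
  proof
    assume "set_int S f = 0"
    then have ae: "AE x in lborel. indicator S x *\<^sub>R f x = 0"
      using integral_nonneg_eq_0_iff_AE[OF i nn] by (simp add: set_lebesgue_integral_def)
    obtain e where e: "e > 0" "\<And>y. y \<in> S \<Longrightarrow> dist y x < e \<Longrightarrow> dist (f y) (f x) < f x"
      using f(1)[unfolded continuous_on_iff] x by meson
    let ?U = "ball x e \<inter> interior S"
    have "x \<in> closure (interior S)"
      using x(1) S convex_closure_interior[OF S(2,3)] closure_subset by blast
    then have "?U \<noteq> {}"
      using e(1) open_Int_closure_eq_empty[OF open_ball, of x e "interior S"] centre_in_ball by blast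
    moreover have "open ?U" by auto
    ultimately have "\<not> negligible ?U" by (rule open_not_negligible[rotated])
    moreover have "negligible ?U"
    proof -
      have "AE y in lborel. y \<notin> ?U"
        using ae
      proof eventually_elim
        case (elim y)
        show ?case
        proof
          assume y: "y \<in> ?U"
          then have "y \<in> S" using interior_subset by auto
          then have "dist (f y) (f x) < f x" using e(2)[of y] y by (simp add: dist_commute[of x])
          then have "f y > 0" by (auto simp: dist_real_def)
          then show False using elim \<open>y \<in> S\<close> by simp
        qed
      qed
      then have "?U \<in> null_sets lborel"
        by (subst (asm) AE_iff_null_sets[symmetric]) auto
      then show ?thesis by (simp add: negligible_iff_null_sets null_sets_completionI)
    qed
    ultimately show False by simp
  qed
  moreover have "set_int S f \<ge> 0"
    unfolding set_lebesgue_integral_def by (rule integral_nonneg_AE[OF nn])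
  ultimately show ?thesis by simp
qed

lemma linear_cov_image:
  fixes N :: "'d::euclidean_space \<Rightarrow> 'd"
  assumes "linear_cov TYPE('d)" "linear N" "inj N"
  obtains \<kappa> where "\<kappa> > 0" "\<And>z S (g :: 'd \<Rightarrow> real). compact S \<Longrightarrow> continuous_on UNIV g \<Longrightarrow>
     set_int ((\<lambda>y. z + N y) ` S) g = \<kappa> * set_int S (\<lambda>y. g (z + N y))"
proof -
  obtain \<kappa> where k: "\<kappa> > 0"
    "\<And>z (f :: 'd \<Rightarrow> real). f \<in> borel_measurable borel \<Longrightarrow> integral\<^sup>L lborel f = \<kappa> * integral\<^sup>L lborel (\<lambda>y. f (z + N y))"
    using assms unfolding linear_cov_def by blast
  show thesis
  proof (rule that[OF k(1)])
    fix z :: 'd and S :: "'d set" and g :: "'d \<Rightarrow> real" assume S: "compact S" and g: "continuous_on UNIV g"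
    have "continuous_on S (\<lambda>y. z + N y)"
      using assms(2) by (intro continuous_intros linear_continuous_on) (simp add: linear_conv_bounded_linear)
    then have "compact ((\<lambda>y. z + N y) ` S)" using S compact_continuous_image by blast
    then have m: "(\<lambda>x. indicator ((\<lambda>y. z + N y) ` S) x *\<^sub>R g x) \<in> borel_measurable borel"
      using borel_measurable_integrable[OF borel_integrable_compact[OF _ continuous_on_subset[OF g subset_UNIV]]] by simp
    have "indicator ((\<lambda>y. z + N y) ` S) (z + N y) = (indicator S y :: real)" for y
      using injD[OF assms(3)] by (auto simp: indicator_def image_iff)
    then show "set_int ((\<lambda>y. z + N y) ` S) g = \<kappa> * set_int S (\<lambda>y. g (z + N y))"
      unfolding set_lebesgue_integral_def by (subst k(2)[OF m, of z]) simp
  qed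
qed

text \<open>The chart chosen inside \<open>flat_integral\<close>, given a name so that its
  properties can be derived from the choice.\<close>

definition chart :: "'d::euclidean_space itself \<Rightarrow> (real^3) set \<Rightarrow> (real^3) \<times> ('d \<Rightarrow> real^3)" where
  "chart D s = (SOME (a, L). linear (L :: 'd \<Rightarrow> real^3) \<and> (\<forall>y. norm (L y) = norm y) \<and>
                      range (\<lambda>y. a + L y) = affine hull s)"

lemma flat_integral_chart:
  "flat_integral (D :: 'd::euclidean_space itself) s g
    = set_int {y. fst (chart D s) + snd (chart D s) y \<in> s} (\<lambda>y. g (fst (chart D s) + snd (chart D s) y))"
  unfolding flat_integral_def chart_def by (simp only: Let_def split_beta)

text \<open>A chart exists because the direction space of the affine hull has the dimension of
  \<open>'d\<close> and is therefore linearly isometric to it.\<close>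

lemma chart_props:
  assumes "aff_dim s = int DIM('d::euclidean_space)"
  shows "linear (snd (chart TYPE('d) s))" "norm (snd (chart TYPE('d) s) y) = norm y"
    "range (\<lambda>y. fst (chart TYPE('d) s) + snd (chart TYPE('d) s) y) = affine hull s"
proof -
  have "s \<noteq> {}" using assms by auto
  then obtain a where a: "a \<in> s" by blast
  define U where "U = span ((\<lambda>x. - a + x) ` s)"
  have hull: "affine hull s = (\<lambda>x. a + x) ` U"
    unfolding U_def by (rule affine_hull_span_gen[OF hull_inc[OF a]])
  have "int (dim U) = aff_dim s"
    unfolding U_def dim_span using aff_dim_eq_dim[OF hull_inc[OF a, of affine]] by simp
  then have d: "dim (UNIV :: 'd set) = dim U" using assms by simp
  have sU: "subspace U" by (simp add: U_def)
  obtain L :: "'d \<Rightarrow> real^3" and g where L: "linear L" "linear g" "L ` UNIV = U" "g ` U = UNIV"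
    "\<And>y. y \<in> UNIV \<Longrightarrow> norm (L y) = norm y" "\<And>x. x \<in> U \<Longrightarrow> norm (g x) = norm x"
    "\<And>y. y \<in> UNIV \<Longrightarrow> g (L y) = y" "\<And>x. x \<in> U \<Longrightarrow> L (g x) = x"
    by (rule isometries_subspaces[OF subspace_UNIV sU d]; rule that; assumption)
  have "range (\<lambda>y. a + L y) = affine hull s" unfolding hull L(3)[symmetric] by auto
  then have ex: "\<exists>p. (case p of (a, L) \<Rightarrow> linear (L :: 'd \<Rightarrow> real^3) \<and> (\<forall>y. norm (L y) = norm y) \<and>
                      range (\<lambda>y. a + L y) = affine hull s)"
    using L(1,5) by (intro exI[of _ "(a, L)"]) simp
  have "case chart TYPE('d) s of (a, L) \<Rightarrow> linear (L :: 'd \<Rightarrow> real^3) \<and> (\<forall>y. norm (L y) = norm y) \<and>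
                      range (\<lambda>y. a + L y) = affine hull s"
    unfolding chart_def by (rule someI_ex[OF ex])
  then show "linear (snd (chart TYPE('d) s))" "norm (snd (chart TYPE('d) s) y) = norm y"
    "range (\<lambda>y. fst (chart TYPE('d) s) + snd (chart TYPE('d) s) y) = affine hull s"
    by (simp_all add: split_beta)
qed

text \<open>The linear part of the chart preserves norms, so preimages of bounded sets are
  bounded.\<close>

lemma chart_preimage_compact:
  assumes "aff_dim s = int DIM('d::euclidean_space)" "compact s"
  shows "compact {y. fst (chart TYPE('d) s) + snd (chart TYPE('d) s) y \<in> s}" (is "compact ?C")
    "continuous_on S (\<lambda>y. fst (chart TYPE('d) s) + snd (chart TYPE('d) s) y)"
proof -
  let ?a = "fst (chart TYPE('d) s)" and ?L = "snd (chart TYPE('d) s)"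
  note c = chart_props[OF assms(1)]
  show cont: "continuous_on S (\<lambda>y. ?a + ?L y)" for S
    using c(1) by (intro continuous_intros linear_continuous_on) (simp add: linear_conv_bounded_linear)
  have "closed ?C"
    using continuous_closed_preimage[OF cont[of UNIV] closed_UNIV compact_imp_closed[OF assms(2)]]
    by (simp add: vimage_def)
  moreover have "bounded ?C"
  proof -
    obtain B where B: "\<And>x. x \<in> s \<Longrightarrow> norm x \<le> B" using compact_imp_bounded[OF assms(2)] bounded_iff by blast
    have "norm y \<le> B + norm ?a" if "y \<in> ?C" for y
    proof -
      have "norm (?L y) \<le> norm (?a + ?L y) + norm ?a" by norm
      then show ?thesis using B[of "?a + ?L y"] that c(2)[of y] by simp
    qed
    then show ?thesis using bounded_iff by blast
  qed
  ultimately show "compact ?C" using compact_eq_bounded_closed by blast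
qed

lemma flat_integral_cong: "(\<And>x. x \<in> s \<Longrightarrow> f x = g x) \<Longrightarrow> flat_integral D s f = flat_integral D s g"
  unfolding flat_integral_chart by (intro set_int_cong) auto

lemma flat_integral_linear:
  fixes f :: "real^3 \<Rightarrow> 'v::euclidean_space" and h :: "'v \<Rightarrow> 'w::euclidean_space"
  assumes "aff_dim s = int DIM('d::euclidean_space)" "compact s" "bounded_linear h" "continuous_on UNIV f"
  shows "flat_integral TYPE('d) s (\<lambda>x. h (f x)) = h (flat_integral TYPE('d) s f)"
  unfolding flat_integral_chart
  by (rule set_int_linear[OF assms(3) chart_preimage_compact(1)[OF assms(1,2)]])
     (rule continuous_on_compose2[OF assms(4) chart_preimage_compact(2)[OF assms(1,2)]], simp)

lemma flat_integral_add:
  fixes f g :: "real^3 \<Rightarrow> 'v::euclidean_space"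
  assumes "aff_dim s = int DIM('d::euclidean_space)" "compact s" "continuous_on UNIV f" "continuous_on UNIV g"
  shows "flat_integral TYPE('d) s (\<lambda>x. f x + g x) = flat_integral TYPE('d) s f + flat_integral TYPE('d) s g"
  unfolding flat_integral_chart
  by (intro set_integral_add set_integrable_compact chart_preimage_compact[OF assms(1,2)] continuous_on_compose2[OF assms(3) chart_preimage_compact(2)[OF assms(1,2)]] continuous_on_compose2[OF assms(4) chart_preimage_compact(2)[OF assms(1,2)]] subset_UNIV)

text \<open>An injective affine parametrization over \<open>K\<close> may replace the isometric
  chart at the price of one positive factor, independent of the integrand. That \<open>K\<close>
  contains 0 and \<open>Basis\<close> forces the range of \<open>M\<close> into the directions of
  \<open>s\<close>.\<close>

lemma flat_integral_param:
  fixes M :: "'d::euclidean_space \<Rightarrow> real^3"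
  assumes cov: "linear_cov TYPE('d)" and M: "linear M" "inj M"
    and K: "compact K" "0 \<in> K" "Basis \<subseteq> K" and s: "s = (\<lambda>y. v + M y) ` K" and dim: "aff_dim s = int DIM('d)"
  obtains \<kappa> where "\<kappa> > 0" "\<And>g :: real^3 \<Rightarrow> real. continuous_on UNIV g \<Longrightarrow>
     flat_integral TYPE('d) s g = \<kappa> * set_int K (\<lambda>y. g (v + M y))"
proof -
  let ?a = "fst (chart TYPE('d) s)" and ?L = "snd (chart TYPE('d) s)"
  note c = chart_props[OF dim]
  \<comment> \<open>The adjoint of the isometry \<open>?L\<close> is a left inverse, and it inverts
    \<open>?L\<close> on the range.\<close>
  let ?A = "adjoint ?L"
  have A: "linear ?A" by (rule adjoint_linear[OF c(1)])
  have LL: "?L x \<bullet> ?L y = x \<bullet> y" for x y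
    using c(2)[of "x + y"] c(2)[of x] c(2)[of y] linear_add[OF c(1)]
    by (metis (no_types, lifting) dot_norm)
  have AL: "?A (?L y) = y" for y
  proof -
    have "x \<bullet> ?A (?L y) = x \<bullet> y" for x using adjoint_works[OF c(1), of x "?L y"] LL by simp
    then show ?thesis by (metis vector_eq_rdot inner_commute)
  qed
  have ra: "\<exists>z. ?a + ?L z = x" if "x \<in> s" for x
  proof -
    have "x \<in> range (\<lambda>y. ?a + ?L y)" unfolding c(3) by (rule hull_inc[OF that])
    then show ?thesis by auto
  qed
  have Mr: "M y \<in> range ?L" for y
  proof -
    have "M b \<in> range ?L" if "b \<in> Basis" for b
    proof -
      have in_s: "v + M 0 \<in> s" "v + M b \<in> s" using K that s by auto
      obtain z0 where z0: "?a + ?L z0 = v + M 0" using ra[OF in_s(1)] by auto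
      obtain z1 where z1: "?a + ?L z1 = v + M b" using ra[OF in_s(2)] by auto
      have "?L (z1 - z0) = (?a + ?L z1) - (?a + ?L z0)" by (simp add: linear_diff[OF c(1)])
      also have "\<dots> = M b" unfolding z0 z1 by (simp add: linear_0[OF M(1)])
      finally have "M b = ?L (z1 - z0)" ..
      then show ?thesis by blast
    qed
    moreover have "subspace (range ?L)" using c(1) by (rule linear_subspace_image[OF _ subspace_UNIV])
    moreover have "M y = (\<Sum>b\<in>Basis. (y \<bullet> b) *\<^sub>R M b)"
      by (subst euclidean_representation[of y, symmetric]) (simp add: linear_sum[OF M(1)] linear_scale[OF M(1)])
    ultimately show ?thesis by (simp add: subspace_sum subspace_scale)
  qed
  have LAM: "?L (?A (M y)) = M y" for y using Mr[of y] AL by auto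
  \<comment> \<open>The parametrization and the chart differ by an affine map of the parameter
    space, with linear part \<open>N\<close> and shift \<open>z\<close>.\<close>
  define N where "N y = ?A (M y)" for y
  have N: "linear N" "inj N"
  proof -
    show "linear N" using linear_compose[OF M(1) A] by (simp add: N_def[abs_def] o_def)
    show "inj N"
    proof (rule injI)
      fix x y assume "N x = N y"
      then have "?L (?A (M x)) = ?L (?A (M y))" by (simp add: N_def)
      then show "x = y" using LAM M(2) by (simp add: inj_eq)
    qed
  qed
  define z where "z = ?A (v - ?a)"
  have key: "v + M y = ?a + ?L (z + N y)" if y: "y \<in> K" for y
  proof -
    obtain w where w: "?a + ?L w = v + M y" using ra[of "v + M y"] y s by auto
    then have "?L w = (v - ?a) + M y" by (simp add: algebra_simps)
    then have "w = z + N y" using AL[of w] linear_add[OF A] by (simp add: z_def N_def)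
    then show ?thesis using w by simp
  qed
  have iL: "inj ?L" using AL by (metis injI)
  have pre: "{y. ?a + ?L y \<in> s} = (\<lambda>y. z + N y) ` K"
  proof (intro set_eqI iffI)
    fix w assume "w \<in> {y. ?a + ?L y \<in> s}"
    then obtain y where y: "y \<in> K" "?a + ?L w = v + M y" using s by auto
    then have "?L w = ?L (z + N y)" using key[OF y(1)] by simp
    then show "w \<in> (\<lambda>y. z + N y) ` K" using injD[OF iL] y(1) by blast
  next
    fix w assume "w \<in> (\<lambda>y. z + N y) ` K"
    then obtain y where y: "y \<in> K" "w = z + N y" by auto
    then have "?a + ?L w = v + M y" using key by simp
    then show "w \<in> {y. ?a + ?L y \<in> s}" using y(1) s by auto
  qed
  obtain \<kappa> where k: "\<kappa> > 0" "\<And>z S (g :: 'd \<Rightarrow> real). compact S \<Longrightarrow> continuous_on UNIV g \<Longrightarrow>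
     set_int ((\<lambda>y. z + N y) ` S) g = \<kappa> * set_int S (\<lambda>y. g (z + N y))"
    by (rule linear_cov_image[OF cov N]; rule that; assumption)
  show thesis
  proof (rule that[OF k(1)])
    fix g :: "real^3 \<Rightarrow> real" assume g: "continuous_on UNIV g"
    have cL: "continuous_on UNIV (\<lambda>y. g (?a + ?L y))"
      using c(1) by (intro continuous_on_compose2[OF g] continuous_intros linear_continuous_on) (auto simp: linear_conv_bounded_linear)
    have "flat_integral TYPE('d) s g = \<kappa> * set_int K (\<lambda>y. g (?a + ?L (z + N y)))"
      unfolding flat_integral_chart pre by (rule k(2)[OF K(1) cL])
    also have "set_int K (\<lambda>y. g (?a + ?L (z + N y))) = set_int K (\<lambda>y. g (v + M y))"
      by (rule set_int_cong) (simp add: key)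
    finally show "flat_integral TYPE('d) s g = \<kappa> * set_int K (\<lambda>y. g (v + M y))" .
  qed
qed

section \<open>Green's formula on simplices\<close>

text \<open>The map \<open>h\<close> identifies pairs with points of a vector type and preserves
  Lebesgue measure. Fubini and the fundamental theorem of calculus along \<open>z\<close> reduce the
  integral of a derivative to the two graphs that bound \<open>D\<close>.\<close>

lemma fubini_FTC:
  fixes h :: "'e::euclidean_space \<times> real \<Rightarrow> 'd::euclidean_space"
  assumes h: "distr lborel borel h = lborel" "continuous_on UNIV h"
    and S: "compact S" "compact D" and \<tau>: "continuous_on UNIV \<tau>" "\<And>y. y \<in> S \<Longrightarrow> 0 \<le> \<tau> y"
    and D: "\<And>y z. h (y, z) \<in> D \<longleftrightarrow> y \<in> S \<and> 0 \<le> z \<and> z \<le> \<tau> y"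
    and f: "continuous_on UNIV f" "continuous_on UNIV f'"
    and der: "\<And>y z. ((\<lambda>z. f (h (y, z))) has_real_derivative f' (h (y, z))) (at z)"
  shows "set_int D f' = set_int S (\<lambda>y. f (h (y, \<tau> y))) - set_int S (\<lambda>y. f (h (y, 0)))"
proof -
  have [measurable]: "h \<in> borel_measurable borel" using h(2) by (rule borel_measurable_continuous_onI)
  let ?F = "\<lambda>x. indicator D x *\<^sub>R f' x"
  have i: "integrable lborel ?F"
    by (rule borel_integrable_compact[OF S(2) continuous_on_subset[OF f(2) subset_UNIV]])
  then have m: "?F \<in> borel_measurable borel" using borel_measurable_integrable by auto
  have hm: "h \<in> measurable lborel borel" by simp
  have i2: "integrable (lborel \<Otimes>\<^sub>M lborel) (\<lambda>p. ?F (h p))"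
    unfolding lborel_prod by (rule integrable_distr[OF hm]) (simp only: h(1) i)
  have "set_int D f' = integral\<^sup>L (distr lborel borel h) ?F"
    unfolding h(1) set_lebesgue_integral_def ..
  also have "\<dots> = integral\<^sup>L (lborel \<Otimes>\<^sub>M lborel) (\<lambda>p. ?F (h p))"
    unfolding lborel_prod by (rule integral_distr[OF hm m])
  also have "\<dots> = (\<integral>y. \<integral>z. ?F (h (y, z)) \<partial>lborel \<partial>lborel)"
    by (rule lborel_pair.integral_fst'[OF i2, symmetric])
  also have "\<dots> = (\<integral>y. indicator S y *\<^sub>R (f (h (y, \<tau> y)) - f (h (y, 0))) \<partial>lborel)"
  proof (rule Bochner_Integration.integral_cong[OF refl])
    fix y
    show "(\<integral>z. ?F (h (y, z)) \<partial>lborel) = indicator S y *\<^sub>R (f (h (y, \<tau> y)) - f (h (y, 0)))"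
    proof (cases "y \<in> S")
      case False then show ?thesis using D by simp
    next
      case True
      have "(\<integral>z. ?F (h (y, z)) \<partial>lborel) = (\<integral>z. f' (h (y, z)) * indicator {0..\<tau> y} z \<partial>lborel)"
        by (rule Bochner_Integration.integral_cong[OF refl]) (use D True in \<open>auto simp: indicator_def\<close>)
      also have "\<dots> = f (h (y, \<tau> y)) - f (h (y, 0))"
      proof (rule integral_FTC_Icc_real[OF \<tau>(2)[OF True] der])
        fix z
        have "continuous_on UNIV (\<lambda>z. f' (h (y, z)))"
          by (intro continuous_on_compose2[OF f(2)] continuous_on_compose2[OF h(2)] continuous_intros) auto
        then show "isCont (\<lambda>z. f' (h (y, z))) z" by (simp add: continuous_on_eq_continuous_at)
      qed
      finally show ?thesis using True by simp
    qed
  qed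
  also have "\<dots> = set_int S (\<lambda>y. f (h (y, \<tau> y)) - f (h (y, 0)))"
    by (simp add: set_lebesgue_integral_def)
  also have "\<dots> = set_int S (\<lambda>y. f (h (y, \<tau> y))) - set_int S (\<lambda>y. f (h (y, 0)))"
  proof (intro set_integral_diff set_integrable_compact[OF S(1)])
    show "continuous_on S (\<lambda>y. f (h (y, \<tau> y)))"
      by (intro continuous_on_compose2[OF f(1)] continuous_on_compose2[OF h(2)] continuous_intros continuous_on_subset[OF \<tau>(1)]) auto
    show "continuous_on S (\<lambda>y. f (h (y, 0)))"
      by (intro continuous_on_compose2[OF f(1)] continuous_on_compose2[OF h(2)] continuous_intros) auto
  qed
  finally show ?thesis .
qed

section \<open>Product coordinates and standard simplices\<close>

definition pack2 :: "real \<times> real \<Rightarrow> real^2" where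
  "pack2 p = fst p *\<^sub>R axis 1 1 + snd p *\<^sub>R axis 2 1"

definition pack3 :: "(real^2) \<times> real \<Rightarrow> real^3" where
  "pack3 p = (fst p $ 1) *\<^sub>R axis 1 1 + (fst p $ 2) *\<^sub>R axis 2 1 + snd p *\<^sub>R axis 3 1"

lemma pack2_nth [simp]: "pack2 (y, z) $ 1 = y" "pack2 (y, z) $ 2 = z"
  by (simp_all add: pack2_def axis_def)

lemma pack3_nth [simp]: "pack3 (y, z) $ 1 = y $ 1" "pack3 (y, z) $ 2 = y $ 2" "pack3 (y, z) $ 3 = z"
  by (simp_all add: pack3_def axis_def)

lemma continuous_pack2: "continuous_on UNIV pack2"
  unfolding pack2_def[abs_def] by (intro continuous_intros)

lemma continuous_pack3: "continuous_on UNIV pack3"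
  unfolding pack3_def[abs_def] by (intro continuous_intros)

lemma Basis_vec_axis: "(Basis :: (real^'n) set) = range (\<lambda>i. axis i 1)"
  by (auto simp: Basis_vec_def)

lemma inj_axis: "inj (\<lambda>i. axis i (1::real))"
  by (auto simp: inj_def axis_eq_axis)

lemma prod_Basis_vec: "(\<Prod>b\<in>Basis. x \<bullet> b) = (\<Prod>i\<in>UNIV. x $ i)" for x :: "real^'n"
  unfolding Basis_vec_axis by (subst prod.reindex[OF inj_axis]) (simp add: inner_axis)

lemma sum_Basis_vec: "(\<Sum>b\<in>Basis. x \<bullet> b) = (\<Sum>i\<in>UNIV. x $ i)" for x :: "real^'n"
  unfolding Basis_vec_axis by (subst sum.reindex[OF inj_axis]) (simp add: inner_axis)

lemma ball_Basis_vec: "(\<forall>b\<in>Basis. P b) \<longleftrightarrow> (\<forall>i. P (axis i 1))" for P :: "real^'n \<Rightarrow> bool"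
  unfolding Basis_vec_axis by auto

lemma distr_pack2: "distr lborel borel pack2 = lborel"
proof (rule lborel_eqI[symmetric])
  fix l u :: "real^2" assume "\<And>b. b \<in> Basis \<Longrightarrow> l \<bullet> b \<le> u \<bullet> b"
  then have le: "l $ i \<le> u $ i" for i
    using ball_Basis_vec[of "\<lambda>b. l \<bullet> b \<le> u \<bullet> b"] by (simp add: inner_axis)
  have m: "pack2 \<in> measurable lborel borel"
    using borel_measurable_continuous_onI[OF continuous_pack2] by simp
  have pre: "pack2 -` box l u = box (l $ 1) (u $ 1) \<times> box (l $ 2) (u $ 2)"
    by (auto simp: mem_box_cart forall_2)
  have "emeasure (distr lborel borel pack2) (box l u) = emeasure lborel (box (l $ 1) (u $ 1) \<times> box (l $ 2) (u $ 2))"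
    by (subst emeasure_distr[OF m]) (simp_all add: pre)
  also have "\<dots> = emeasure lborel (box (l $ 1) (u $ 1)) * emeasure lborel (box (l $ 2) (u $ 2))"
    unfolding lborel_prod[symmetric] by (rule lborel.emeasure_pair_measure_Times) auto
  also have "\<dots> = ennreal (\<Prod>b\<in>Basis. (u - l) \<bullet> b)"
    using le by (simp add: prod_Basis_vec UNIV_2 ennreal_mult'[symmetric])
  finally show "emeasure (distr lborel borel pack2) (box l u) = ennreal (\<Prod>b\<in>Basis. (u - l) \<bullet> b)" .
qed simp

lemma prod_UNIV_3: "prod f (UNIV :: 3 set) = f 1 * f 2 * f 3"
  unfolding UNIV_3 by (simp add: ac_simps)

lemma distr_pack3: "distr lborel borel pack3 = lborel"
proof (rule lborel_eqI[symmetric])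
  fix l u :: "real^3" assume "\<And>b. b \<in> Basis \<Longrightarrow> l \<bullet> b \<le> u \<bullet> b"
  then have le: "l $ i \<le> u $ i" for i
    using ball_Basis_vec[of "\<lambda>b. l \<bullet> b \<le> u \<bullet> b"] by (simp add: inner_axis)
  have m: "pack3 \<in> measurable lborel borel"
    using borel_measurable_continuous_onI[OF continuous_pack3] by simp
  define l' u' where "l' = pack2 (l $ 1, l $ 2)" and "u' = pack2 (u $ 1, u $ 2)"
  have pre: "pack3 -` box l u = box l' u' \<times> box (l $ 3) (u $ 3)"
    by (auto simp: mem_box_cart forall_2 forall_3 l'_def u'_def)
  have le': "\<And>b. b \<in> Basis \<Longrightarrow> l' \<bullet> b \<le> u' \<bullet> b"
    using le by (auto simp: Basis_vec_axis inner_axis l'_def u'_def) (metis exhaust_2 pack2_nth)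
  have "emeasure (distr lborel borel pack3) (box l u) = emeasure lborel (box l' u' \<times> box (l $ 3) (u $ 3))"
    by (subst emeasure_distr[OF m]) (simp_all add: pre)
  also have "\<dots> = emeasure lborel (box l' u') * emeasure lborel (box (l $ 3) (u $ 3))"
    unfolding lborel_prod[symmetric] by (rule lborel.emeasure_pair_measure_Times) auto
  also have "emeasure lborel (box l' u') = ennreal ((u $ 1 - l $ 1) * (u $ 2 - l $ 2))"
    by (subst emeasure_lborel_box[OF le']) (simp_all add: prod_Basis_vec UNIV_2 l'_def u'_def)
  also have "ennreal ((u $ 1 - l $ 1) * (u $ 2 - l $ 2)) * emeasure lborel (box (l $ 3) (u $ 3)) = ennreal (\<Prod>b\<in>Basis. (u - l) \<bullet> b)"
  proof -
    have 1: "(\<Prod>b\<in>Basis. (u - l) \<bullet> b) = (u $ 1 - l $ 1) * (u $ 2 - l $ 2) * (u $ 3 - l $ 3)"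
      unfolding prod_Basis_vec prod_UNIV_3 by simp
    have 2: "emeasure lborel (box (l $ 3) (u $ 3)) = ennreal (u $ 3 - l $ 3)"
      using le[of 3] by simp
    have "0 \<le> (u $ 1 - l $ 1) * (u $ 2 - l $ 2)" "0 \<le> u $ 3 - l $ 3"
      using le[of 1] le[of 2] le[of 3] by simp_all
    then show ?thesis unfolding 1 2 by (rule ennreal_mult[symmetric])
  qed
  finally show "emeasure (distr lborel borel pack3) (box l u) = ennreal (\<Prod>b\<in>Basis. (u - l) \<bullet> b)" .
qed simp

definition std3 :: "(real^3) set" where "std3 = {y. 0 \<le> y $ 1 \<and> 0 \<le> y $ 2 \<and> 0 \<le> y $ 3 \<and> y $ 1 + y $ 2 + y $ 3 \<le> 1}"
definition std2 :: "(real^2) set" where "std2 = {y. 0 \<le> y $ 1 \<and> 0 \<le> y $ 2 \<and> y $ 1 + y $ 2 \<le> 1}"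

lemma std3_hull: "std3 = convex hull (insert 0 Basis)"
  unfolding std_simplex std3_def by (simp add: ball_Basis_vec sum_Basis_vec inner_axis forall_3 sum_3)

lemma std2_hull: "std2 = convex hull (insert 0 Basis)"
  unfolding std_simplex std2_def by (simp add: ball_Basis_vec sum_Basis_vec inner_axis forall_2 sum_2)

lemma std1_hull: "{0..1::real} = convex hull (insert 0 Basis)"
  unfolding std_simplex by auto

lemma std_simplex_props:
  fixes D :: "'d::euclidean_space set"
  assumes "D = convex hull (insert 0 Basis)"
  shows "compact D" "convex D" "interior D \<noteq> {}" "0 \<in> D" "Basis \<subseteq> D"
proof -
  show "compact D" unfolding assms by (intro finite_imp_compact_convex_hull) simp
  show "interior D \<noteq> {}" unfolding assms using interior_std_simplex_nonempty by blast
  show "0 \<in> D" "Basis \<subseteq> D" unfolding assms using hull_subset[of "insert 0 Basis" convex] by auto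
qed (simp add: assms)

definition param3 where "param3 a b c d y = a + (y $ 1 *\<^sub>R (b - a) + y $ 2 *\<^sub>R (c - a) + y $ 3 *\<^sub>R (d - a))"
  for a b c d :: "real^3" and y :: "real^3"
definition param2 where "param2 a b c y = a + (y $ 1 *\<^sub>R (b - a) + y $ 2 *\<^sub>R (c - a))"
  for a b c :: "real^3" and y :: "real^2"
definition param1 where "param1 a b t = a + t *\<^sub>R (b - a)" for a b :: "real^3" and t :: real

lemma continuous_param: "continuous_on S (param3 a b c d)" "continuous_on S' (param2 a b c)" "continuous_on S'' (param1 a b)"
  unfolding param3_def[abs_def] param2_def[abs_def] param1_def[abs_def] by (intro continuous_intros)+

text \<open>Along the third coordinate the parametrization moves with velocity \<open>d - a\<close>.
  Each fibre starts on the triangle with vertices \<open>a\<close>, \<open>b\<close>,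
  \<open>c\<close> and ends on the one with vertices \<open>d\<close>, \<open>b\<close>,
  \<open>c\<close>.\<close>

lemma green_std3:
  assumes "C1 \<psi>"
  shows "set_int std3 (\<lambda>y. (d - a) \<bullet> grad \<psi> (param3 a b c d y)) = set_int std2 (\<lambda>y. \<psi> (param2 d b c y)) - set_int std2 (\<lambda>y. \<psi> (param2 a b c y))"
proof -
  have "set_int std3 (\<lambda>y. (d - a) \<bullet> grad \<psi> (param3 a b c d y))
      = set_int std2 (\<lambda>y. \<psi> (param3 a b c d (pack3 (y, 1 - y $ 1 - y $ 2)))) - set_int std2 (\<lambda>y. \<psi> (param3 a b c d (pack3 (y, 0))))"
  proof (rule fubini_FTC[OF distr_pack3 continuous_pack3])
    show "compact std2" "compact std3" using std_simplex_props(1) std2_hull std3_hull by blast+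
    show "continuous_on UNIV (\<lambda>y::real^2. 1 - y $ 1 - y $ 2)" by (intro continuous_intros)
    show "0 \<le> 1 - y $ 1 - y $ 2" if "y \<in> std2" for y using that by (simp add: std2_def)
    show "pack3 (y, z) \<in> std3 \<longleftrightarrow> y \<in> std2 \<and> 0 \<le> z \<and> z \<le> 1 - y $ 1 - y $ 2" for y z
      by (auto simp: std2_def std3_def)
    show "continuous_on UNIV (\<lambda>y. \<psi> (param3 a b c d y))"
      by (rule continuous_on_compose2[OF C1_continuous[OF assms] continuous_param(1) subset_UNIV])
    have "continuous_on UNIV (\<lambda>y. grad \<psi> (param3 a b c d y))"
      by (rule continuous_on_compose2[OF C1_continuous_grad[OF assms] continuous_param(1) subset_UNIV])
    then show "continuous_on UNIV (\<lambda>y. (d - a) \<bullet> grad \<psi> (param3 a b c d y))"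
      by (intro continuous_intros)
    fix y :: "real^2" and z :: real
    have "((\<lambda>z. param3 a b c d (pack3 (y, z))) has_derivative (\<lambda>t. t *\<^sub>R (d - a))) (at z)"
      unfolding param3_def pack3_nth by (auto intro!: derivative_eq_intros)
    from has_derivative_compose[OF this C1_has_derivative[OF assms]]
    show "((\<lambda>z. \<psi> (param3 a b c d (pack3 (y, z)))) has_real_derivative (d - a) \<bullet> grad \<psi> (param3 a b c d (pack3 (y, z)))) (at z)"
      by (simp add: has_field_derivative_def mult_commute_abs)
  qed
  moreover have "param3 a b c d (pack3 (y, 1 - y $ 1 - y $ 2)) = param2 d b c y" for y
    by (simp add: param3_def param2_def algebra_simps)
  moreover have "param3 a b c d (pack3 (y, 0)) = param2 a b c y" for y
    by (simp add: param3_def param2_def)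
  ultimately show ?thesis by simp
qed

lemma green_std2:
  assumes "C1 \<psi>"
  shows "set_int std2 (\<lambda>y. (c - a) \<bullet> grad \<psi> (param2 a b c y)) = set_int {0..1} (\<lambda>t. \<psi> (param1 c b t)) - set_int {0..1} (\<lambda>t. \<psi> (param1 a b t))"
proof -
  have "set_int std2 (\<lambda>y. (c - a) \<bullet> grad \<psi> (param2 a b c y))
      = set_int {0..1} (\<lambda>t. \<psi> (param2 a b c (pack2 (t, 1 - t)))) - set_int {0..1} (\<lambda>t. \<psi> (param2 a b c (pack2 (t, 0))))"
  proof (rule fubini_FTC[OF distr_pack2 continuous_pack2])
    show "compact {0..1::real}" by simp
    show "compact std2" using std_simplex_props(1) std2_hull by blast
    show "continuous_on UNIV (\<lambda>t::real. 1 - t)" by (intro continuous_intros)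
    show "0 \<le> 1 - t" if "t \<in> {0..1}" for t :: real using that by simp
    show "pack2 (y, z) \<in> std2 \<longleftrightarrow> y \<in> {0..1} \<and> 0 \<le> z \<and> z \<le> 1 - y" for y z
      by (auto simp: std2_def)
    show "continuous_on UNIV (\<lambda>y. \<psi> (param2 a b c y))"
      by (rule continuous_on_compose2[OF C1_continuous[OF assms] continuous_param(2) subset_UNIV])
    have "continuous_on UNIV (\<lambda>y. grad \<psi> (param2 a b c y))"
      by (rule continuous_on_compose2[OF C1_continuous_grad[OF assms] continuous_param(2) subset_UNIV])
    then show "continuous_on UNIV (\<lambda>y. (c - a) \<bullet> grad \<psi> (param2 a b c y))"
      by (intro continuous_intros)
    fix y :: real and z :: real
    have "((\<lambda>z. param2 a b c (pack2 (y, z))) has_derivative (\<lambda>t. t *\<^sub>R (c - a))) (at z)"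
      unfolding param2_def pack2_nth by (auto intro!: derivative_eq_intros)
    from has_derivative_compose[OF this C1_has_derivative[OF assms]]
    show "((\<lambda>z. \<psi> (param2 a b c (pack2 (y, z)))) has_real_derivative (c - a) \<bullet> grad \<psi> (param2 a b c (pack2 (y, z)))) (at z)"
      by (simp add: has_field_derivative_def mult_commute_abs)
  qed
  moreover have "param2 a b c (pack2 (t, 1 - t)) = param1 c b t" for t
    by (simp add: param2_def param1_def algebra_simps)
  moreover have "param2 a b c (pack2 (t, 0)) = param1 a b t" for t
    by (simp add: param2_def param1_def)
  ultimately show ?thesis by simp
qed

lemma green_std1:
  assumes "C1 \<psi>"
  shows "set_int {0..1} (\<lambda>t. (b - a) \<bullet> grad \<psi> (param1 a b t)) = \<psi> b - \<psi> a"
proof -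
  have "(\<integral>t. (b - a) \<bullet> grad \<psi> (param1 a b t) * indicator {0..1} t \<partial>lborel) = \<psi> (param1 a b 1) - \<psi> (param1 a b 0)"
  proof (rule integral_FTC_Icc_real)
    fix t :: real
    have "((\<lambda>t. param1 a b t) has_derivative (\<lambda>t. t *\<^sub>R (b - a))) (at t)"
      unfolding param1_def by (auto intro!: derivative_eq_intros)
    from has_derivative_compose[OF this C1_has_derivative[OF assms]]
    show "((\<lambda>t. \<psi> (param1 a b t)) has_real_derivative (b - a) \<bullet> grad \<psi> (param1 a b t)) (at t)"
      by (simp add: has_field_derivative_def mult_commute_abs)
    have "continuous_on UNIV (\<lambda>y. grad \<psi> (param1 a b y))"
      by (rule continuous_on_compose2[OF C1_continuous_grad[OF assms] continuous_param(3) subset_UNIV])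
    then have "continuous_on UNIV (\<lambda>y. (b - a) \<bullet> grad \<psi> (param1 a b y))"
      by (intro continuous_intros)
    then show "isCont (\<lambda>t. (b - a) \<bullet> grad \<psi> (param1 a b t)) t" by (simp add: continuous_on_eq_continuous_at)
  qed simp
  then show ?thesis by (simp add: set_lebesgue_integral_def param1_def mult.commute)
qed

lemma tangent_space_orthogonal:
  assumes "\<And>x y. x \<in> C \<Longrightarrow> y \<in> C \<Longrightarrow> n \<bullet> (x - y) = 0" "u \<in> tangent_space (convex hull C)"
  shows "n \<bullet> u = 0"
proof -
  have h: "n \<bullet> (x - y) = 0" if xy: "x \<in> convex hull C" "y \<in> convex hull C" for x y
  proof (cases "C = {}")
    case True then show ?thesis using xy by simp
  next
    case False
    then obtain b where b: "b \<in> C" by blast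
    have "convex hull C \<subseteq> {x. n \<bullet> x = n \<bullet> b}"
    proof (rule hull_minimal)
      show "convex {x. n \<bullet> x = n \<bullet> b}" by (rule convex_hyperplane)
      show "C \<subseteq> {x. n \<bullet> x = n \<bullet> b}"
      proof
        fix x assume "x \<in> C"
        from assms(1)[OF this b] show "x \<in> {x. n \<bullet> x = n \<bullet> b}" by (simp add: inner_diff_right)
      qed
    qed
    then have "n \<bullet> x = n \<bullet> b" "n \<bullet> y = n \<bullet> b" using xy by blast+
    then show ?thesis by (simp add: inner_diff_right)
  qed
  have "tangent_space (convex hull C) \<subseteq> {u. n \<bullet> u = 0}"
    unfolding tangent_space_def
  proof (rule span_minimal[OF _ subspace_hyperplane])
    show "{x - y |x y. x \<in> convex hull C \<and> y \<in> convex hull C} \<subseteq> {u. n \<bullet> u = 0}" using h by force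
  qed
  then show ?thesis using assms(2) by blast
qed

text \<open>The vector is a multiple of the component of \<open>a - b0\<close> orthogonal to the
  opposite facet; affine independence makes that component nonzero.\<close>

lemma facet_conormal:
  fixes C :: "(real^3) set"
  assumes "\<not> affine_dependent C" "a \<in> C" "b0 \<in> C" "b0 \<noteq> a"
  shows "\<exists>n. (\<forall>b\<in>C - {a}. n \<bullet> (b - a) = \<alpha>)"
proof -
  let ?U = "span ((\<lambda>x. - b0 + x) ` (C - {a}))"
  have b0: "b0 \<in> C - {a}" using assms by simp
  have hull: "affine hull (C - {a}) = (\<lambda>x. b0 + x) ` ?U"
    by (rule affine_hull_span_gen[OF hull_inc[OF b0]])
  have "a \<notin> affine hull (C - {a})" using assms(1,2) by (auto simp: affine_dependent_def)
  then have aU: "a - b0 \<notin> ?U" unfolding hull image_iff by (metis add_diff_cancel_left' diff_add_cancel add.commute)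
  obtain y z where yz: "y \<in> ?U" "\<And>w. w \<in> ?U \<Longrightarrow> orthogonal z w" "a - b0 = y + z"
    using orthogonal_subspace_decomp_exists[of "(\<lambda>x. - b0 + x) ` (C - {a})" "a - b0"] by metis
  have "z \<noteq> 0" using aU yz by auto
  then have zz: "z \<bullet> z \<noteq> 0" by simp
  \<comment> \<open>The scaling makes the pairing with \<open>a - b0\<close> equal to
    \<open>-\<alpha>\<close>, hence the pairing with every edge leaving \<open>a\<close> equal to
    \<open>\<alpha>\<close>.\<close>
  define n where "n = - (\<alpha> / (z \<bullet> z)) *\<^sub>R z"
  have "z \<bullet> y = 0" using yz(2)[OF yz(1)] by (simp add: orthogonal_def)
  then have na: "n \<bullet> (a - b0) = - \<alpha>" using zz by (simp add: n_def yz(3) inner_add_right)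
  have "n \<bullet> (b - a) = \<alpha>" if "b \<in> C - {a}" for b
  proof -
    have "- b0 + b \<in> ?U" using that by (intro span_base) auto
    then have "n \<bullet> (- b0 + b) = 0" using yz(2)[of "- b0 + b"] by (simp add: n_def orthogonal_def)
    then show ?thesis using na by (simp add: inner_diff_right inner_add_right)
  qed
  then show ?thesis by blast
qed

text \<open>Common to triangles and tetrahedra: \<open>I\<close> integrates over the simplex and
  \<open>J a\<close> over the facet opposite \<open>a\<close>. Both sides of the formula are linear
  in the direction, and the edge directions span the tangent space, so it suffices to know the
  edges; the weights \<open>\<alpha>\<close> fix the lengths of the conormals.\<close>

lemma green_assemble:
  fixes C :: "(real^3) set" and J :: "real^3 \<Rightarrow> (real^3 \<Rightarrow> real) \<Rightarrow> real"
  assumes C: "\<not> affine_dependent C" "a0 \<in> C" "b0 \<in> C" "a0 \<noteq> b0"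
    and lin: "\<And>\<psi> w w'. C1 \<psi> \<Longrightarrow> I (\<lambda>x. (w + w') \<bullet> grad \<psi> x) = I (\<lambda>x. w \<bullet> grad \<psi> x) + I (\<lambda>x. w' \<bullet> grad \<psi> x)"
      "\<And>\<psi> w c. C1 \<psi> \<Longrightarrow> I (\<lambda>x. (c *\<^sub>R w) \<bullet> grad \<psi> x) = c * I (\<lambda>x. w \<bullet> grad \<psi> x)"
    and edge: "\<And>\<psi> a d. C1 \<psi> \<Longrightarrow> a \<in> C \<Longrightarrow> d \<in> C \<Longrightarrow> a \<noteq> d \<Longrightarrow>
      I (\<lambda>x. (d - a) \<bullet> grad \<psi> x) = \<alpha> a * J a \<psi> - \<alpha> d * J d \<psi>"
  shows "\<exists>n. (\<forall>a\<in>C. \<forall>u\<in>tangent_space (convex hull (C - {a})). n a \<bullet> u = 0) \<and>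
    (\<forall>\<psi> w. C1 \<psi> \<longrightarrow> w \<in> tangent_space (convex hull C) \<longrightarrow> I (\<lambda>x. w \<bullet> grad \<psi> x) = (\<Sum>a\<in>C. (n a \<bullet> w) * J a \<psi>))"
proof -
  have finC: "finite C" using C(1) aff_independent_finite by blast
  have "\<forall>a\<in>C. \<exists>n. (\<forall>b\<in>C - {a}. n \<bullet> (b - a) = \<alpha> a)"
    using facet_conormal[OF C(1)] C(2-4) by metis
  then obtain n where n: "\<And>a b. a \<in> C \<Longrightarrow> b \<in> C - {a} \<Longrightarrow> n a \<bullet> (b - a) = \<alpha> a" by metis
  have orth: "n a \<bullet> u = 0" if au: "a \<in> C" "u \<in> tangent_space (convex hull (C - {a}))" for a u
  proof (rule tangent_space_orthogonal[OF _ au(2)])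
    fix x y assume "x \<in> C - {a}" "y \<in> C - {a}"
    then have "n a \<bullet> (x - a) = n a \<bullet> (y - a)" using n au(1) by simp
    then show "n a \<bullet> (x - y) = 0" by (simp add: inner_diff_right)
  qed
  have green: "I (\<lambda>x. w \<bullet> grad \<psi> x) = (\<Sum>a\<in>C. (n a \<bullet> w) * J a \<psi>)"
    if \<psi>: "C1 \<psi>" and w: "w \<in> tangent_space (convex hull C)" for \<psi> w
  proof -
    define S where "S = {w. I (\<lambda>x. w \<bullet> grad \<psi> x) = (\<Sum>a\<in>C. (n a \<bullet> w) * J a \<psi>)}"
    have S: "subspace S"
      unfolding subspace_def
    proof (intro conjI ballI allI)
      show "0 \<in> S" using lin(2)[OF \<psi>, of 0 0] by (simp add: S_def)
      show "x + y \<in> S" if "x \<in> S" "y \<in> S" for x y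
        using that lin(1)[OF \<psi>, of x y] by (simp add: S_def inner_add_right distrib_right sum.distrib)
      show "c *\<^sub>R x \<in> S" if "x \<in> S" for c x
        using that lin(2)[OF \<psi>, of c x] by (simp add: S_def sum_distrib_left mult.assoc)
    qed
    have ad: "d - a \<in> S" if "a \<in> C" "d \<in> C" "a \<noteq> d" for a d
    proof -
      \<comment> \<open>The facet opposite a third vertex \<open>b\<close> contains both
        \<open>a\<close> and \<open>d\<close>, so its conormal annihilates
        \<open>d - a\<close>.\<close>
      have "(\<Sum>b\<in>C. (n b \<bullet> (d - a)) * J b \<psi>) = (\<Sum>b\<in>{a, d}. (n b \<bullet> (d - a)) * J b \<psi>)"
      proof (rule sum.mono_neutral_right[OF finC])
        show "\<forall>b\<in>C - {a, d}. n b \<bullet> (d - a) * J b \<psi> = 0"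
        proof
          fix b assume b: "b \<in> C - {a, d}"
          have "n b \<bullet> (d - b) = n b \<bullet> (a - b)" using n[of b d] n[of b a] b that by auto
          then show "n b \<bullet> (d - a) * J b \<psi> = 0" by (simp add: inner_diff_right)
        qed
      qed (use that in auto)
      also have "\<dots> = \<alpha> a * J a \<psi> - \<alpha> d * J d \<psi>"
      proof -
        have "n a \<bullet> (d - a) = \<alpha> a" "n d \<bullet> (a - d) = \<alpha> d" using n[of a d] n[of d a] that by auto
        then have "n d \<bullet> (d - a) = - \<alpha> d" by (simp add: inner_diff_right)
        then show ?thesis using \<open>n a \<bullet> (d - a) = \<alpha> a\<close> that by simp
      qed
      finally show ?thesis using edge[OF \<psi> that] by (simp add: S_def)
    qed
    have "C \<subseteq> (\<lambda>w. a0 + w) ` S"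
    proof
      fix c assume c: "c \<in> C"
      have "c - a0 \<in> S" using ad[OF C(2) c] subspace_0[OF S] by (cases "c = a0") auto
      then show "c \<in> (\<lambda>w. a0 + w) ` S" by (intro image_eqI[of _ _ "c - a0"]) auto
    qed
    then have hull: "convex hull C \<subseteq> (\<lambda>w. a0 + w) ` S"
      by (rule hull_minimal) (intro convex_translation subspace_imp_convex[OF S])
    have "x - y \<in> S" if xy: "x \<in> convex hull C" "y \<in> convex hull C" for x y
    proof -
      obtain u v where "u \<in> S" "v \<in> S" "x = a0 + u" "y = a0 + v" using hull xy by blast
      then show ?thesis using subspace_diff[OF S, of u v] by simp
    qed
    then have "tangent_space (convex hull C) \<subseteq> S"
      unfolding tangent_space_def by (intro span_minimal S) auto
    then show ?thesis using w by (auto simp: S_def)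
  qed
  show ?thesis using orth green by blast
qed

text \<open>If two facets coincided, a vertex would lie in the affine hull of the other
  vertices.\<close>

lemma inj_facets:
  fixes C :: "(real^3) set"
  assumes "\<not> affine_dependent C"
  shows "inj_on (\<lambda>a. convex hull (C - {a})) C"
proof (rule inj_onI, rule ccontr)
  fix a b assume ab: "a \<in> C" "b \<in> C" "convex hull (C - {a}) = convex hull (C - {b})" "a \<noteq> b"
  then have "a \<in> convex hull (C - {a})" using hull_inc[of a "C - {b}" convex] by simp
  then have "a \<in> affine hull (C - {a})" using convex_hull_subset_affine_hull by blast
  then show False using assms ab(1) by (auto simp: affine_dependent_def)
qed

lemma sum_facets:
  fixes C :: "(real^3) set"
  assumes "\<not> affine_dependent C" "2 \<le> card C"
  shows "(\<Sum>F | F facet_of convex hull C. g F) = (\<Sum>a\<in>C. g (convex hull (C - {a})))"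
proof -
  have eq: "{F. F facet_of convex hull C} = (\<lambda>a. convex hull (C - {a})) ` C"
    using facet_of_convex_hull_affine_independent_alt[OF assms(1)] assms(2) by auto
  show ?thesis unfolding eq sum.reindex[OF inj_facets[OF assms(1)]] by simp
qed

text \<open>The masses are normalized so that the integral over a simplex is its mass times the integral
  over the standard simplex, for every ordering of the vertices.\<close>

definition mass3 :: "(real^3) set \<Rightarrow> real" where "mass3 s = set_int s (\<lambda>_. 1) / set_int std3 (\<lambda>_. 1)"
definition mass2 :: "(real^3) set \<Rightarrow> real" where
  "mass2 s = flat_integral TYPE(real^2) s (\<lambda>_. 1) / set_int std2 (\<lambda>_. 1)"
definition mass1 :: "(real^3) set \<Rightarrow> real" where
  "mass1 s = flat_integral TYPE(real) s (\<lambda>_. 1) / set_int {0..1::real} (\<lambda>_. 1)"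

lemma std_mass_pos:
  fixes D :: "'d::euclidean_space set"
  assumes "D = convex hull (insert 0 Basis)"
  shows "set_int D (\<lambda>_. 1::real) > 0"
  using std_simplex_props[OF assms] by (intro set_int_positive[of D _ 0]) auto

lemma linear_image_std_simplex:
  fixes M :: "'d::euclidean_space \<Rightarrow> real^3"
  assumes "linear M"
  shows "(\<lambda>y. a + M y) ` (convex hull (insert 0 Basis)) = convex hull (insert a ((\<lambda>b. a + M b) ` Basis))"
proof -
  have "(\<lambda>y. a + M y) ` (convex hull (insert 0 Basis)) = (+) a ` (M ` (convex hull (insert 0 Basis)))"
    by (simp add: image_image)
  also have "\<dots> = (+) a ` (convex hull (M ` (insert 0 Basis)))"
    by (simp add: convex_hull_linear_image[OF assms])
  also have "\<dots> = convex hull ((+) a ` M ` (insert 0 Basis))"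
    by (rule convex_hull_translation[symmetric])
  also have "(+) a ` M ` (insert 0 Basis) = insert a ((\<lambda>b. a + M b) ` Basis)"
    by (simp add: image_image linear_0[OF assms])
  finally show ?thesis .
qed

lemma independent_coeffs:
  fixes a b c d :: "real^3"
  assumes "\<not> affine_dependent {a, b, c, d}" "card {a, b, c, d} = 4"
    "x *\<^sub>R (b - a) + y *\<^sub>R (c - a) + z *\<^sub>R (d - a) = 0"
  shows "x = 0" "y = 0" "z = 0"
proof -
  have dist: "a \<noteq> b" "a \<noteq> c" "a \<noteq> d" "b \<noteq> c" "b \<noteq> d" "c \<noteq> d"
    using assms(2) by (auto simp: card_insert_if split: if_splits)
  \<comment> \<open>Weights of an affine relation: the vertex \<open>a\<close> takes minus the sum
    of the other three.\<close>
  define U where "U v = (if v = b then x else if v = c then y else if v = d then z else - (x + y + z))" for v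
  have "sum U {a, b, c, d} = 0" using dist by (simp add: U_def)
  moreover have "(\<Sum>v\<in>{a, b, c, d}. U v *\<^sub>R v) = 0"
    using dist assms(3) by (simp add: U_def algebra_simps)
  ultimately have "\<forall>v\<in>{a, b, c, d}. U v = 0"
    using affine_dependent_explicit_finite[of "{a, b, c, d}"] assms(1) by auto
  then have "U b = 0" "U c = 0" "U d = 0" by auto
  then show "x = 0" "y = 0" "z = 0" using dist by (auto simp: U_def)
qed

lemma independent_coeffs3:
  fixes a b c :: "real^3"
  assumes "\<not> affine_dependent {a, b, c}" "card {a, b, c} = 3" "x *\<^sub>R (b - a) + y *\<^sub>R (c - a) = 0"
  shows "x = 0" "y = 0"
proof -
  have dist: "a \<noteq> b" "a \<noteq> c" "b \<noteq> c"
    using assms(2) by (auto simp: card_insert_if split: if_splits)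
  define U where "U v = (if v = b then x else if v = c then y else - (x + y))" for v
  have "sum U {a, b, c} = 0" using dist by (simp add: U_def)
  moreover have "(\<Sum>v\<in>{a, b, c}. U v *\<^sub>R v) = 0"
    using dist assms(3) by (simp add: U_def algebra_simps)
  ultimately have "\<forall>v\<in>{a, b, c}. U v = 0"
    using affine_dependent_explicit_finite[of "{a, b, c}"] assms(1) by auto
  then have "U b = 0" "U c = 0" by auto
  then show "x = 0" "y = 0" using dist by (auto simp: U_def)
qed

lemma volume_std:
  assumes "\<not> affine_dependent {a, b, c, d}" "card {a, b, c, d} = 4"
  shows "mass3 (convex hull {a, b, c, d}) > 0"
    and "continuous_on UNIV g \<Longrightarrow> set_int (convex hull {a, b, c, d}) g
      = mass3 (convex hull {a, b, c, d}) * set_int std3 (\<lambda>y. g (param3 a b c d y) :: real)"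
proof -
  define M where "M y = y $ 1 *\<^sub>R (b - a) + y $ 2 *\<^sub>R (c - a) + y $ 3 *\<^sub>R (d - a)" for y :: "real^3"
  have M: "linear M" by (rule linearI) (simp_all add: M_def algebra_simps)
  have iM: "inj M"
    unfolding linear_injective_0[OF M]
  proof (intro allI impI)
    fix x assume "M x = 0"
    from independent_coeffs[OF assms this[unfolded M_def]] show "x = 0" by (simp add: vec_eq_iff forall_3)
  qed
  have P: "param3 a b c d y = a + M y" for y by (simp add: param3_def M_def)
  have s: "convex hull {a, b, c, d} = (\<lambda>y. a + M y) ` std3"
  proof -
    have "(\<lambda>y. a + M y) ` std3 = convex hull (insert a ((\<lambda>b. a + M b) ` Basis))"
      unfolding std3_hull by (rule linear_image_std_simplex[OF M])
    also have "insert a ((\<lambda>b. a + M b) ` Basis) = {a, b, c, d}"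
      unfolding Basis_vec_axis UNIV_3 by (simp add: M_def axis_def)
    finally show ?thesis ..
  qed
  obtain \<kappa> where k: "\<kappa> > 0" "\<And>z S (g :: real^3 \<Rightarrow> real). compact S \<Longrightarrow> continuous_on UNIV g \<Longrightarrow>
     set_int ((\<lambda>y. z + M y) ` S) g = \<kappa> * set_int S (\<lambda>y. g (z + M y))"
    by (rule linear_cov_image[OF linear_cov_vec M iM]; rule that; assumption)
  have k': "set_int (convex hull {a, b, c, d}) g = \<kappa> * set_int std3 (\<lambda>y. g (param3 a b c d y))"
    if "continuous_on UNIV g" for g :: "real^3 \<Rightarrow> real"
    unfolding s P by (rule k(2)[OF std_simplex_props(1)[OF std3_hull] that])
  \<comment> \<open>The integrand 1 identifies the unknown factor with the mass.\<close>
  have "mass3 (convex hull {a, b, c, d}) = \<kappa>"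
    using k'[of "\<lambda>_. 1"] std_mass_pos[OF std3_hull] by (simp add: mass3_def)
  then show "mass3 (convex hull {a, b, c, d}) > 0"
    "continuous_on UNIV g \<Longrightarrow> set_int (convex hull {a, b, c, d}) g
      = mass3 (convex hull {a, b, c, d}) * set_int std3 (\<lambda>y. g (param3 a b c d y) :: real)"
    using k(1) k' by auto
qed

lemma face_std:
  assumes "\<not> affine_dependent {a, b, c}" "card {a, b, c} = 3"
  shows "mass2 (convex hull {a, b, c}) > 0"
    and "continuous_on UNIV g \<Longrightarrow> flat_integral TYPE(real^2) (convex hull {a, b, c}) g
      = mass2 (convex hull {a, b, c}) * set_int std2 (\<lambda>y. g (param2 a b c y) :: real)"
proof -
  define M where "M y = y $ 1 *\<^sub>R (b - a) + y $ 2 *\<^sub>R (c - a)" for y :: "real^2"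
  have M: "linear M" by (rule linearI) (simp_all add: M_def algebra_simps)
  have iM: "inj M"
    unfolding linear_injective_0[OF M]
  proof (intro allI impI)
    fix x assume "M x = 0"
    from independent_coeffs3[OF assms this[unfolded M_def]] show "x = 0" by (simp add: vec_eq_iff forall_2)
  qed
  have P: "param2 a b c y = a + M y" for y by (simp add: param2_def M_def)
  have s: "convex hull {a, b, c} = (\<lambda>y. a + M y) ` std2"
  proof -
    have "(\<lambda>y. a + M y) ` std2 = convex hull (insert a ((\<lambda>b. a + M b) ` Basis))"
      unfolding std2_hull by (rule linear_image_std_simplex[OF M])
    also have "insert a ((\<lambda>b. a + M b) ` Basis) = {a, b, c}"
      unfolding Basis_vec_axis UNIV_2 by (simp add: M_def axis_def)
    finally show ?thesis ..
  qed
  have dim: "aff_dim (convex hull {a, b, c}) = int DIM(real^2)"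
    using aff_dim_affine_independent[OF assms(1)] assms(2) by (simp add: aff_dim_convex_hull)
  note D = std_simplex_props[OF std2_hull]
  obtain \<kappa> where k: "\<kappa> > 0" "\<And>g :: real^3 \<Rightarrow> real. continuous_on UNIV g \<Longrightarrow>
     flat_integral TYPE(real^2) (convex hull {a, b, c}) g = \<kappa> * set_int std2 (\<lambda>y. g (a + M y))"
    by (rule flat_integral_param[OF linear_cov_vec M iM D(1,4,5) s dim]; rule that; assumption)
  have "mass2 (convex hull {a, b, c}) = \<kappa>"
    using k(2)[of "\<lambda>_. 1"] std_mass_pos[OF std2_hull] by (simp add: mass2_def)
  then show "mass2 (convex hull {a, b, c}) > 0"
    "continuous_on UNIV g \<Longrightarrow> flat_integral TYPE(real^2) (convex hull {a, b, c}) g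
      = mass2 (convex hull {a, b, c}) * set_int std2 (\<lambda>y. g (param2 a b c y) :: real)"
    using k unfolding P by auto
qed

lemma edge_std:
  assumes "a \<noteq> b"
  shows "mass1 (convex hull {a, b}) > 0"
    and "continuous_on UNIV g \<Longrightarrow> flat_integral TYPE(real) (convex hull {a, b}) g
      = mass1 (convex hull {a, b}) * set_int {0..1} (\<lambda>y. g (param1 a b y) :: real)"
proof -
  define M where "M y = y *\<^sub>R (b - a)" for y :: real
  have M: "linear M" by (rule linearI) (simp_all add: M_def algebra_simps)
  have iM: "inj M"
    unfolding linear_injective_0[OF M] using assms by (auto simp: M_def)
  have P: "param1 a b y = a + M y" for y by (simp add: param1_def M_def)
  have s: "convex hull {a, b} = (\<lambda>y. a + M y) ` {0..1}"
  proof -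
    have "(\<lambda>y. a + M y) ` {0..1} = convex hull (insert a ((\<lambda>b. a + M b) ` Basis))"
      unfolding std1_hull by (rule linear_image_std_simplex[OF M])
    also have "insert a ((\<lambda>b. a + M b) ` Basis) = {a, b}" by (simp add: M_def)
    finally show ?thesis ..
  qed
  have dim: "aff_dim (convex hull {a, b}) = int DIM(real)"
    using assms by (simp add: aff_dim_convex_hull aff_dim_2)
  note D = std_simplex_props[OF std1_hull]
  obtain \<kappa> where k: "\<kappa> > 0" "\<And>g :: real^3 \<Rightarrow> real. continuous_on UNIV g \<Longrightarrow>
     flat_integral TYPE(real) (convex hull {a, b}) g = \<kappa> * set_int {0..1} (\<lambda>y. g (a + M y))"
    by (rule flat_integral_param[OF linear_cov_real M iM D(1,4,5) s dim]; rule that; assumption)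
  have "mass1 (convex hull {a, b}) = \<kappa>"
    using k(2)[of "\<lambda>_. 1"] std_mass_pos[OF std1_hull] by (simp add: mass1_def)
  then show "mass1 (convex hull {a, b}) > 0"
    "continuous_on UNIV g \<Longrightarrow> flat_integral TYPE(real) (convex hull {a, b}) g
      = mass1 (convex hull {a, b}) * set_int {0..1} (\<lambda>y. g (param1 a b y) :: real)"
    using k unfolding P by auto
qed

section \<open>Green's formula for arbitrary simplices\<close>

abbreviation flat2 where "flat2 \<equiv> flat_integral TYPE(real^2)"
abbreviation flat1 where "flat1 \<equiv> flat_integral TYPE(real)"

lemma continuous_dir: "C1 \<psi> \<Longrightarrow> continuous_on S (\<lambda>x. w \<bullet> grad \<psi> x)"
  by (intro continuous_intros C1_continuous_grad)

lemma two_more: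
  assumes "card C = 4" "a \<in> C" "d \<in> C" "a \<noteq> d"
  obtains b c where "C = {a, b, c, d}" "card {a, b, c, d} = 4" "card {d, b, c} = 3" "card {a, b, c} = 3"
    "C - {a} = {d, b, c}" "C - {d} = {a, b, c}"
proof -
  have "finite C" using assms(1) card.infinite by fastforce
  then have "card (C - {a, d}) = 2" using assms by (simp add: card_Diff_subset)
  then obtain b c where bc: "C - {a, d} = {b, c}" "b \<noteq> c" by (auto simp: card_2_iff)
  then have n: "b \<noteq> a" "b \<noteq> d" "c \<noteq> a" "c \<noteq> d" by auto
  have "C = {a, b, c, d}" using bc assms by auto
  then show thesis using n bc(2) assms(4) by (intro that[of b c]) auto
qed

lemma one_more:
  assumes "card C = 3" "a \<in> C" "d \<in> C" "a \<noteq> d"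
  obtains b where "C = {a, b, d}" "card {a, b, d} = 3" "d \<noteq> b" "a \<noteq> b"
    "C - {a} = {d, b}" "C - {d} = {a, b}"
proof -
  have "finite C" using assms(1) card.infinite by fastforce
  then have "card (C - {a, d}) = 1" using assms by (simp add: card_Diff_subset)
  then obtain b where b: "C - {a, d} = {b}" by (auto simp: card_1_singleton_iff)
  then have n: "b \<noteq> a" "b \<noteq> d" by auto
  have "C = {a, b, d}" using b assms by auto
  then show thesis using n assms(4) by (intro that[of b]) auto
qed

lemma tangent_space_full:
  assumes "3 simplex T" shows "tangent_space T = UNIV"
proof -
  have "T \<noteq> {}" using assms by auto
  then obtain a where a: "a \<in> T" by blast
  have "aff_dim T = int (dim ((\<lambda>x. x - a) ` T))"
    by (rule aff_dim_eq_dim_subtract[OF hull_inc[OF a]])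
  then have "dim ((\<lambda>x. x - a) ` T) = 3" using aff_dim_simplex[OF assms] by simp
  moreover have "(\<lambda>x. x - a) ` T \<subseteq> tangent_space T"
    unfolding tangent_space_def using a by (auto intro!: span_base)
  ultimately have "dim (tangent_space T) \<ge> 3" by (metis dim_subset)
  then have "dim (tangent_space T) = DIM(real^3)" using dim_subset_UNIV[of "tangent_space T"] by simp
  then show ?thesis using dim_eq_full[of "tangent_space T"] by (simp add: tangent_space_def span_span)
qed

lemma simplexE:
  assumes "n simplex T"
  obtains C where "\<not> affine_dependent C" "int (card C) = n + 1" "T = convex hull C"
  using assms unfolding simplex_def by blast

theorem green_tetrahedron:
  assumes T: "3 simplex T"
  shows "\<exists>n. (\<forall>F. F facet_of T \<longrightarrow> (\<forall>u\<in>tangent_space F. n F \<bullet> u = 0)) \<and>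
    (\<forall>\<psi> w. C1 \<psi> \<longrightarrow> set_int T (\<lambda>x. w \<bullet> grad \<psi> x) = (\<Sum>F | F facet_of T. (n F \<bullet> w) * flat2 F \<psi>))"
proof -
  obtain C where C: "\<not> affine_dependent C" "int (card C) = 3 + 1" "T = convex hull C"
    using T by (rule simplexE)
  have cC: "card C = 4" using C(2) by simp
  have finC: "finite C" using C(1) aff_independent_finite by blast
  obtain a0 b0 where ab: "a0 \<in> C" "b0 \<in> C" "a0 \<noteq> b0"
    using cC card_le_Suc0_iff_eq[OF finC] by fastforce
  have cT: "compact T" using T compact_simplex by blast
  \<comment> \<open>The ratio of masses turns integrals over the standard simplices into integrals
    over \<open>T\<close> and its facets.\<close>
  define \<alpha> where "\<alpha> a = mass3 T / mass2 (convex hull (C - {a}))" for a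
  have "\<exists>n. (\<forall>a\<in>C. \<forall>u\<in>tangent_space (convex hull (C - {a})). n a \<bullet> u = 0) \<and>
    (\<forall>\<psi> w. C1 \<psi> \<longrightarrow> w \<in> tangent_space (convex hull C) \<longrightarrow> set_int T (\<lambda>x. w \<bullet> grad \<psi> x)
      = (\<Sum>a\<in>C. (n a \<bullet> w) * flat2 (convex hull (C - {a})) \<psi>))"
  proof (rule green_assemble[where \<alpha>=\<alpha> and I="set_int T" and J="\<lambda>a. flat2 (convex hull (C - {a}))", OF C(1) ab])
    fix \<psi> :: "real^3 \<Rightarrow> real" and w w' :: "real^3" and c :: real assume \<psi>: "C1 \<psi>"
    show "set_int T (\<lambda>x. (w + w') \<bullet> grad \<psi> x) = set_int T (\<lambda>x. w \<bullet> grad \<psi> x) + set_int T (\<lambda>x. w' \<bullet> grad \<psi> x)"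
      unfolding inner_add_left by (intro set_integral_add set_integrable_compact[OF cT] continuous_dir \<psi>)
    show "set_int T (\<lambda>x. (c *\<^sub>R w) \<bullet> grad \<psi> x) = c * set_int T (\<lambda>x. w \<bullet> grad \<psi> x)" by simp
  next
    fix \<psi> :: "real^3 \<Rightarrow> real" and a d assume \<psi>: "C1 \<psi>" and ad: "a \<in> C" "d \<in> C" "a \<noteq> d"
    obtain b c where bc: "C = {a, b, c, d}" "card {a, b, c, d} = 4" "card {d, b, c} = 3" "card {a, b, c} = 3"
      "C - {a} = {d, b, c}" "C - {d} = {a, b, c}"
      using cC ad by (rule two_more)
    have i: "\<not> affine_dependent {a, b, c, d}" "\<not> affine_dependent {d, b, c}" "\<not> affine_dependent {a, b, c}"
      using C(1) bc affine_independent_subset[OF C(1)] by (metis, metis Diff_subset, metis Diff_subset)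
    have Tc: "T = convex hull {a, b, c, d}" using C(3) bc(1) by simp
    have "set_int T (\<lambda>x. (d - a) \<bullet> grad \<psi> x) = mass3 T * set_int std3 (\<lambda>y. (d - a) \<bullet> grad \<psi> (param3 a b c d y))"
      unfolding Tc by (rule volume_std(2)[OF i(1) bc(2) continuous_dir[OF \<psi>]])
    also have "\<dots> = mass3 T * (set_int std2 (\<lambda>y. \<psi> (param2 d b c y)) - set_int std2 (\<lambda>y. \<psi> (param2 a b c y)))"
      unfolding green_std3[OF \<psi>] ..
    also have "\<dots> = \<alpha> a * flat2 (convex hull (C - {a})) \<psi> - \<alpha> d * flat2 (convex hull (C - {d})) \<psi>"
      using face_std[OF i(2) bc(3)] face_std[OF i(3) bc(4)] C1_continuous[OF \<psi>]
      unfolding \<alpha>_def bc(5,6) by (simp add: right_diff_distrib)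
    finally show "set_int T (\<lambda>x. (d - a) \<bullet> grad \<psi> x) = \<alpha> a * flat2 (convex hull (C - {a})) \<psi> - \<alpha> d * flat2 (convex hull (C - {d})) \<psi>" .
  qed
  then obtain n where n: "\<And>a u. a \<in> C \<Longrightarrow> u \<in> tangent_space (convex hull (C - {a})) \<Longrightarrow> n a \<bullet> u = 0"
    "\<And>\<psi> w. C1 \<psi> \<Longrightarrow> w \<in> tangent_space (convex hull C) \<Longrightarrow> set_int T (\<lambda>x. w \<bullet> grad \<psi> x)
      = (\<Sum>a\<in>C. (n a \<bullet> w) * flat2 (convex hull (C - {a})) \<psi>)" by blast
  let ?f = "\<lambda>a. convex hull (C - {a})"
  \<comment> \<open>Facets correspond to their opposite vertices, so the conormals can be reindexed
    by facets.\<close>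
  define N where "N F = n (inv_into C ?f F)" for F
  have inv: "N (?f a) = n a" if "a \<in> C" for a
    using inv_into_f_f[OF inj_facets[OF C(1)] that] by (simp add: N_def)
  show ?thesis
  proof (intro exI[of _ N] conjI allI impI ballI)
    fix F u assume "F facet_of T" "u \<in> tangent_space F"
    then obtain a where "a \<in> C" "F = convex hull (C - {a})" "u \<in> tangent_space F"
      using facet_of_convex_hull_affine_independent_alt[OF C(1)] C(3) by auto
    then show "N F \<bullet> u = 0" using n(1) inv by simp
  next
    fix \<psi> w assume "C1 \<psi>"
    then have "set_int T (\<lambda>x. w \<bullet> grad \<psi> x) = (\<Sum>a\<in>C. (n a \<bullet> w) * flat2 (?f a) \<psi>)"
      using n(2)[of \<psi> w] tangent_space_full[OF T] C(3) by simp
    also have "\<dots> = (\<Sum>a\<in>C. (N (?f a) \<bullet> w) * flat2 (?f a) \<psi>)"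
      by (intro sum.cong refl) (simp add: inv)
    also have "\<dots> = (\<Sum>F | F facet_of T. (N F \<bullet> w) * flat2 F \<psi>)"
      unfolding C(3) using sum_facets[OF C(1), of "\<lambda>F. (N F \<bullet> w) * flat2 F \<psi>"] cC by simp
    finally show "set_int T (\<lambda>x. w \<bullet> grad \<psi> x) = (\<Sum>F | F facet_of T. (N F \<bullet> w) * flat2 F \<psi>)" .
  qed
qed

theorem green_triangle:
  assumes T: "2 simplex (T :: (real^3) set)"
  shows "\<exists>n. (\<forall>F. F facet_of T \<longrightarrow> (\<forall>u\<in>tangent_space F. n F \<bullet> u = 0)) \<and>
    (\<forall>\<psi> w. C1 \<psi> \<longrightarrow> w \<in> tangent_space T \<longrightarrow> flat2 T (\<lambda>x. w \<bullet> grad \<psi> x) = (\<Sum>F | F facet_of T. (n F \<bullet> w) * flat1 F \<psi>))"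
proof -
  obtain C where C: "\<not> affine_dependent C" "int (card C) = 2 + 1" "T = convex hull C"
    using T by (rule simplexE)
  have cC: "card C = 3" using C(2) by simp
  have finC: "finite C" using C(1) aff_independent_finite by blast
  obtain a0 b0 where ab: "a0 \<in> C" "b0 \<in> C" "a0 \<noteq> b0"
    using cC card_le_Suc0_iff_eq[OF finC] by fastforce
  have cT: "compact T" using T compact_simplex by blast
  have dT: "aff_dim T = int DIM(real^2)" using aff_dim_simplex[OF T] by simp
  define \<alpha> where "\<alpha> a = mass2 T / mass1 (convex hull (C - {a}))" for a
  have "\<exists>n. (\<forall>a\<in>C. \<forall>u\<in>tangent_space (convex hull (C - {a})). n a \<bullet> u = 0) \<and>
    (\<forall>\<psi> w. C1 \<psi> \<longrightarrow> w \<in> tangent_space (convex hull C) \<longrightarrow> flat2 T (\<lambda>x. w \<bullet> grad \<psi> x)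
      = (\<Sum>a\<in>C. (n a \<bullet> w) * flat1 (convex hull (C - {a})) \<psi>))"
  proof (rule green_assemble[where \<alpha>=\<alpha> and I="flat2 T" and J="\<lambda>a. flat1 (convex hull (C - {a}))", OF C(1) ab])
    fix \<psi> :: "real^3 \<Rightarrow> real" and w w' :: "real^3" and c :: real assume \<psi>: "C1 \<psi>"
    show "flat2 T (\<lambda>x. (w + w') \<bullet> grad \<psi> x) = flat2 T (\<lambda>x. w \<bullet> grad \<psi> x) + flat2 T (\<lambda>x. w' \<bullet> grad \<psi> x)"
      unfolding inner_add_left by (intro flat_integral_add[OF dT cT] continuous_dir \<psi>)
    show "flat2 T (\<lambda>x. (c *\<^sub>R w) \<bullet> grad \<psi> x) = c * flat2 T (\<lambda>x. w \<bullet> grad \<psi> x)"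
      using flat_integral_linear[OF dT cT bounded_linear_mult_right continuous_dir[OF \<psi>], of c w] by simp
  next
    fix \<psi> :: "real^3 \<Rightarrow> real" and a d assume \<psi>: "C1 \<psi>" and ad: "a \<in> C" "d \<in> C" "a \<noteq> d"
    obtain b where b: "C = {a, b, d}" "card {a, b, d} = 3" "d \<noteq> b" "a \<noteq> b"
      "C - {a} = {d, b}" "C - {d} = {a, b}"
      using cC ad by (rule one_more)
    have i: "\<not> affine_dependent {a, b, d}" using C(1) b(1) by simp
    have Tc: "T = convex hull {a, b, d}" using C(3) b(1) by simp
    have "flat2 T (\<lambda>x. (d - a) \<bullet> grad \<psi> x) = mass2 T * set_int std2 (\<lambda>y. (d - a) \<bullet> grad \<psi> (param2 a b d y))"
      unfolding Tc by (rule face_std(2)[OF i b(2) continuous_dir[OF \<psi>]])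
    also have "\<dots> = mass2 T * (set_int {0..1} (\<lambda>y. \<psi> (param1 d b y)) - set_int {0..1} (\<lambda>y. \<psi> (param1 a b y)))"
      unfolding green_std2[OF \<psi>] ..
    also have "\<dots> = \<alpha> a * flat1 (convex hull (C - {a})) \<psi> - \<alpha> d * flat1 (convex hull (C - {d})) \<psi>"
      using edge_std[OF b(3)] edge_std[OF b(4)] C1_continuous[OF \<psi>]
      unfolding \<alpha>_def b(5,6) by (simp add: right_diff_distrib)
    finally show "flat2 T (\<lambda>x. (d - a) \<bullet> grad \<psi> x) = \<alpha> a * flat1 (convex hull (C - {a})) \<psi> - \<alpha> d * flat1 (convex hull (C - {d})) \<psi>" .
  qed
  then obtain n where n: "\<And>a u. a \<in> C \<Longrightarrow> u \<in> tangent_space (convex hull (C - {a})) \<Longrightarrow> n a \<bullet> u = 0"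
    "\<And>\<psi> w. C1 \<psi> \<Longrightarrow> w \<in> tangent_space (convex hull C) \<Longrightarrow> flat2 T (\<lambda>x. w \<bullet> grad \<psi> x)
      = (\<Sum>a\<in>C. (n a \<bullet> w) * flat1 (convex hull (C - {a})) \<psi>)" by blast
  let ?f = "\<lambda>a. convex hull (C - {a})"
  define N where "N F = n (inv_into C ?f F)" for F
  have inv: "N (?f a) = n a" if "a \<in> C" for a
    using inv_into_f_f[OF inj_facets[OF C(1)] that] by (simp add: N_def)
  show ?thesis
  proof (intro exI[of _ N] conjI allI impI ballI)
    fix F u assume "F facet_of T" "u \<in> tangent_space F"
    then obtain a where "a \<in> C" "F = convex hull (C - {a})" "u \<in> tangent_space F"
      using facet_of_convex_hull_affine_independent_alt[OF C(1)] C(3) by auto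
    then show "N F \<bullet> u = 0" using n(1) inv by simp
  next
    fix \<psi> w assume "C1 \<psi>" "w \<in> tangent_space T"
    then have "flat2 T (\<lambda>x. w \<bullet> grad \<psi> x) = (\<Sum>a\<in>C. (n a \<bullet> w) * flat1 (?f a) \<psi>)"
      using n(2)[of \<psi> w] C(3) by simp
    also have "\<dots> = (\<Sum>a\<in>C. (N (?f a) \<bullet> w) * flat1 (?f a) \<psi>)"
      by (intro sum.cong refl) (simp add: inv)
    also have "\<dots> = (\<Sum>F | F facet_of T. (N F \<bullet> w) * flat1 F \<psi>)"
      unfolding C(3) using sum_facets[OF C(1), of "\<lambda>F. (N F \<bullet> w) * flat1 F \<psi>"] cC by simp
    finally show "flat2 T (\<lambda>x. w \<bullet> grad \<psi> x) = (\<Sum>F | F facet_of T. (N F \<bullet> w) * flat1 F \<psi>)" .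
  qed
qed

text \<open>With the unnormalized direction \<open>b - a\<close>, the factor \<open>mass1 e\<close>
  is the length of the edge.\<close>

theorem green_edge:
  assumes e: "1 simplex (e :: (real^3) set)"
  obtains a b where "a \<noteq> b" "e = convex hull {a, b}"
    "\<And>\<psi>. C1 \<psi> \<Longrightarrow> flat1 e (\<lambda>x. (b - a) \<bullet> grad \<psi> x) = mass1 e * (\<psi> b - \<psi> a)"
proof -
  obtain C where C: "\<not> affine_dependent C" "int (card C) = 1 + 1" "e = convex hull C"
    using e by (rule simplexE)
  then obtain a b where ab: "C = {a, b}" "a \<noteq> b" by (auto simp: card_2_iff)
  show thesis
    using ab edge_std(2)[OF ab(2) continuous_dir, of _ "b - a"] green_std1[of _ b a] C(3)
    by (intro that[of a b]) auto
qed

section \<open>Positivity of face and edge integrals\<close>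

lemma flat2_positive:
  assumes "2 simplex F" "continuous_on UNIV g" "\<And>x. x \<in> F \<Longrightarrow> g x \<ge> 0" "x \<in> F" "g x > (0::real)"
  shows "flat2 F g > 0"
proof -
  obtain C where C: "\<not> affine_dependent C" "int (card C) = 2 + 1" "F = convex hull C"
    using assms(1) by (rule simplexE)
  then have "card C = 3" by simp
  then obtain a b c where abc: "C = {a, b, c}" by (auto simp: card_3_iff)
  define M where "M y = y $ 1 *\<^sub>R (b - a) + y $ 2 *\<^sub>R (c - a)" for y :: "real^2"
  have M: "linear M" by (rule linearI) (simp_all add: M_def algebra_simps)
  have P: "param2 a b c y = a + M y" for y by (simp add: param2_def M_def)
  have s: "F = param2 a b c ` std2"
  proof -
    have "param2 a b c ` std2 = (\<lambda>y. a + M y) ` std2" by (simp add: P)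
    also have "\<dots> = convex hull (insert a ((\<lambda>b. a + M b) ` Basis))"
      unfolding std2_hull by (rule linear_image_std_simplex[OF M])
    also have "insert a ((\<lambda>b. a + M b) ` Basis) = {a, b, c}"
      unfolding Basis_vec_axis UNIV_2 by (simp add: M_def axis_def)
    finally show ?thesis using C(3) abc by simp
  qed
  obtain y where y: "y \<in> std2" "param2 a b c y = x" using assms(4) s by auto
  note D = std_simplex_props[OF std2_hull]
  have "set_int std2 (\<lambda>y. g (param2 a b c y)) > 0"
    using assms(3,5) s y D
    by (intro set_int_positive[of std2 _ y] continuous_on_compose2[OF assms(2) continuous_param(2)]) auto
  then show ?thesis
    using face_std(1)[of a b c] face_std(2)[of a b c g] C abc assms(2) by simp
qed

lemma flat1_positive:
  assumes "1 simplex F" "continuous_on UNIV g" "\<And>x. x \<in> F \<Longrightarrow> g x \<ge> 0" "x \<in> F" "g x > (0::real)"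
  shows "flat1 F g > 0"
proof -
  obtain a b where ab: "a \<noteq> b" "F = convex hull {a, b}"
    "\<And>\<psi>. C1 \<psi> \<Longrightarrow> flat1 F (\<lambda>x. (b - a) \<bullet> grad \<psi> x) = mass1 F * (\<psi> b - \<psi> a)"
    by (rule green_edge[OF assms(1)]; rule that; assumption)
  have s: "F = param1 a b ` {0..1}"
    unfolding ab(2) segment_convex_hull[symmetric] closed_segment_image_interval
    by (rule image_cong[OF refl]) (simp add: param1_def algebra_simps)
  obtain y where y: "y \<in> {0..1}" "param1 a b y = x" using assms(4) s by auto
  note D = std_simplex_props[OF std1_hull]
  have "set_int {0..1} (\<lambda>y. g (param1 a b y)) > 0"
    using assms(3,5) s y D
    by (intro set_int_positive[of "{0..1}" _ y] continuous_on_compose2[OF assms(2) continuous_param(3)]) auto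
  then show ?thesis
    using edge_std(1)[OF ab(1)] edge_std(2)[OF ab(1), of g] ab(2) assms(2) by simp
qed

section \<open>Derivatives of the polynomial pieces\<close>

lemma C1_from_pd:
  assumes "\<And>x. (f has_derivative (\<lambda>h. \<Sum>i\<in>UNIV. h $ i * G i x)) (at x)" "\<And>i. continuous_on UNIV (G i)"
  shows "C1 f" "pd i f x = G i x"
proof -
  have 1: "(f has_derivative (\<lambda>h. h \<bullet> (\<chi> i. G i x))) (at x)" for x
    using assms(1)[of x] by (simp add: inner_vec_def)
  have 2: "continuous_on UNIV (\<lambda>x. \<chi> i. G i x)"
    by (intro continuous_on_vec_lambda assms(2))
  show "C1 f" "pd i f x = G i x"
    using C1I[OF 1 2] by (auto simp flip: grad_nth)
qed

lemma polys_continuous: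
  assumes "subspace V" "q \<in> polys m V" shows "continuous_on S q"
proof -
  obtain dq where "\<forall>x. (q has_derivative (\<lambda>h. \<Sum>i\<in>UNIV. h $ i *\<^sub>R dq i x)) (at x)"
    using polys_has_derivative[OF assms] by auto
  then show ?thesis
    by (meson continuous_at_imp_continuous_on has_derivative_continuous)
qed

lemma polys_C1:
  assumes "subspace V" "q \<in> polys m V"
  obtains dq where "\<And>i. dq i \<in> polys (m - 1) V" "\<And>l. bounded_linear l \<Longrightarrow> C1 (\<lambda>x. l (q x))"
    "\<And>l i x. bounded_linear l \<Longrightarrow> pd i (\<lambda>x. l (q x)) x = l (dq i x)"
proof -
  obtain dq where dq: "\<And>i. dq i \<in> polys (m - 1) V" "\<And>x. (q has_derivative (\<lambda>h. \<Sum>i\<in>UNIV. h $ i *\<^sub>R dq i x)) (at x)"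
    using polys_has_derivative[OF assms] by auto
  have d: "((\<lambda>x. l (q x)) has_derivative (\<lambda>h. \<Sum>i\<in>UNIV. h $ i * l (dq i x))) (at x)" if l: "bounded_linear l" for l x
    by (rule has_derivative_eq_rhs[OF bounded_linear.has_derivative[OF l dq(2)]])
       (simp add: linear_sum[OF bounded_linear.linear[OF l]] linear_scale[OF bounded_linear.linear[OF l]])
  have c: "continuous_on UNIV (\<lambda>x. l (dq i x))" if l: "bounded_linear l" for l i
    by (rule bounded_linear.continuous_on[OF l polys_continuous[OF assms(1) dq(1)]])
  show thesis
  proof (rule that[OF dq(1)])
    fix l :: "'a \<Rightarrow> real" and i x assume l: "bounded_linear l"
    show "C1 (\<lambda>x. l (q x))" "pd i (\<lambda>x. l (q x)) x = l (dq i x)"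
      by (rule C1_from_pd[where G="\<lambda>i x. l (dq i x)", OF d[OF l] c[OF l]])+
  qed
qed

lemma simplex3_interior:
  assumes "3 simplex (T :: (real^3) set)"
  shows "interior T \<noteq> {}" "rel_interior T = interior T"
proof -
  have "affine hull T = UNIV" using aff_dim_simplex[OF assms] aff_dim_eq_full[of T] by simp
  then show r: "rel_interior T = interior T" by (rule rel_interior_interior)
  have "T \<noteq> {}" using assms by auto
  then show "interior T \<noteq> {}"
    using rel_interior_eq_empty[OF convex_simplex[OF assms]] r by simp
qed

text \<open>A rescaled copy of the function is supported inside the given tetrahedron, so that
  Green's formula has no boundary terms.\<close>

lemma integral_grad_eq_0:
  assumes T: "3 simplex (T :: (real^3) set)" and \<psi>: "C1 \<psi>" and K: "compact K" "\<And>x. x \<notin> K \<Longrightarrow> \<psi> x = 0"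
  shows "integral\<^sup>L lborel (\<lambda>x. w \<bullet> grad \<psi> x) = 0"
proof -
  obtain x0 where "x0 \<in> interior T" using simplex3_interior(1)[OF T] by blast
  then obtain e where e: "e > 0" "ball x0 e \<subseteq> interior T"
    using open_contains_ball[of "interior T"] by auto
  obtain B where B: "B > 0" "\<And>x. x \<in> K \<Longrightarrow> norm x < B"
    using compact_imp_bounded[OF K(1)] bounded_pos_less by blast
  \<comment> \<open>The map \<open>f\<close> sends \<open>x0\<close> to 0 and scales by
    \<open>R\<close>. Points outside the ball of radius \<open>e\<close> leave the ball of radius
    \<open>B\<close>, and hence \<open>K\<close>.\<close>
  define R where "R = B / e"
  have R: "R > 0" using e B by (simp add: R_def)
  define z where "z = - R *\<^sub>R x0"
  define f where "f x = z + R *\<^sub>R x" for x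
  have fout: "f x \<notin> K" if "x \<notin> interior T" for x
  proof
    assume "f x \<in> K"
    then have "norm (R *\<^sub>R (x - x0)) < B" using B(2)[of "f x"] by (simp add: f_def z_def algebra_simps)
    then have "R * norm (x - x0) < R * e" using R e(1) by (simp only: norm_scaleR abs_of_pos) (simp add: R_def)
    then have "norm (x - x0) < e" using R by (simp only: mult_less_cancel_left_pos)
    then have "x \<in> ball x0 e" by (simp add: dist_norm norm_minus_commute)
    then show False using that e(2) by blast
  qed
  define \<psi>' where "\<psi>' x = \<psi> (f x)" for x
  have d: "(\<psi>' has_derivative (\<lambda>h. h \<bullet> (R *\<^sub>R grad \<psi> (f x)))) (at x)" for x
  proof -
    have "(f has_derivative (\<lambda>h. R *\<^sub>R h)) (at x)"
      unfolding f_def by (auto intro!: derivative_eq_intros)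
    from has_derivative_compose[OF this C1_has_derivative[OF \<psi>]]
    show ?thesis by (simp add: \<psi>'_def[abs_def])
  qed
  have cf: "continuous_on UNIV f" unfolding f_def[abs_def] by (intro continuous_intros)
  have c: "continuous_on UNIV (\<lambda>x. R *\<^sub>R grad \<psi> (f x))"
    by (intro continuous_intros continuous_on_compose2[OF C1_continuous_grad[OF \<psi>] cf subset_UNIV])
  have \<psi>': "C1 \<psi>'" "grad \<psi>' = (\<lambda>x. R *\<^sub>R grad \<psi> (f x))" using C1I[OF d c] by auto
  obtain n where n: "\<And>\<psi> w. C1 \<psi> \<Longrightarrow> set_int T (\<lambda>x. w \<bullet> grad \<psi> x) = (\<Sum>F | F facet_of T. (n F \<bullet> w) * flat2 F \<psi>)"
    using green_tetrahedron[OF T] by (elim exE conjE) simp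
  have "flat2 F \<psi>' = 0" if F: "F facet_of T" for F
  proof -
    have "F \<subseteq> T - interior T"
      using F face_of_subset_rel_boundary[of F T] facet_of_def[of F T] simplex3_interior(2)[OF T] by force
    then have "flat2 F \<psi>' = flat2 F (\<lambda>x. 0)"
      using K(2) fout by (intro flat_integral_cong) (auto simp: \<psi>'_def)
    then show ?thesis by (simp add: flat_integral_chart set_lebesgue_integral_def)
  qed
  then have "set_int T (\<lambda>x. w \<bullet> grad \<psi>' x) = 0" unfolding n[OF \<psi>'(1)] by simp
  then have "R * set_int T (\<lambda>x. w \<bullet> grad \<psi> (f x)) = 0" unfolding \<psi>'(2) by simp
  then have 0: "set_int T (\<lambda>x. w \<bullet> grad \<psi> (f x)) = 0" using R by simp
  have g0: "grad \<psi> x = 0" if "x \<notin> K" for x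
  proof -
    have "pd i \<psi> x = 0" for i
      by (rule vanish_pd[of "- K"]) (use that K compact_imp_closed in auto)
    then show ?thesis by (simp add: vec_eq_iff)
  qed
  have "set_int T (\<lambda>x. w \<bullet> grad \<psi> (f x)) = integral\<^sup>L lborel (\<lambda>x. w \<bullet> grad \<psi> (f x))"
    unfolding set_lebesgue_integral_def
  proof (rule Bochner_Integration.integral_cong[OF refl])
    fix x
    show "indicator T x *\<^sub>R (w \<bullet> grad \<psi> (f x)) = w \<bullet> grad \<psi> (f x)"
    proof (cases "x \<in> T")
      case False
      then have "f x \<notin> K" using fout interior_subset by blast
      then show ?thesis using g0 by simp
    qed simp
  qed
  with 0 have 0: "integral\<^sup>L lborel (\<lambda>x. w \<bullet> grad \<psi> (z + R *\<^sub>R x)) = 0" by (simp add: f_def)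
  have N: "linear (\<lambda>x::real^3. R *\<^sub>R x)" "inj (\<lambda>x::real^3. R *\<^sub>R x)"
    using R by (auto simp: linear_scaleR inj_def)
  have m: "(\<lambda>x. w \<bullet> grad \<psi> x) \<in> borel_measurable borel"
    by (intro borel_measurable_continuous_onI continuous_dir \<psi>)
  \<comment> \<open>Undoing the scaling multiplies the vanishing integral by a constant.\<close>
  obtain \<kappa> where k: "\<forall>z. \<forall>f\<in>borel_measurable borel. integral\<^sup>L lborel f = \<kappa> * integral\<^sup>L lborel (\<lambda>y::real^3. f (z + R *\<^sub>R y) :: real)"
    using linear_cov_vec[unfolded linear_cov_def, rule_format, OF N] by blast
  show ?thesis using k[rule_format, OF m, of z] unfolding 0 by simp
qed

section \<open>Integration by parts on a mesh\<close>

locale tet_mesh =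
  fixes \<Omega> :: "(real^3) set" and \<W> :: "(real^3) set set"
  assumes mesh: "tetrahedral_mesh \<Omega> \<W>" and open_dom: "open \<Omega>"
begin

lemmas finite_mesh = tetrahedral_meshD(1)[OF mesh]
lemmas mesh_simplex = tetrahedral_meshD(2)[OF mesh]
lemmas mesh_cover = tetrahedral_meshD(3)[OF mesh]

lemma mesh_compact: "T \<in> \<W> \<Longrightarrow> compact T" using mesh_simplex compact_simplex by blast

text \<open>For distinct tetrahedra the intersection is a proper face, and proper faces avoid the
  interior.\<close>

lemma mesh_interior_disjoint:
  assumes "T \<in> \<W>" "T' \<in> \<W>" "x \<in> interior T" "x \<in> T'"
  shows "T = T'"
proof (rule ccontr)
  assume "T \<noteq> T'"
  note I = tetrahedral_meshD(4,5)[OF mesh assms(1,2)]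
  have "aff_dim T = aff_dim T'" using assms mesh_simplex aff_dim_simplex by metis
  then have "T \<inter> T' \<noteq> T"
    using same_dim_Int[of T T'] mesh_simplex[OF assms(1)] mesh_simplex[OF assms(2)] convex_simplex \<open>T \<noteq> T'\<close> I(2) by blast
  then have "(T \<inter> T') \<inter> interior T = {}" using face_of_disjoint_interior[OF I(1)] by blast
  then show False using assms interior_subset by blast
qed

lemma facet_cells: "T \<in> \<W> \<Longrightarrow> F facet_of T \<Longrightarrow> F \<in> cells \<W> 2"
  using aff_dim_simplex[OF mesh_simplex, of T] by (auto simp: cells_def facet_of_def)

lemma cells_facet: "T \<in> \<W> \<Longrightarrow> F \<in> cells \<W> 2 \<Longrightarrow> F face_of T \<longleftrightarrow> F facet_of T"
  using aff_dim_simplex[OF mesh_simplex, of T] by (auto simp: cells_def facet_of_def)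

lemma edge_cells: "F \<in> cells \<W> 2 \<Longrightarrow> e facet_of F \<Longrightarrow> e \<in> cells \<W> 1"
  using face_of_cell[OF mesh, of F 2 e 1] by (auto simp: cells_def facet_of_def)

lemma finite_facets: "n simplex T \<Longrightarrow> finite {F. F facet_of T}" for T :: "(real^3) set"
  by (rule finite_subset[OF _ finite_polytope_faces[OF simplex_imp_polytope]]) (auto simp: facet_of_def)

text \<open>Collecting by facets brings together the contributions of the tetrahedra at a common
  facet, which are meant to cancel.\<close>

lemma sum_facets_swap:
  "(\<Sum>T\<in>\<W>. \<Sum>F | F facet_of T. h T F) = (\<Sum>F\<in>cells \<W> 2. \<Sum>T | T \<in> \<W> \<and> F facet_of T. h T F)"
proof -
  have "(\<Sum>T\<in>\<W>. \<Sum>F | F facet_of T. h T F) = (\<Sum>T\<in>\<W>. \<Sum>F | F \<in> cells \<W> 2 \<and> F facet_of T. h T F)"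
    by (intro sum.cong refl) (use facet_cells in auto)
  also have "\<dots> = (\<Sum>F\<in>cells \<W> 2. \<Sum>T | T \<in> \<W> \<and> F facet_of T. h T F)"
    by (rule sum.swap_restrict[OF finite_mesh finite_cells[OF mesh]])
  finally show ?thesis .
qed

text \<open>Tetrahedra overlap only in their frontiers, a null set. The mesh covers the closure of
  the domain, and the hypothesis \<open>out\<close> settles interior points of tetrahedra that lie
  outside \<open>\<Omega>\<close>.\<close>

lemma integral_split:
  fixes H :: "real^3 \<Rightarrow> 'v::euclidean_space"
  assumes H: "H \<in> borel_measurable lebesgue" "\<And>x. x \<notin> \<Omega> \<Longrightarrow> H x = 0"
    and g: "\<And>T. T \<in> \<W> \<Longrightarrow> continuous_on T (g T)"
    and eq: "\<And>T x. T \<in> \<W> \<Longrightarrow> x \<in> interior T \<Longrightarrow> x \<in> \<Omega> \<Longrightarrow> H x = g T x"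
    and out: "\<And>T x. T \<in> \<W> \<Longrightarrow> x \<in> interior T \<Longrightarrow> x \<notin> \<Omega> \<Longrightarrow> g T x = 0"
  shows "integral\<^sup>L lebesgue H = (\<Sum>T\<in>\<W>. set_int T (g T))"
proof -
  let ?G = "\<lambda>x. \<Sum>T\<in>\<W>. indicator T x *\<^sub>R g T x"
  have int: "integrable lborel (\<lambda>x. indicator T x *\<^sub>R g T x)" if "T \<in> \<W>" for T
    by (rule borel_integrable_compact[OF mesh_compact[OF that] g[OF that]])
  have Gint: "integrable lborel ?G" by (rule Bochner_Integration.integrable_sum) (rule int)
  have Gm: "?G \<in> borel_measurable lborel" by (rule borel_measurable_integrable[OF Gint])
  have "negligible (\<Union>T\<in>\<W>. frontier T)"
    using finite_mesh mesh_simplex convex_simplex by (intro negligible_Union) (auto intro!: negligible_convex_frontier)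
  then have "(\<Union>T\<in>\<W>. frontier T) \<in> null_sets lebesgue" by (simp add: negligible_iff_null_sets)
  then have ae: "AE x in lebesgue. x \<notin> (\<Union>T\<in>\<W>. frontier T)" by (rule AE_not_in)
  have "AE x in lebesgue. H x = ?G x"
    using ae
  proof eventually_elim
    case (elim x)
    show ?case
    proof (cases "\<exists>T\<in>\<W>. x \<in> T")
      case True
      then obtain T where T: "T \<in> \<W>" "x \<in> T" by blast
      have xi: "x \<in> interior T"
        using elim T compact_imp_closed[OF mesh_compact[OF T(1)]] by (auto simp: frontier_def closure_closed)
      have ne: "x \<notin> S" if "S \<in> \<W> - {T}" for S
        using mesh_interior_disjoint[OF T(1) _ xi, of S] that by auto
      have "?G x = (\<Sum>S\<in>{T}. indicator S x *\<^sub>R g S x)"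
        by (rule sum.mono_neutral_right[OF finite_mesh]) (use T ne in simp_all)
      then have "?G x = g T x" using T by simp
      then show ?thesis using eq[OF T(1) xi] out[OF T(1) xi] H(2)[of x] by (cases "x \<in> \<Omega>") simp_all
    next
      case False
      then have "x \<notin> \<Omega>" using mesh_cover closure_subset[of \<Omega>] by blast
      then show ?thesis using False H(2) by (auto simp: indicator_def intro!: sum.neutral[symmetric])
    qed
  qed
  then have "integral\<^sup>L lebesgue H = integral\<^sup>L lebesgue ?G"
    by (rule integral_cong_AE[OF H(1) measurable_completion[OF Gm]])
  also have "\<dots> = integral\<^sup>L lborel ?G" by (rule integral_completion[OF Gm])
  also have "\<dots> = (\<Sum>T\<in>\<W>. set_int T (g T))"
    unfolding set_lebesgue_integral_def by (rule Bochner_Integration.integral_sum) (rule int)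
  finally show ?thesis .
qed

text \<open>A simultaneous choice for all tetrahedra. Green's formula forces the outward unit
  normals, but their lengths and signs are never computed.\<close>

definition conormal :: "(real^3) set \<Rightarrow> (real^3) set \<Rightarrow> real^3" where
  "conormal = (SOME n. \<forall>T\<in>\<W>. (\<forall>F. F facet_of T \<longrightarrow> (\<forall>u\<in>tangent_space F. n T F \<bullet> u = 0)) \<and>
    (\<forall>\<psi> w. C1 \<psi> \<longrightarrow> set_int T (\<lambda>x. w \<bullet> grad \<psi> x) = (\<Sum>F | F facet_of T. (n T F \<bullet> w) * flat2 F \<psi>)))"

lemma conormal:
  assumes "T \<in> \<W>"
  shows "\<And>F u. F facet_of T \<Longrightarrow> u \<in> tangent_space F \<Longrightarrow> conormal T F \<bullet> u = 0"
    "\<And>\<psi> w. C1 \<psi> \<Longrightarrow> set_int T (\<lambda>x. w \<bullet> grad \<psi> x) = (\<Sum>F | F facet_of T. (conormal T F \<bullet> w) * flat2 F \<psi>)"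
proof -
  have "\<forall>T\<in>\<W>. \<exists>n. (\<forall>F. F facet_of T \<longrightarrow> (\<forall>u\<in>tangent_space F. n F \<bullet> u = 0)) \<and>
    (\<forall>\<psi> w. C1 \<psi> \<longrightarrow> set_int T (\<lambda>x. w \<bullet> grad \<psi> x) = (\<Sum>F | F facet_of T. (n F \<bullet> w) * flat2 F \<psi>))"
    by (intro ballI green_tetrahedron mesh_simplex)
  from bchoice[OF this] have "\<forall>T\<in>\<W>. (\<forall>F. F facet_of T \<longrightarrow> (\<forall>u\<in>tangent_space F. conormal T F \<bullet> u = 0)) \<and>
    (\<forall>\<psi> w. C1 \<psi> \<longrightarrow> set_int T (\<lambda>x. w \<bullet> grad \<psi> x) = (\<Sum>F | F facet_of T. (conormal T F \<bullet> w) * flat2 F \<psi>))"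
    unfolding conormal_def by (rule someI_ex)
  then show "\<And>F u. F facet_of T \<Longrightarrow> u \<in> tangent_space F \<Longrightarrow> conormal T F \<bullet> u = 0"
    "\<And>\<psi> w. C1 \<psi> \<Longrightarrow> set_int T (\<lambda>x. w \<bullet> grad \<psi> x) = (\<Sum>F | F facet_of T. (conormal T F \<bullet> w) * flat2 F \<psi>)"
    using assms by blast+
qed

lemma green_mesh:
  assumes "\<And>T. T \<in> \<W> \<Longrightarrow> C1 (\<psi> T)"
  shows "(\<Sum>T\<in>\<W>. set_int T (\<lambda>x. w \<bullet> grad (\<psi> T) x))
    = (\<Sum>F\<in>cells \<W> 2. \<Sum>T | T \<in> \<W> \<and> F facet_of T. (conormal T F \<bullet> w) * flat2 F (\<psi> T))"
  unfolding sum_facets_swap[symmetric] by (intro sum.cong refl conormal(2) assms)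

lemma flat_zero: "(\<And>x. x \<in> s \<Longrightarrow> g x = 0) \<Longrightarrow> flat_integral D s g = 0"
  for g :: "real^3 \<Rightarrow> 'v::euclidean_space"
  using flat_integral_cong[of s g "\<lambda>_. 0" D] by (simp add: flat_integral_chart set_lebesgue_integral_def)

text \<open>A cell that is not interior lies in the frontier, which the open set
  \<open>\<Omega>\<close> does not meet.\<close>

lemma boundary_cell_zero:
  assumes "s \<in> cells \<W> d" "s \<notin> interior_cells \<Omega> \<W> d" "csupp \<Omega> \<phi>" "x \<in> s"
  shows "\<phi> x = 0"
proof -
  have "x \<in> frontier \<Omega>" using assms by (auto simp: interior_cells_eq)
  then have "x \<notin> \<Omega>" using open_dom by (simp add: frontier_def interior_open)
  then show ?thesis using csupp_zero[OF assms(3)] by blast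
qed

text \<open>Testing the divergence theorem with a bump function at a point of \<open>F\<close> yields the
  cancellation of conormals without any discussion of the two sides of \<open>F\<close>.\<close>

lemma conormal_sum_0:
  assumes F: "F \<in> interior_cells \<Omega> \<W> 2"
  shows "(\<Sum>T | T \<in> \<W> \<and> F facet_of T. conormal T F) = 0"
proof -
  have Fc: "F \<in> cells \<W> 2" using F by (auto simp: interior_cells_eq)
  obtain x where x: "x \<in> rel_interior F" "x \<in> \<Omega>" using interior_cell_point[OF mesh F open_dom] by auto
  obtain r where r: "r > 0" "cball x r \<subseteq> \<Omega>" "\<And>b B. B \<in> cells \<W> b \<Longrightarrow> b \<le> 2 \<Longrightarrow> B \<noteq> F \<Longrightarrow> B \<inter> cball x r = {}"
    by (rule cell_isolated[OF mesh Fc x open_dom]; rule that; assumption)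
  define \<psi> where "\<psi> = bump x r"
  have \<psi>: "C1 \<psi>" unfolding \<psi>_def using C2_bump C2_C1 by blast
  have out: "\<psi> y = 0" if "y \<notin> ball x r" for y unfolding \<psi>_def using bump_outside r(1) that by blast
  have pos: "flat2 F \<psi> > 0"
  proof (rule flat2_positive[OF cells_simplex[OF mesh Fc] C1_continuous[OF \<psi>]])
    show "x \<in> F" using x rel_interior_subset by blast
  qed (use r(1) in \<open>auto simp: \<psi>_def bump_nonneg bump_center\<close>)
  have "(\<Sum>T | T \<in> \<W> \<and> F facet_of T. conormal T F) \<bullet> w = 0" for w
  proof -
    obtain T0 where T0: "T0 \<in> \<W>" using Fc by (auto simp: cells_def)
    have gout: "grad \<psi> y = 0" if "y \<notin> cball x r" for y
    proof -
      have "pd i \<psi> y = 0" for i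
        by (rule vanish_pd[of "- cball x r"]) (use that out in auto)
      then show ?thesis by (simp add: vec_eq_iff)
    qed
    have g0: "w \<bullet> grad \<psi> y = 0" if "y \<notin> \<Omega>" for y
    proof -
      have "y \<notin> cball x r" using that r(2) by blast
      from gout[OF this] show ?thesis by simp
    qed
    \<comment> \<open>The integral over the whole space vanishes; rewritten as a sum over facets, it
      keeps only \<open>F\<close>, the one facet that meets the support of the bump.\<close>
    have "0 = integral\<^sup>L lborel (\<lambda>x. w \<bullet> grad \<psi> x)"
    proof (rule integral_grad_eq_0[OF mesh_simplex[OF T0] \<psi> compact_cball, symmetric])
      fix y assume "y \<notin> cball x r"
      then show "\<psi> y = 0" using out[of y] ball_subset_cball[of x r] by blast
    qed
    also have "\<dots> = integral\<^sup>L lebesgue (\<lambda>x. w \<bullet> grad \<psi> x)"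
      using borel_measurable_continuous_onI[OF continuous_dir[OF \<psi>]] by (intro integral_completion[symmetric]) simp
    also have "\<dots> = (\<Sum>T\<in>\<W>. set_int T (\<lambda>x. w \<bullet> grad \<psi> x))"
    proof (rule integral_split)
      show "(\<lambda>x. w \<bullet> grad \<psi> x) \<in> borel_measurable lebesgue"
        using borel_measurable_continuous_onI[OF continuous_dir[OF \<psi>]] by (intro measurable_completion) simp
    qed (rule g0 refl continuous_dir[OF \<psi>] | assumption)+
    also have "\<dots> = (\<Sum>F\<in>cells \<W> 2. \<Sum>T | T \<in> \<W> \<and> F facet_of T. (conormal T F \<bullet> w) * flat2 F \<psi>)"
      using green_mesh[of "\<lambda>_. \<psi>" w] \<psi> by simp
    also have "\<dots> = (\<Sum>G\<in>{F}. \<Sum>T | T \<in> \<W> \<and> G facet_of T. (conormal T G \<bullet> w) * flat2 G \<psi>)"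
    proof (rule sum.mono_neutral_right[OF finite_cells[OF mesh]])
      show "\<forall>G\<in>cells \<W> 2 - {F}. (\<Sum>T | T \<in> \<W> \<and> G facet_of T. (conormal T G \<bullet> w) * flat2 G \<psi>) = 0"
      proof
        fix G assume "G \<in> cells \<W> 2 - {F}"
        then have "G \<inter> cball x r = {}" using r(3) by auto
        then have "\<psi> y = 0" if "y \<in> G" for y using that out[of y] ball_subset_cball[of x r] by blast
        then show "(\<Sum>T | T \<in> \<W> \<and> G facet_of T. (conormal T G \<bullet> w) * flat2 G \<psi>) = 0" by (simp add: flat_zero)
      qed
    qed (use Fc in auto)
    finally have "(\<Sum>T | T \<in> \<W> \<and> F facet_of T. conormal T F \<bullet> w) * flat2 F \<psi> = 0"
      by (simp add: sum_distrib_right)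
    then show ?thesis using pos by (simp add: inner_sum_left)
  qed
  then show ?thesis by (metis inner_eq_zero_iff)
qed

text \<open>Compatibility makes the product single-valued on interior facets, where the conormals
  sum to 0; on boundary facets \<open>\<phi>\<close> vanishes. No facet term survives.\<close>

lemma mesh_by_parts:
  assumes \<phi>: "C1 \<phi>" "csupp \<Omega> \<phi>" and g: "\<And>T. T \<in> \<W> \<Longrightarrow> C1 (g T)"
    and compat: "\<And>F T T' x. F \<in> interior_cells \<Omega> \<W> 2 \<Longrightarrow> T \<in> \<W> \<Longrightarrow> T' \<in> \<W> \<Longrightarrow> F facet_of T \<Longrightarrow> F facet_of T' \<Longrightarrow> x \<in> F \<Longrightarrow> g T x = g T' x"
  shows "(\<Sum>T\<in>\<W>. set_int T (\<lambda>x. pd j \<phi> x * g T x)) = - (\<Sum>T\<in>\<W>. set_int T (\<lambda>x. \<phi> x * pd j (g T) x))"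
proof -
  have C: "C1 (\<lambda>x. \<phi> x * g T x)" if "T \<in> \<W>" for T by (rule C1_mult[OF \<phi>(1) g[OF that]])
  have "(\<Sum>T | T \<in> \<W> \<and> F facet_of T. (conormal T F \<bullet> axis j 1) * flat2 F (\<lambda>x. \<phi> x * g T x)) = 0" if F: "F \<in> cells \<W> 2" for F
  proof (cases "F \<in> interior_cells \<Omega> \<W> 2")
    case False
    then show ?thesis using boundary_cell_zero[OF F False \<phi>(2)] by (simp add: flat_zero)
  next
    case True
    obtain T0 where "T0 \<in> \<W>" "F face_of T0" using F by (auto simp: cells_def)
    then have T0: "T0 \<in> \<W>" "F facet_of T0" using cells_facet F by auto
    have "(\<Sum>T | T \<in> \<W> \<and> F facet_of T. (conormal T F \<bullet> axis j 1) * flat2 F (\<lambda>x. \<phi> x * g T x))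
      = (\<Sum>T | T \<in> \<W> \<and> F facet_of T. (conormal T F \<bullet> axis j 1) * flat2 F (\<lambda>x. \<phi> x * g T0 x))"
    proof (rule sum.cong[OF refl])
      fix T assume "T \<in> {T. T \<in> \<W> \<and> F facet_of T}"
      then have "flat2 F (\<lambda>x. \<phi> x * g T x) = flat2 F (\<lambda>x. \<phi> x * g T0 x)"
        using compat[OF True _ T0(1) _ T0(2)] by (intro flat_integral_cong) auto
      then show "(conormal T F \<bullet> axis j 1) * flat2 F (\<lambda>x. \<phi> x * g T x) = (conormal T F \<bullet> axis j 1) * flat2 F (\<lambda>x. \<phi> x * g T0 x)" by simp
    qed
    also have "\<dots> = ((\<Sum>T | T \<in> \<W> \<and> F facet_of T. conormal T F) \<bullet> axis j 1) * flat2 F (\<lambda>x. \<phi> x * g T0 x)"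
      by (simp add: inner_sum_left sum_distrib_right)
    finally show ?thesis using conormal_sum_0[OF True] by simp
  qed
  then have "(\<Sum>F\<in>cells \<W> 2. \<Sum>T | T \<in> \<W> \<and> F facet_of T. (conormal T F \<bullet> axis j 1) * flat2 F (\<lambda>x. \<phi> x * g T x)) = 0"
    by (rule sum.neutral[OF ballI])
  with green_mesh[of "\<lambda>T x. \<phi> x * g T x" "axis j 1", OF C]
  have "(\<Sum>T\<in>\<W>. set_int T (\<lambda>x. axis j 1 \<bullet> grad (\<lambda>x. \<phi> x * g T x) x)) = 0"
    by (rule trans)
  moreover have "set_int T (\<lambda>x. axis j 1 \<bullet> grad (\<lambda>x. \<phi> x * g T x) x)
     = set_int T (\<lambda>x. \<phi> x * pd j (g T) x) + set_int T (\<lambda>x. pd j \<phi> x * g T x)" if T: "T \<in> \<W>" for T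
  proof -
    have "set_int T (\<lambda>x. axis j 1 \<bullet> grad (\<lambda>x. \<phi> x * g T x) x) = set_int T (\<lambda>x. \<phi> x * pd j (g T) x + pd j \<phi> x * g T x)"
      by (rule set_int_cong) (simp add: inner_axis' pd_mult[OF \<phi>(1) g[OF T]])
    also have "\<dots> = set_int T (\<lambda>x. \<phi> x * pd j (g T) x) + set_int T (\<lambda>x. pd j \<phi> x * g T x)"
      by (intro set_integral_add set_integrable_compact[OF mesh_compact[OF T]] continuous_intros
          C1_continuous C1_continuous_pd \<phi> g T)
    finally show ?thesis .
  qed
  ultimately show ?thesis by (simp add: sum.distrib)
qed

text \<open>The frontiers of the tetrahedra form a null set, so the pairing only sees the polynomial
  pieces.\<close>

lemma reg_dist_eq:
  fixes \<sigma> :: "real^3 \<Rightarrow> 'v::euclidean_space"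
  assumes \<phi>: "\<phi> \<in> test_fun \<Omega>" and m: "set_borel_measurable lebesgue \<Omega> \<sigma>"
    and q: "\<And>T. T \<in> \<W> \<Longrightarrow> continuous_on T (q T)" "\<And>T x. T \<in> \<W> \<Longrightarrow> x \<in> interior T \<Longrightarrow> \<sigma> x = q T x"
  shows "reg_dist \<Omega> \<sigma> \<phi> = (\<Sum>T\<in>\<W>. set_int T (\<lambda>x. \<phi> x *\<^sub>R q T x))"
proof -
  have c: "continuous_on S \<phi>" for S by (rule C1_continuous[OF test_fun_C1[OF \<phi>]])
  have z: "\<phi> x = 0" if "x \<notin> \<Omega>" for x using csupp_zero[OF test_fun_csupp[OF \<phi>]] that by blast
  have "\<phi> \<in> borel_measurable lebesgue"
    using borel_measurable_continuous_onI[OF c] by (intro measurable_completion) simp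
  then have "(\<lambda>x. \<phi> x *\<^sub>R (indicator \<Omega> x *\<^sub>R \<sigma> x)) \<in> borel_measurable lebesgue"
    using m unfolding set_borel_measurable_def by (rule borel_measurable_scaleR)
  then have m': "(\<lambda>x. indicator \<Omega> x *\<^sub>R (\<phi> x *\<^sub>R \<sigma> x)) \<in> borel_measurable lebesgue"
    by (simp add: mult.commute)
  have "reg_dist \<Omega> \<sigma> \<phi> = integral\<^sup>L lebesgue (\<lambda>x. indicator \<Omega> x *\<^sub>R (\<phi> x *\<^sub>R \<sigma> x))"
    using \<phi> by (simp add: reg_dist_def on_test_def set_lebesgue_integral_def)
  also have "\<dots> = (\<Sum>T\<in>\<W>. set_int T (\<lambda>x. \<phi> x *\<^sub>R q T x))"
    by (rule integral_split[OF m']) (use q z in \<open>auto intro!: continuous_intros c\<close>)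
  finally show ?thesis .
qed

end

section \<open>Calculus of distributions\<close>

text \<open>The Levi-Civita symbol: it turns the curl into an index contraction, and the
  cancellations of this section into instances of antisymmetry.\<close>

definition lc :: "3 \<Rightarrow> 3 \<Rightarrow> 3 \<Rightarrow> real" where
  "lc i j k = (if (i, j, k) \<in> {(1,2,3),(2,3,1),(3,1,2)} then 1
     else if (i, j, k) \<in> {(1,3,2),(3,2,1),(2,1,3)} then -1 else 0)"

lemma lc_swap: "lc i k l = - lc i l k" "lc j m n = - lc m j n"
proof -
  have "\<forall>i k l. lc i k l = - lc i l k" by (simp add: forall_3 lc_def)
  then show "lc i k l = - lc i l k" by blast
  have "\<forall>j m n. lc j m n = - lc m j n" by (simp add: forall_3 lc_def)
  then show "lc j m n = - lc m j n" by blast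
qed

text \<open>Exchanging the names of the two indices shows that the sum is its own negative.\<close>

lemma antisym_sum_0:
  fixes a A :: "'i::finite \<Rightarrow> 'i \<Rightarrow> real"
  assumes "\<And>k l. a k l = - a l k" "\<And>k l. A k l = A l k"
  shows "(\<Sum>k\<in>UNIV. \<Sum>l\<in>UNIV. a k l * A k l) = 0"
proof -
  have "(\<Sum>k\<in>UNIV. \<Sum>l\<in>UNIV. a k l * A k l) = (\<Sum>l\<in>UNIV. \<Sum>k\<in>UNIV. a k l * A k l)"
    by (rule sum.swap)
  also have "\<dots> = (\<Sum>l\<in>UNIV. \<Sum>k\<in>UNIV. - (a l k * A l k))"
  proof (intro sum.cong refl)
    fix k l show "a k l * A k l = - (a l k * A l k)" using assms(1)[of k l] assms(2)[of k l] by simp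
  qed
  also have "\<dots> = - (\<Sum>k\<in>UNIV. \<Sum>l\<in>UNIV. a k l * A k l)" by (simp add: sum_negf)
  finally show ?thesis by simp
qed

lemma dpd_test: "\<phi> \<in> test_fun \<Omega> \<Longrightarrow> dpd \<Omega> i F \<phi> = - F (pd i \<phi>)"
  by (simp add: dpd_def on_test_def)

lemma dpd_not_test: "\<phi> \<notin> test_fun \<Omega> \<Longrightarrow> dpd \<Omega> i F \<phi> = 0"
  by (simp add: dpd_def on_test_def)

lemma dcurl_vec_nth: "dcurl_vec \<Omega> U \<phi> $ i = (\<Sum>k\<in>UNIV. \<Sum>l\<in>UNIV. lc i k l * dpd \<Omega> k U \<phi> $ l)"
proof -
  have "i = 1 \<or> i = 2 \<or> i = 3" by (rule exhaust_3)
  then show ?thesis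
    by (elim disjE) (simp_all add: dcurl_vec_def sum_3 lc_def)
qed

lemma dcurl_nth:
  assumes "\<phi> \<in> test_fun \<Omega>"
  shows "dcurl \<Omega> S \<phi> $ n $ i = - (\<Sum>k\<in>UNIV. \<Sum>l\<in>UNIV. lc i k l * S (pd k \<phi>) $ n $ l)"
  by (simp add: dcurl_def dcurl_vec_nth dpd_test[OF assms] sum_negf)

text \<open>Each curl moves one derivative onto the test function with a minus sign, and the two
  signs cancel. The transpose lets the second curl contract the row index \<open>n\<close>.\<close>

lemma dinc_nth:
  assumes "\<phi> \<in> test_fun \<Omega>"
  shows "dinc \<Omega> S \<phi> $ i $ j =
    (\<Sum>m\<in>UNIV. \<Sum>n\<in>UNIV. \<Sum>k\<in>UNIV. \<Sum>l\<in>UNIV. lc j m n * lc i k l * S (pd k (pd m \<phi>)) $ n $ l)"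
  unfolding dinc_def dcurl_nth[OF assms] transpose_def
  by (simp add: dcurl_nth[OF test_fun_pd[OF assms]] sum_negf sum_distrib_left mult.assoc)

lemma dinc_not_test: "\<phi> \<notin> test_fun \<Omega> \<Longrightarrow> dinc \<Omega> S \<phi> = 0"
  unfolding dinc_def dcurl_def by (simp add: vec_eq_iff dcurl_vec_nth dpd_not_test)

lemma ddef_nth:
  assumes "\<phi> \<in> test_fun \<Omega>"
  shows "ddef \<Omega> U \<phi> $ a $ b = - (1/2) * (U (pd b \<phi>) $ a + U (pd a \<phi>) $ b)"
  by (simp add: ddef_def dgrad_def transpose_def dpd_test[OF assms] algebra_simps)

lemma ddef_not_test: "\<phi> \<notin> test_fun \<Omega> \<Longrightarrow> ddef \<Omega> U \<phi> = 0"
  by (simp add: ddef_def dgrad_def transpose_def dpd_not_test vec_eq_iff)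

lemma ddiv_nth:
  assumes "\<phi> \<in> test_fun \<Omega>"
  shows "ddiv \<Omega> M \<phi> $ i = - (\<Sum>j\<in>UNIV. M (pd j \<phi>) $ i $ j)"
  by (simp add: ddiv_def ddiv_vec_def dpd_test[OF assms] sum_negf)

lemma ddiv_not_test: "\<phi> \<notin> test_fun \<Omega> \<Longrightarrow> ddiv \<Omega> M \<phi> = 0"
  by (simp add: ddiv_def ddiv_vec_def dpd_not_test vec_eq_iff)

text \<open>Each half of the symmetric gradient sets two derivatives against an antisymmetric
  symbol: in the indices \<open>k\<close>, \<open>l\<close> for one half and \<open>m\<close>,
  \<open>n\<close> for the other.\<close>

theorem dinc_ddef: "dinc \<Omega> (ddef \<Omega> U) = (\<lambda>_. 0)"
proof
  fix \<phi>
  show "dinc \<Omega> (ddef \<Omega> U) \<phi> = 0"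
  proof (cases "\<phi> \<in> test_fun \<Omega>")
    case False then show ?thesis by (rule dinc_not_test)
  next
    case t: True
    have comm: "pd a (pd b \<psi>) = pd b (pd a \<psi>)" if "\<psi> \<in> test_fun \<Omega>" for a b \<psi>
      by (rule pd_commute[OF test_fun_C2[OF that]])
    let ?V = "\<lambda>a k m n. U (pd a (pd k (pd m \<phi>))) $ n"
    have "dinc \<Omega> (ddef \<Omega> U) \<phi> $ i $ j = 0" for i j
    proof -
      have "dinc \<Omega> (ddef \<Omega> U) \<phi> $ i $ j
        = (\<Sum>m\<in>UNIV. \<Sum>n\<in>UNIV. \<Sum>k\<in>UNIV. \<Sum>l\<in>UNIV. lc j m n * lc i k l * (- (1/2) * (?V l k m n + ?V n k m l)))"
        unfolding dinc_nth[OF t] by (simp only: ddef_nth[OF test_fun_pd[OF test_fun_pd[OF t]]])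
      also have "\<dots> = (\<Sum>m\<in>UNIV. \<Sum>n\<in>UNIV. - (1/2) * lc j m n * (\<Sum>k\<in>UNIV. \<Sum>l\<in>UNIV. lc i k l * ?V l k m n))
          + (\<Sum>m\<in>UNIV. \<Sum>n\<in>UNIV. lc j m n * (- (1/2) * (\<Sum>k\<in>UNIV. \<Sum>l\<in>UNIV. lc i k l * ?V n k m l)))"
        by (simp only: sum.distrib[symmetric] sum_distrib_left) (intro sum.cong refl, simp add: algebra_simps)
      also have "(\<Sum>m\<in>UNIV. \<Sum>n\<in>UNIV. - (1/2) * lc j m n * (\<Sum>k\<in>UNIV. \<Sum>l\<in>UNIV. lc i k l * ?V l k m n)) = 0"
      proof (intro sum.neutral ballI)
        fix m n
        have "(\<Sum>k\<in>UNIV. \<Sum>l\<in>UNIV. lc i k l * ?V l k m n) = 0"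
          by (rule antisym_sum_0[OF lc_swap(1)]) (subst comm[OF test_fun_pd[OF t]], rule refl)
        then show "- (1/2) * lc j m n * (\<Sum>k\<in>UNIV. \<Sum>l\<in>UNIV. lc i k l * ?V l k m n) = 0" by simp
      qed
      also have "(\<Sum>m\<in>UNIV. \<Sum>n\<in>UNIV. lc j m n * (- (1/2) * (\<Sum>k\<in>UNIV. \<Sum>l\<in>UNIV. lc i k l * ?V n k m l))) = 0"
      proof (rule antisym_sum_0[OF lc_swap(1)])
        fix m n
        have "?V n k m l = ?V m k n l" for k l
        proof -
          \<comment> \<open>Three adjacent swaps exchange \<open>m\<close> and \<open>n\<close>
            across the middle derivative.\<close>
          have "pd n (pd k (pd m \<phi>)) = pd k (pd n (pd m \<phi>))" by (rule comm[OF test_fun_pd[OF t]])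
          also have "\<dots> = pd k (pd m (pd n \<phi>))" by (simp only: comm[OF t, of n m])
          also have "\<dots> = pd m (pd k (pd n \<phi>))" by (rule comm[OF test_fun_pd[OF t]])
          finally show ?thesis by simp
        qed
        then show "- (1/2) * (\<Sum>k\<in>UNIV. \<Sum>l\<in>UNIV. lc i k l * ?V n k m l) = - (1/2) * (\<Sum>k\<in>UNIV. \<Sum>l\<in>UNIV. lc i k l * ?V m k n l)"
          by simp
      qed
      finally show ?thesis by simp
    qed
    then show ?thesis by (simp add: vec_eq_iff)
  qed
qed

text \<open>The derivative of the divergence joins that of the second curl in the symbol
  \<open>lc j m n\<close>, against which commuting derivatives cancel.\<close>

theorem ddiv_dinc: "ddiv \<Omega> (dinc \<Omega> S) = (\<lambda>_. 0)"
proof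
  fix \<phi>
  show "ddiv \<Omega> (dinc \<Omega> S) \<phi> = 0"
  proof (cases "\<phi> \<in> test_fun \<Omega>")
    case False then show ?thesis by (rule ddiv_not_test)
  next
    case t: True
    have "ddiv \<Omega> (dinc \<Omega> S) \<phi> $ i = 0" for i
    proof -
      let ?A = "\<lambda>j m. \<Sum>n\<in>UNIV. \<Sum>k\<in>UNIV. \<Sum>l\<in>UNIV. lc j m n * lc i k l * S (pd k (pd m (pd j \<phi>))) $ n $ l"
      have "?A j m = - ?A m j" for j m
      proof -
        have "pd m (pd j \<phi>) = pd j (pd m \<phi>)" by (rule pd_commute[OF test_fun_C2[OF t]])
        moreover have "lc j m n = - lc m j n" for n by (rule lc_swap(2))
        ultimately show ?thesis by (simp add: sum_negf)
      qed
      then have "(\<Sum>j\<in>UNIV. \<Sum>m\<in>UNIV. ?A j m * 1) = 0" by (rule antisym_sum_0) simp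
      then show ?thesis
        unfolding ddiv_nth[OF t] by (simp add: dinc_nth[OF test_fun_pd[OF t]])
    qed
    then show ?thesis by (simp add: vec_eq_iff)
  qed
qed

section \<open>The deformation operator\<close>

text \<open>Existence and uniqueness justify the definite description; afterwards a projection is
  recognized by the orthogonality of its residual.\<close>

lemma orthogonal_proj:
  assumes "subspace W"
  shows "orthogonal_proj W v \<in> W" "z \<in> W \<Longrightarrow> (v - orthogonal_proj W v) \<bullet> z = 0"
    "w \<in> W \<Longrightarrow> (\<And>z. z \<in> W \<Longrightarrow> (v - w) \<bullet> z = 0) \<Longrightarrow> orthogonal_proj W v = w"
proof -
  obtain y y' where yz: "y \<in> span W" "\<And>w. w \<in> span W \<Longrightarrow> orthogonal y' w" "v = y + y'"
    using orthogonal_subspace_decomp_exists[of W v] by metis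
  have sW: "span W = W" using assms by (simp add: span_eq_iff)
  have uniq: "w = w'" if "w \<in> W" "\<forall>z\<in>W. orthogonal (v - w) z" "w' \<in> W" "\<forall>z\<in>W. orthogonal (v - w') z" for w w'
  proof -
    have "w - w' \<in> W" using assms that subspace_diff by blast
    then have "(v - w) \<bullet> (w - w') = 0" "(v - w') \<bullet> (w - w') = 0"
      using that by (auto simp: orthogonal_def)
    then have "(w - w') \<bullet> (w - w') = 0" by (simp add: inner_diff_left)
    then show ?thesis by simp
  qed
  have ex: "\<exists>!w. w \<in> W \<and> (\<forall>z\<in>W. orthogonal (v - w) z)"
    by (rule ex1I[of _ y]) (use yz sW uniq in auto)
  from theI'[OF ex] show "orthogonal_proj W v \<in> W" "z \<in> W \<Longrightarrow> (v - orthogonal_proj W v) \<bullet> z = 0"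
    unfolding orthogonal_proj_def[symmetric] by (auto simp: orthogonal_def)
  show "w \<in> W \<Longrightarrow> (\<And>z. z \<in> W \<Longrightarrow> (v - w) \<bullet> z = 0) \<Longrightarrow> orthogonal_proj W v = w"
    unfolding orthogonal_proj_def using the1_equality[OF ex, of w] by (auto simp: orthogonal_def)
qed

lemma subspace_tangent: "subspace (tangent_space s)" by (simp add: tangent_space_def)

lemma proj_mat_mult: "proj_mat f *v v = orthogonal_proj (tangent_space f) v"
proof -
  note P = orthogonal_proj[OF subspace_tangent]
  have "linear (orthogonal_proj (tangent_space f))"
  proof (rule linearI)
    fix x y :: "real^3" and c :: real
    let ?P = "orthogonal_proj (tangent_space f)"
    have "(x + y - (?P x + ?P y)) \<bullet> z = 0" if "z \<in> tangent_space f" for z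
      using P(2)[OF that, of x] P(2)[OF that, of y] by (simp add: inner_diff_left inner_add_left)
    then show "?P (x + y) = ?P x + ?P y"
      by (intro P(3) subspace_add[OF subspace_tangent] P(1)) auto
    have "(c *\<^sub>R x - c *\<^sub>R ?P x) \<bullet> z = 0" if "z \<in> tangent_space f" for z
      using P(2)[OF that, of x] by (simp add: inner_diff_left)
    then show "?P (c *\<^sub>R x) = c *\<^sub>R ?P x"
      by (intro P(3) subspace_scale[OF subspace_tangent] P(1)) auto
  qed
  from fun_cong[OF matrix_vector_mul(2)[OF this], of v] show ?thesis unfolding proj_mat_def .
qed

text \<open>The projection is self-adjoint with range in the tangent space and fixes tangent
  vectors, so the sandwiched matrix carries exactly the bilinear form on tangent vectors.\<close>

lemma proj_mat_eq_iff:
  "proj_mat f ** A ** proj_mat f = proj_mat f ** B ** proj_mat f \<longleftrightarrow>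
    (\<forall>u\<in>tangent_space f. \<forall>v\<in>tangent_space f. u \<bullet> (A *v v) = u \<bullet> (B *v v))"
proof -
  note P = orthogonal_proj[OF subspace_tangent]
  let ?P = "orthogonal_proj (tangent_space f)"
  have sym: "x \<bullet> ?P y = ?P x \<bullet> y" for x y
    using P(2)[OF P(1), of x f y] P(2)[OF P(1), of y f x]
    by (simp add: inner_diff_left inner_diff_right inner_commute)
  have id: "?P u = u" if "u \<in> tangent_space f" for u by (rule P(3)[OF that]) simp
  have key: "x \<bullet> ((proj_mat f ** A ** proj_mat f) *v y) = ?P x \<bullet> (A *v ?P y)" for x y A
    by (simp only: matrix_vector_mul_assoc[symmetric] proj_mat_mult sym)
  show ?thesis
  proof
    assume eq: "proj_mat f ** A ** proj_mat f = proj_mat f ** B ** proj_mat f"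
    show "\<forall>u\<in>tangent_space f. \<forall>v\<in>tangent_space f. u \<bullet> (A *v v) = u \<bullet> (B *v v)"
    proof (intro ballI)
      fix u v assume "u \<in> tangent_space f" "v \<in> tangent_space f"
      then show "u \<bullet> (A *v v) = u \<bullet> (B *v v)" using key[of u A v] key[of u B v] eq id by simp
    qed
  next
    assume eq: "\<forall>u\<in>tangent_space f. \<forall>v\<in>tangent_space f. u \<bullet> (A *v v) = u \<bullet> (B *v v)"
    have "x \<bullet> ((proj_mat f ** A ** proj_mat f) *v y) = x \<bullet> ((proj_mat f ** B ** proj_mat f) *v y)" for x y
      unfolding key using eq P(1) by blast
    then have "(proj_mat f ** A ** proj_mat f) *v y = (proj_mat f ** B ** proj_mat f) *v y" for y
      using vector_eq_ldot by blast
    then show "proj_mat f ** A ** proj_mat f = proj_mat f ** B ** proj_mat f"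
      by (simp add: matrix_eq)
  qed
qed

text \<open>The point \<open>x\<close> may lie on the boundary of \<open>F\<close>, so only
  one-sided derivatives along segments inside \<open>F\<close> are available. Differences of such
  directions span the tangent space.\<close>

lemma tangential_derivative_0:
  assumes h: "C1 h" "\<And>y. y \<in> F \<Longrightarrow> h y = 0" and F: "convex F" "x \<in> F" and w: "w \<in> tangent_space F"
  shows "w \<bullet> grad h x = 0"
proof -
  have v: "(v - x) \<bullet> grad h x = 0" if v: "v \<in> F" for v
  proof -
    have der: "((\<lambda>t. h (x + t *\<^sub>R (v - x))) has_real_derivative (v - x) \<bullet> grad h x) (at 0)"
    proof -
      have "((\<lambda>t. x + t *\<^sub>R (v - x)) has_derivative (\<lambda>t. t *\<^sub>R (v - x))) (at 0)"
        by (auto intro!: derivative_eq_intros)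
      moreover have "(h has_derivative (\<lambda>k. k \<bullet> grad h x)) (at (x + 0 *\<^sub>R (v - x)))"
        using C1_has_derivative[OF h(1)] by simp
      ultimately have "((\<lambda>t. h (x + t *\<^sub>R (v - x))) has_derivative (\<lambda>t. (t *\<^sub>R (v - x)) \<bullet> grad h x)) (at 0)"
        by (rule has_derivative_compose)
      then show ?thesis by (simp add: has_field_derivative_def mult_commute_abs)
    qed
    have "x + t *\<^sub>R (v - x) \<in> F" if "0 \<le> t" "t \<le> 1" for t
      using convexD_alt[OF F(1,2) v that] by (simp add: algebra_simps)
    then have z: "h (x + t *\<^sub>R (v - x)) = 0" if "0 \<le> t" "t \<le> 1" for t using h(2) that by blast
    have "((\<lambda>t. h (x + t *\<^sub>R (v - x))) has_real_derivative (v - x) \<bullet> grad h x) (at 0 within {0..1})"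
      using der by (rule has_field_derivative_at_within)
    moreover have "((\<lambda>t. h (x + t *\<^sub>R (v - x))) has_real_derivative 0) (at 0 within {0..1})"
      by (rule has_field_derivative_transform_within[of "\<lambda>_. 0" 0 0 "{0..1}" 1]) (use z in auto)
    ultimately show ?thesis
      unfolding has_real_derivative_iff_has_vector_derivative
      by (rule vector_derivative_unique_within[rotated]) (simp add: at_within_Icc_at_right)
  qed
  have "tangent_space F \<subseteq> {w. grad h x \<bullet> w = 0}"
    unfolding tangent_space_def
  proof (rule span_minimal[OF _ subspace_hyperplane])
    show "{x - y |x y. x \<in> F \<and> y \<in> F} \<subseteq> {w. grad h x \<bullet> w = 0}"
    proof clarify
      fix a b assume "a \<in> F" "b \<in> F"
      then have "(a - x) \<bullet> grad h x = 0" "(b - x) \<bullet> grad h x = 0" using v by auto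
      then show "grad h x \<bullet> (a - b) = 0" by (simp add: inner_diff_left inner_diff_right inner_commute)
    qed
  qed
  then show ?thesis using w by (auto simp: inner_commute)
qed

lemma polys_linear:
  assumes "linear L" "q \<in> polys m V" "\<And>v. v \<in> V \<Longrightarrow> L v \<in> V'"
  shows "(\<lambda>x. L (q x)) \<in> polys m V'"
proof -
  obtain c where "range c \<subseteq> V" "q = (\<lambda>x. \<Sum>\<alpha> | (\<Sum>i\<in>UNIV. \<alpha> i) \<le> m. monom3 \<alpha> x *\<^sub>R c \<alpha>)"
    using assms(2) unfolding polys_def by auto
  then show ?thesis unfolding polys_def mem_Collect_eq
    by (intro exI[of _ "\<lambda>\<alpha>. L (c \<alpha>)"]) (use assms(3) in \<open>auto simp: linear_sum[OF assms(1)] linear_scale[OF assms(1)]\<close>)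
qed

lemma subspace_sym: "subspace sym_matrices"
  by (auto simp: subspace_def sym_matrices_def transpose_def vec_eq_iff)

lemma bounded_linear_nth2: "bounded_linear (\<lambda>A :: real^3^3. A $ i $ j)"
  using bounded_linear_compose[OF bounded_linear_vec_nth[of j] bounded_linear_vec_nth[of i]] by simp

context tet_mesh
begin

lemma set_int_nth:
  fixes g :: "real^3 \<Rightarrow> real^3"
  assumes "T \<in> \<W>" "continuous_on T g"
  shows "set_int T g $ i = set_int T (\<lambda>x. g x $ i)"
  using set_int_linear[OF bounded_linear_vec_nth mesh_compact[OF assms(1)] assms(2)] by simp

lemma set_int_nth2:
  fixes g :: "real^3 \<Rightarrow> real^3^3"
  assumes "T \<in> \<W>" "continuous_on T g"
  shows "set_int T g $ i $ j = set_int T (\<lambda>x. g x $ i $ j)"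
  using set_int_linear[OF bounded_linear_nth2 mesh_compact[OF assms(1)] assms(2)] by simp

lemma zero_in_Lag: "(\<lambda>_. 0 :: 'v::euclidean_space) \<in> Lag \<Omega> \<W> m"
proof -
  have 1: "reg_dist \<Omega> (\<lambda>_. 0 :: 'v) = (\<lambda>_. 0)"
    by (auto simp: reg_dist_def on_test_def set_lebesgue_integral_def fun_eq_iff)
  have 2: "\<forall>T\<in>\<W>. \<exists>q\<in>polys m UNIV. \<forall>x\<in>T. (0 :: 'v) = q x"
    by (intro ballI bexI[of _ "\<lambda>_. 0"] refl polys_0 subspace_UNIV)
  show ?thesis unfolding Lag_def mem_Collect_eq
    by (intro exI[of _ "\<lambda>_. 0 :: 'v"] conjI 1[symmetric] 2 continuous_on_const)
qed

lemma zero_in_Upsilon: "(\<lambda>_. 0) \<in> Upsilon_WF \<Omega> \<W>"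
proof -
  have "ddiv_vec \<Omega> (\<lambda>_. 0) = (\<lambda>_. 0)"
    by (auto simp: ddiv_vec_def dpd_def on_test_def fun_eq_iff)
  then show ?thesis by (simp add: Upsilon_WF_def zero_in_Lag)
qed

lemma bounded_dom: "bounded \<Omega>"
proof -
  have "bounded (\<Union>\<W>)" using finite_mesh mesh_compact compact_imp_bounded by blast
  then show ?thesis using mesh_cover bounded_subset closure_subset by metis
qed

text \<open>Continuity of \<open>u\<close> removes all face terms, so \<open>def\<close> acts
  piecewise. Two pieces that agree on a face have equal tangential derivatives there, which gives
  tangential-tangential continuity; and the trace of \<open>def u\<close> is the divergence, which
  lies in the Lagrange space by assumption.\<close>

lemma ddef_in_Sigma:
  assumes U: "U \<in> Upsilon_WF \<Omega> \<W>"
  shows "ddef \<Omega> U \<in> Sigma_WF \<Omega> \<W>"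
proof -
  obtain u where u: "U = reg_dist \<Omega> u" "continuous_on (closure \<Omega>) u"
    "\<forall>T\<in>\<W>. \<exists>q. q \<in> polys 2 UNIV \<and> (\<forall>x\<in>T. u x = q x)"
  proof -
    have "U \<in> Lag \<Omega> \<W> 2" using U by (simp add: Upsilon_WF_def)
    then show thesis using that unfolding Lag_def Bex_def by auto
  qed
  from bchoice[OF u(3)] obtain q where q: "\<And>T. T \<in> \<W> \<Longrightarrow> q T \<in> polys 2 UNIV" "\<And>T x. T \<in> \<W> \<Longrightarrow> x \<in> T \<Longrightarrow> u x = q T x"
    by auto
  have "\<forall>T\<in>\<W>. \<exists>dq. (\<forall>i. dq i \<in> polys 1 UNIV) \<and> (\<forall>a. C1 (\<lambda>x. q T x $ a)) \<and> (\<forall>i a x. pd i (\<lambda>x. q T x $ a) x = dq i x $ a)"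
  proof
    fix T assume "T \<in> \<W>"
    obtain dq where dq: "\<And>i. dq i \<in> polys (2 - 1) UNIV" "\<And>l. bounded_linear l \<Longrightarrow> C1 (\<lambda>x. l (q T x))"
      "\<And>l i x. bounded_linear l \<Longrightarrow> pd i (\<lambda>x. l (q T x)) x = l (dq i x)"
      by (rule polys_C1[OF subspace_UNIV q(1)[OF \<open>T \<in> \<W>\<close>]]; rule that; assumption)
    show "\<exists>dq. (\<forall>i. dq i \<in> polys 1 UNIV) \<and> (\<forall>a. C1 (\<lambda>x. q T x $ a)) \<and> (\<forall>i a x. pd i (\<lambda>x. q T x $ a) x = dq i x $ a)"
      using dq(1) dq(2,3)[OF bounded_linear_vec_nth] by (intro exI[of _ dq]) simp
  qed
  from bchoice[OF this] obtain dq where dq0: "\<forall>T\<in>\<W>. (\<forall>i. dq T i \<in> polys 1 UNIV) \<and>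
    (\<forall>a. C1 (\<lambda>x. q T x $ a)) \<and> (\<forall>i a x. pd i (\<lambda>x. q T x $ a) x = dq T i x $ a)" ..
  have dq: "\<And>T i. T \<in> \<W> \<Longrightarrow> dq T i \<in> polys 1 UNIV"
    "\<And>T a. T \<in> \<W> \<Longrightarrow> C1 (\<lambda>x. q T x $ a)" "\<And>T i a x. T \<in> \<W> \<Longrightarrow> pd i (\<lambda>x. q T x $ a) x = dq T i x $ a"
    using dq0 by blast+
  \<comment> \<open>The share of the derivative in direction \<open>i\<close> in the symmetric
    gradient, as a linear map: linearity keeps the degree, and the values are visibly
    symmetric.\<close>
  define L :: "3 \<Rightarrow> real^3 \<Rightarrow> real^3^3" where "L i v = (1/2) *\<^sub>R (outer v (axis i 1) + outer (axis i 1) v)" for i v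
  have L: "linear (L i)" for i
    by (rule linearI) (simp_all add: L_def outer_def vec_eq_iff algebra_simps)
  define s where "s T x = (\<Sum>i\<in>UNIV. L i (dq T i x))" for T x
  have s_nth: "s T x $ a $ b = (1/2) * (dq T b x $ a + dq T a x $ b)" for T x a b
  proof -
    have "s T x $ a $ b = (\<Sum>i\<in>UNIV. (1/2) * (if i = b then dq T i x $ a else 0)) + (\<Sum>i\<in>UNIV. (1/2) * (if i = a then dq T i x $ b else 0))"
      unfolding s_def sum.distrib[symmetric] by (auto simp: L_def outer_def axis_def intro!: sum.cong)
    also have "\<dots> = (1/2) * dq T b x $ a + (1/2) * dq T a x $ b"
      unfolding sum_distrib_left[symmetric] by (simp only: sum.delta' sum.delta finite UNIV_I if_True)
    finally show ?thesis by simp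
  qed
  have sp: "s T \<in> polys 1 sym_matrices" if "T \<in> \<W>" for T
    unfolding s_def
  proof (intro polys_sum subspace_sym)
    fix i
    show "(\<lambda>x. L i (dq T i x)) \<in> polys 1 sym_matrices"
      by (rule polys_linear[OF L dq(1)[OF that]]) (simp add: L_def sym_matrices_def outer_def transpose_def vec_eq_iff add.commute mult.commute)
  qed
  have sc: "continuous_on S (s T)" if "T \<in> \<W>" for S T
    by (rule polys_continuous[OF subspace_sym sp[OF that]])
  \<comment> \<open>A piecewise representative, set to 0 off the interiors of the
    tetrahedra.\<close>
  define \<sigma> where "\<sigma> x = (\<Sum>T\<in>\<W>. indicator (interior T) x *\<^sub>R s T x)" for x
  have \<sigma>s: "\<sigma> x = s T x" if T: "T \<in> \<W>" "x \<in> interior T" for T x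
  proof -
    have ne: "x \<notin> interior S" if "S \<in> \<W> - {T}" for S
      using mesh_interior_disjoint[OF T(1) _ T(2), of S] that interior_subset[of S] by auto
    have "\<sigma> x = (\<Sum>S\<in>{T}. indicator (interior S) x *\<^sub>R s S x)"
      unfolding \<sigma>_def by (rule sum.mono_neutral_right[OF finite_mesh]) (use T ne in simp_all)
    then show ?thesis using T by simp
  qed
  have \<sigma>m: "\<sigma> \<in> borel_measurable borel"
    unfolding \<sigma>_def
  proof (intro borel_measurable_sum)
    fix T assume "T \<in> \<W>"
    have [measurable]: "s T \<in> borel_measurable borel" by (rule borel_measurable_continuous_onI[OF sc[OF \<open>T \<in> \<W>\<close>]])
    show "(\<lambda>x. indicator (interior T) x *\<^sub>R s T x) \<in> borel_measurable borel" by measurable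
  qed
  have \<Omega>b: "\<Omega> \<in> sets borel" using open_dom by simp
  have "(\<lambda>x. indicator \<Omega> x *\<^sub>R \<sigma> x) \<in> borel_measurable lborel" using \<sigma>m \<Omega>b by simp
  then have \<sigma>l: "set_borel_measurable lebesgue \<Omega> \<sigma>"
    unfolding set_borel_measurable_def by (rule measurable_completion)
  have sq: "square_integrable_on \<Omega> \<sigma>"
  proof -
    have "\<forall>T\<in>\<W>. \<exists>B. \<forall>x\<in>T. norm (s T x) \<le> B"
    proof
      fix T assume T: "T \<in> \<W>"
      have "compact (s T ` T)" by (rule compact_continuous_image[OF sc[OF T] mesh_compact[OF T]])
      then show "\<exists>B. \<forall>x\<in>T. norm (s T x) \<le> B" using compact_imp_bounded bounded_iff by (metis imageI)
    qed
    from bchoice[OF this] obtain B where B: "\<And>T x. T \<in> \<W> \<Longrightarrow> x \<in> T \<Longrightarrow> norm (s T x) \<le> B T" by auto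
    \<comment> \<open>At most one summand is nonzero at a point, but the sum of all bounds is a
      convenient global one; on a bounded domain it yields square integrability.\<close>
    have nb: "norm (\<sigma> x) \<le> (\<Sum>T\<in>\<W>. \<bar>B T\<bar>)" for x
      unfolding \<sigma>_def
    proof (rule sum_norm_le)
      fix T assume T: "T \<in> \<W>"
      show "norm (indicator (interior T) x *\<^sub>R s T x) \<le> \<bar>B T\<bar>"
      proof (cases "x \<in> interior T")
        case True
        then have "x \<in> T" using interior_subset by blast
        then show ?thesis using True B[OF T, of x] by simp
      qed simp
    qed
    have "integrable lborel (\<lambda>x. indicator \<Omega> x *\<^sub>R (norm (\<sigma> x))\<^sup>2)"
    proof (rule integrableI_bounded_set_indicator[where B="(\<Sum>T\<in>\<W>. \<bar>B T\<bar>)\<^sup>2"])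
      show "(\<lambda>x. (norm (\<sigma> x))\<^sup>2) \<in> borel_measurable lborel" using \<sigma>m by simp
      show "emeasure lborel \<Omega> < \<infinity>" by (rule emeasure_bounded_finite[OF bounded_dom])
      show "AE x\<in>\<Omega> in lborel. norm ((norm (\<sigma> x))\<^sup>2) \<le> (\<Sum>T\<in>\<W>. \<bar>B T\<bar>)\<^sup>2"
        by (intro AE_I2 impI) (use power_mono[OF nb norm_ge_zero] in simp)
    qed (use \<Omega>b in simp)
    then have "set_integrable lebesgue \<Omega> (\<lambda>x. (norm (\<sigma> x))\<^sup>2)"
      unfolding set_integrable_def by (subst integrable_completion) (use \<sigma>m \<Omega>b in simp_all)
    then show ?thesis using \<sigma>l by (simp add: square_integrable_on_def)
  qed
  have um: "set_borel_measurable lebesgue \<Omega> u"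
  proof -
    have "(\<lambda>x. indicator \<Omega> x *\<^sub>R u x) \<in> borel_measurable borel"
      by (rule borel_measurable_continuous_on_indicator[OF \<Omega>b continuous_on_subset[OF u(2) closure_subset]])
    then have "(\<lambda>x. indicator \<Omega> x *\<^sub>R u x) \<in> borel_measurable lborel" by simp
    then show ?thesis unfolding set_borel_measurable_def by (rule measurable_completion)
  qed
  have qc: "continuous_on S (q T)" if "T \<in> \<W>" for S T by (rule polys_continuous[OF subspace_UNIV q(1)[OF that]])
  \<comment> \<open>Componentwise integration by parts: neighbouring pieces agree on their common
    face because both equal \<open>u\<close> there.\<close>
  have Upd: "U (pd j \<phi>) $ i = - (\<Sum>T\<in>\<W>. set_int T (\<lambda>x. \<phi> x * dq T j x $ i))" if t: "\<phi> \<in> test_fun \<Omega>" for \<phi> i j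
  proof -
    note t' = test_fun_pd[OF t, of j]
    have c: "continuous_on S (pd j \<phi>)" for S by (rule C1_continuous[OF test_fun_C1[OF t']])
    have qi: "u x = q T x" if "T \<in> \<W>" "x \<in> interior T" for T x
      using q(2)[OF that(1)] that(2) interior_subset by blast
    have "U (pd j \<phi>) = (\<Sum>T\<in>\<W>. set_int T (\<lambda>x. pd j \<phi> x *\<^sub>R q T x))"
      unfolding u(1) by (rule reg_dist_eq[OF t' um qc qi])
    then have "U (pd j \<phi>) $ i = (\<Sum>T\<in>\<W>. set_int T (\<lambda>x. pd j \<phi> x *\<^sub>R q T x) $ i)" by simp
    also have "\<dots> = (\<Sum>T\<in>\<W>. set_int T (\<lambda>x. pd j \<phi> x * q T x $ i))"
    proof (intro sum.cong refl)
      fix T assume T: "T \<in> \<W>"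
      have "continuous_on T (\<lambda>x. pd j \<phi> x *\<^sub>R q T x)" by (intro continuous_intros c qc[OF T])
      from set_int_nth[OF T this] show "set_int T (\<lambda>x. pd j \<phi> x *\<^sub>R q T x) $ i = set_int T (\<lambda>x. pd j \<phi> x * q T x $ i)" by simp
    qed
    also have "\<dots> = - (\<Sum>T\<in>\<W>. set_int T (\<lambda>x. \<phi> x * pd j (\<lambda>x. q T x $ i) x))"
    proof (rule mesh_by_parts[OF test_fun_C1[OF t] test_fun_csupp[OF t] dq(2)])
      fix F T T' x assume "T \<in> \<W>" "T' \<in> \<W>" "F facet_of T" "F facet_of T'" "x \<in> F"
      then have "x \<in> T" "x \<in> T'" using facet_of_imp_subset by blast+
      then have "q T x = q T' x" using q(2)[OF \<open>T \<in> \<W>\<close>] q(2)[OF \<open>T' \<in> \<W>\<close>] by metis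
      then show "q T x $ i = q T' x $ i" by simp
    qed
    also have "(\<Sum>T\<in>\<W>. set_int T (\<lambda>x. \<phi> x * pd j (\<lambda>x. q T x $ i) x)) = (\<Sum>T\<in>\<W>. set_int T (\<lambda>x. \<phi> x * dq T j x $ i))"
      by (intro sum.cong refl) (simp add: dq(3))
    finally show ?thesis .
  qed
  have eq: "ddef \<Omega> U = reg_dist \<Omega> \<sigma>"
  proof
    fix \<phi>
    show "ddef \<Omega> U \<phi> = reg_dist \<Omega> \<sigma> \<phi>"
    proof (cases "\<phi> \<in> test_fun \<Omega>")
      case False
      then show ?thesis by (simp add: ddef_not_test reg_dist_def on_test_def)
    next
      case t: True
      have c: "continuous_on S \<phi>" for S by (rule C1_continuous[OF test_fun_C1[OF t]])
      have "ddef \<Omega> U \<phi> $ a $ b = reg_dist \<Omega> \<sigma> \<phi> $ a $ b" for a b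
      proof -
        have "reg_dist \<Omega> \<sigma> \<phi> $ a $ b = (\<Sum>T\<in>\<W>. set_int T (\<lambda>x. \<phi> x *\<^sub>R s T x)) $ a $ b"
          by (subst reg_dist_eq[OF t \<sigma>l sc \<sigma>s]) simp_all
        also have "\<dots> = (\<Sum>T\<in>\<W>. set_int T (\<lambda>x. \<phi> x *\<^sub>R s T x) $ a $ b)" by simp
        also have "\<dots> = (\<Sum>T\<in>\<W>. (1/2) * (set_int T (\<lambda>x. \<phi> x * dq T b x $ a) + set_int T (\<lambda>x. \<phi> x * dq T a x $ b)))"
        proof (intro sum.cong refl)
          fix T assume T: "T \<in> \<W>"
          have dc: "continuous_on T (\<lambda>x. dq T i x)" for i by (rule polys_continuous[OF subspace_UNIV dq(1)[OF T]])
          have "set_int T (\<lambda>x. \<phi> x *\<^sub>R s T x) $ a $ b = set_int T (\<lambda>x. (\<phi> x *\<^sub>R s T x) $ a $ b)"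
            by (intro set_int_nth2 T continuous_intros c sc)
          also have "\<dots> = set_int T (\<lambda>x. (1/2) * (\<phi> x * dq T b x $ a + \<phi> x * dq T a x $ b))"
            by (intro set_int_cong) (simp add: s_nth algebra_simps)
          also have "\<dots> = (1/2) * set_int T (\<lambda>x. \<phi> x * dq T b x $ a + \<phi> x * dq T a x $ b)" by simp
          also have "set_int T (\<lambda>x. \<phi> x * dq T b x $ a + \<phi> x * dq T a x $ b) = set_int T (\<lambda>x. \<phi> x * dq T b x $ a) + set_int T (\<lambda>x. \<phi> x * dq T a x $ b)"
            by (intro set_integral_add set_integrable_compact mesh_compact T continuous_intros c dc)
          finally show "set_int T (\<lambda>x. \<phi> x *\<^sub>R s T x) $ a $ b = (1/2) * (set_int T (\<lambda>x. \<phi> x * dq T b x $ a) + set_int T (\<lambda>x. \<phi> x * dq T a x $ b))" .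
        qed
        also have "\<dots> = ddef \<Omega> U \<phi> $ a $ b"
          unfolding ddef_nth[OF t] Upd[OF t] sum_distrib_left[symmetric] sum.distrib by (simp add: field_simps)
        finally show ?thesis ..
      qed
      then show ?thesis by (simp add: vec_eq_iff)
    qed
  qed
  have tt: "proj_mat f ** s T x ** proj_mat f = proj_mat f ** s T' x ** proj_mat f"
    if f: "f \<in> interior_cells \<Omega> \<W> 2" "T \<in> \<W>" "T' \<in> \<W>" "f face_of T" "f face_of T'" "x \<in> f" for f T T' x
    unfolding proj_mat_eq_iff
  proof (intro ballI)
    fix v w assume v: "v \<in> tangent_space f" and w: "w \<in> tangent_space f"
    have cf: "convex f" using f(4) face_of_imp_convex by blast
    \<comment> \<open>The difference of the two pieces vanishes on \<open>f\<close>, hence so does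
      its derivative along a tangent vector.\<close>
    have tang: "(\<Sum>i\<in>UNIV. y $ i * dq T i x $ a) = (\<Sum>i\<in>UNIV. y $ i * dq T' i x $ a)" if y: "y \<in> tangent_space f" for y a
    proof -
      define h where "h z = q T z $ a - q T' z $ a" for z
      have dh: "(h has_derivative (\<lambda>k. k \<bullet> (grad (\<lambda>x. q T x $ a) z - grad (\<lambda>x. q T' x $ a) z))) (at z)" for z
        unfolding h_def inner_diff_right
        by (intro has_derivative_diff C1_has_derivative dq(2) f)
      have "continuous_on UNIV (\<lambda>z. grad (\<lambda>x. q T x $ a) z - grad (\<lambda>x. q T' x $ a) z)"
        by (intro continuous_intros C1_continuous_grad dq(2) f)
      note h = C1I[OF dh this]
      have "h z = 0" if "z \<in> f" for z
      proof -
        have z: "z \<in> T" "z \<in> T'" using that f(4,5) face_of_imp_subset by blast+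
        have "q T z = q T' z" using q(2)[OF f(2) z(1)] q(2)[OF f(3) z(2)] by simp
        then show ?thesis by (simp add: h_def)
      qed
      then have "y \<bullet> grad h x = 0" by (rule tangential_derivative_0[OF h(1) _ cf f(6) y])
      then show ?thesis
        unfolding h(2) by (simp add: inner_vec_def dq(3) f right_diff_distrib sum_subtractf)
    qed
    \<comment> \<open>Regrouped so that only derivatives along \<open>v\<close> or along
      \<open>w\<close> occur.\<close>
    have form: "v \<bullet> (s S x *v w) = (1/2) * ((\<Sum>a\<in>UNIV. v $ a * (\<Sum>i\<in>UNIV. w $ i * dq S i x $ a)) + (\<Sum>b\<in>UNIV. w $ b * (\<Sum>i\<in>UNIV. v $ i * dq S i x $ b)))" for S
    proof -
      have "v \<bullet> (s S x *v w) = (\<Sum>a\<in>UNIV. \<Sum>b\<in>UNIV. v $ a * (s S x $ a $ b * w $ b))"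
        by (simp add: inner_vec_def matrix_vector_mult_def sum_distrib_left)
      also have "\<dots> = (1/2) * ((\<Sum>a\<in>UNIV. \<Sum>b\<in>UNIV. v $ a * (w $ b * dq S b x $ a)) + (\<Sum>a\<in>UNIV. \<Sum>b\<in>UNIV. w $ b * (v $ a * dq S a x $ b)))"
        unfolding s_nth sum.distrib[symmetric] sum_distrib_left by (intro sum.cong refl) (simp add: algebra_simps)
      also have "(\<Sum>a\<in>UNIV. \<Sum>b\<in>UNIV. w $ b * (v $ a * dq S a x $ b)) = (\<Sum>b\<in>UNIV. \<Sum>a\<in>UNIV. w $ b * (v $ a * dq S a x $ b))"
        by (rule sum.swap)
      finally show ?thesis by (simp only: sum_distrib_left)
    qed
    show "v \<bullet> (s T x *v w) = v \<bullet> (s T' x *v w)"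
      unfolding form tang[OF v] tang[OF w] ..
  qed
  have "ddef \<Omega> U \<in> Reg1 \<Omega> \<W>"
    unfolding Reg1_def mem_Collect_eq
    by (intro exI[of _ \<sigma>] conjI eq sq exI[of _ s]) (use sp \<sigma>s tt in blast)+
  moreover have "(\<lambda>\<phi>. trace (ddef \<Omega> U \<phi>)) = ddiv_vec \<Omega> U"
    by (auto simp: fun_eq_iff trace_def ddef_def dgrad_def ddiv_vec_def transpose_def)
  ultimately show ?thesis using U by (simp add: Sigma_WF_def Upsilon_WF_def)
qed

end

section \<open>The divergence operator\<close>

lemma subspace_face_matrices: "subspace (face_matrices f)" by (simp add: face_matrices_def)
lemma subspace_edge_matrices: "subspace (edge_matrices f)" by (simp add: edge_matrices_def)

text \<open>Tangent rows are what allows integration by parts inside the face.\<close>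

lemma face_matrices_row:
  assumes "A \<in> face_matrices f" shows "A $ i \<in> tangent_space f"
proof -
  have "face_matrices f \<subseteq> {A. \<forall>i. A $ i \<in> tangent_space f}"
    unfolding face_matrices_def
  proof (rule span_minimal)
    show "subspace {A :: real^3^3. \<forall>i. A $ i \<in> tangent_space f}"
      using subspace_tangent[of f] by (auto simp: subspace_def)
    have "(outer u v + outer v u) $ i = u $ i *\<^sub>R v + v $ i *\<^sub>R u" for u v i
      by (simp add: outer_def vec_eq_iff)
    then show "{outer u v + outer v u |u v. u \<in> tangent_space f \<and> v \<in> tangent_space f} \<subseteq> {A. \<forall>i. A $ i \<in> tangent_space f}"
      using subspace_tangent[of f] by (auto intro!: subspace_add subspace_scale)
  qed
  then show ?thesis using assms by blast
qed

lemma tangent_space_segment: "tangent_space (convex hull {a, b}) = span {b - a}"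
proof
  show "tangent_space (convex hull {a, b}) \<subseteq> span {b - a}"
    unfolding tangent_space_def
  proof (rule span_minimal)
    show "{x - y |x y. x \<in> convex hull {a, b} \<and> y \<in> convex hull {a, b}} \<subseteq> span {b - a}"
    proof clarify
      fix x y assume "x \<in> convex hull {a, b}" "y \<in> convex hull {a, b}"
      then obtain s t where xy: "x = (1 - s) *\<^sub>R a + s *\<^sub>R b" "y = (1 - t) *\<^sub>R a + t *\<^sub>R b"
        by (auto simp: segment_convex_hull[symmetric] closed_segment_def)
      have "x - y = (s - t) *\<^sub>R (b - a)" unfolding xy by (simp add: algebra_simps)
      then show "x - y \<in> span {b - a}" by (simp add: span_breakdown_eq span_scale span_base)
    qed
  qed simp
  have "b - a \<in> tangent_space (convex hull {a, b})"
    unfolding tangent_space_def using hull_subset[of "{a, b}" convex] by (intro span_base) auto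
  then show "span {b - a} \<subseteq> tangent_space (convex hull {a, b})"
    by (intro span_minimal subspace_tangent) simp
qed

text \<open>The unnormalized vector \<open>b - a\<close> absorbs the choice of a unit tangent and
  matches the direction in the edge formula.\<close>

lemma edge_matrices_segment:
  assumes "A \<in> edge_matrices (convex hull {a, b})"
  shows "\<exists>c. A = c *\<^sub>R outer (b - a) (b - a)"
proof -
  have "edge_matrices (convex hull {a, b}) \<subseteq> span {outer (b - a) (b - a)}"
    unfolding edge_matrices_def
  proof (rule span_minimal)
    show "{outer \<tau> \<tau> |\<tau>. \<tau> \<in> tangent_space (convex hull {a, b}) \<and> norm \<tau> = 1} \<subseteq> span {outer (b - a) (b - a)}"
    proof clarify
      fix \<tau> assume "\<tau> \<in> tangent_space (convex hull {a, b})"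
      then obtain k where "\<tau> = k *\<^sub>R (b - a)" unfolding tangent_space_segment span_singleton by auto
      then have "outer \<tau> \<tau> = (k * k) *\<^sub>R outer (b - a) (b - a)" by (simp add: outer_def vec_eq_iff mult_ac)
      then show "outer \<tau> \<tau> \<in> span {outer (b - a) (b - a)}" by (simp add: span_scale span_base)
    qed
  qed simp
  then show ?thesis using assms by (auto simp: span_singleton)
qed

context tet_mesh
begin

lemma flat2_linear:
  fixes f :: "real^3 \<Rightarrow> 'v::euclidean_space" and h :: "'v \<Rightarrow> 'w::euclidean_space"
  assumes "s \<in> cells \<W> 2" "bounded_linear h" "continuous_on UNIV f"
  shows "flat2 s (\<lambda>x. h (f x)) = h (flat2 s f)"
  by (rule flat_integral_linear[OF _ compact_simplex[OF cells_simplex[OF mesh assms(1)]] assms(2,3)])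
     (simp add: aff_dim_simplex[OF cells_simplex[OF mesh assms(1)]])

lemma flat1_linear:
  fixes f :: "real^3 \<Rightarrow> 'v::euclidean_space" and h :: "'v \<Rightarrow> 'w::euclidean_space"
  assumes "s \<in> cells \<W> 1" "bounded_linear h" "continuous_on UNIV f"
  shows "flat1 s (\<lambda>x. h (f x)) = h (flat1 s f)"
  by (rule flat_integral_linear[OF _ compact_simplex[OF cells_simplex[OF mesh assms(1)]] assms(2,3)])
     (simp add: aff_dim_simplex[OF cells_simplex[OF mesh assms(1)]])

lemma flat1_scaleR:
  fixes v :: "'v::euclidean_space"
  assumes "s \<in> cells \<W> 1" "continuous_on UNIV f"
  shows "flat1 s (\<lambda>x. f x *\<^sub>R v) = flat1 s f *\<^sub>R v"
  by (rule flat1_linear[OF assms(1) bounded_linear_scaleR_left assms(2)])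

lemma flat2_scaleR:
  fixes v :: "'v::euclidean_space"
  assumes "s \<in> cells \<W> 2" "continuous_on UNIV f"
  shows "flat2 s (\<lambda>x. f x *\<^sub>R v) = flat2 s f *\<^sub>R v"
  by (rule flat2_linear[OF assms(1) bounded_linear_scaleR_left assms(2)])

lemma flat2_dir:
  assumes "s \<in> cells \<W> 2" "C1 \<phi>"
  shows "flat2 s (\<lambda>x. w \<bullet> grad \<phi> x) = (\<Sum>j\<in>UNIV. w $ j * flat2 s (pd j \<phi>))"
proof -
  have c: "continuous_on UNIV (grad \<phi>)" by (rule C1_continuous_grad[OF assms(2)])
  have "flat2 s (\<lambda>x. w \<bullet> grad \<phi> x) = w \<bullet> flat2 s (grad \<phi>)"
    by (rule flat2_linear[OF assms(1) bounded_linear_inner_right c])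
  moreover have "flat2 s (pd j \<phi>) = flat2 s (grad \<phi>) $ j" for j
    using flat2_linear[OF assms(1) bounded_linear_vec_nth c, of j] by simp
  ultimately show ?thesis by (simp add: inner_vec_def)
qed

lemma interior_cells_sub: "s \<in> interior_cells \<Omega> \<W> d \<Longrightarrow> s \<in> cells \<W> d"
  by (simp add: interior_cells_eq)

lemma finite_interior_cells: "finite (interior_cells \<Omega> \<W> d)"
  using finite_cells[OF mesh] by (simp add: interior_cells_eq)

text \<open>The formula fixes only the component tangent to \<open>f\<close>, since it is required
  for tangent directions only; the vector will be paired with such directions alone.\<close>

definition edge_conormal :: "(real^3) set \<Rightarrow> (real^3) set \<Rightarrow> real^3" where
  "edge_conormal = (SOME n. \<forall>f\<in>cells \<W> 2. (\<forall>e. e facet_of f \<longrightarrow> (\<forall>u\<in>tangent_space e. n f e \<bullet> u = 0)) \<and>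
    (\<forall>\<psi> w. C1 \<psi> \<longrightarrow> w \<in> tangent_space f \<longrightarrow> flat2 f (\<lambda>x. w \<bullet> grad \<psi> x) = (\<Sum>e | e facet_of f. (n f e \<bullet> w) * flat1 e \<psi>)))"

lemma edge_conormal:
  assumes "f \<in> cells \<W> 2"
  shows "\<And>e u. e facet_of f \<Longrightarrow> u \<in> tangent_space e \<Longrightarrow> edge_conormal f e \<bullet> u = 0"
    "\<And>\<psi> w. C1 \<psi> \<Longrightarrow> w \<in> tangent_space f \<Longrightarrow> flat2 f (\<lambda>x. w \<bullet> grad \<psi> x) = (\<Sum>e | e facet_of f. (edge_conormal f e \<bullet> w) * flat1 e \<psi>)"
proof -
  have "\<forall>f\<in>cells \<W> 2. \<exists>n. (\<forall>e. e facet_of f \<longrightarrow> (\<forall>u\<in>tangent_space e. n e \<bullet> u = 0)) \<and>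
    (\<forall>\<psi> w. C1 \<psi> \<longrightarrow> w \<in> tangent_space f \<longrightarrow> flat2 f (\<lambda>x. w \<bullet> grad \<psi> x) = (\<Sum>e | e facet_of f. (n e \<bullet> w) * flat1 e \<psi>))"
    by (intro ballI green_triangle cells_simplex[OF mesh])
  from bchoice[OF this] have "\<forall>f\<in>cells \<W> 2. (\<forall>e. e facet_of f \<longrightarrow> (\<forall>u\<in>tangent_space e. edge_conormal f e \<bullet> u = 0)) \<and>
    (\<forall>\<psi> w. C1 \<psi> \<longrightarrow> w \<in> tangent_space f \<longrightarrow> flat2 f (\<lambda>x. w \<bullet> grad \<psi> x) = (\<Sum>e | e facet_of f. (edge_conormal f e \<bullet> w) * flat1 e \<psi>))"
    unfolding edge_conormal_def by (rule someI_ex)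
  then show "\<And>e u. e facet_of f \<Longrightarrow> u \<in> tangent_space e \<Longrightarrow> edge_conormal f e \<bullet> u = 0"
    "\<And>\<psi> w. C1 \<psi> \<Longrightarrow> w \<in> tangent_space f \<Longrightarrow> flat2 f (\<lambda>x. w \<bullet> grad \<psi> x) = (\<Sum>e | e facet_of f. (edge_conormal f e \<bullet> w) * flat1 e \<psi>)"
    using assms by blast+
qed

text \<open>Boundary edges drop out, and an index set common to all faces lets sums over faces and
  over edges be exchanged.\<close>

lemma sum_edges_interior:
  assumes f: "f \<in> cells \<W> 2" and z: "\<And>e. e \<in> cells \<W> 1 \<Longrightarrow> e \<notin> interior_cells \<Omega> \<W> 1 \<Longrightarrow> G e = 0"
  shows "(\<Sum>e | e facet_of f. G e) = (\<Sum>e\<in>interior_cells \<Omega> \<W> 1. if e facet_of f then G e else 0)"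
proof -
  have "(\<Sum>e | e facet_of f. G e) = (\<Sum>e | e \<in> interior_cells \<Omega> \<W> 1 \<and> e facet_of f. G e)"
    by (rule sum.mono_neutral_right[OF finite_facets[OF cells_simplex[OF mesh f]]])
       (use z edge_cells[OF f] in auto)
  also have "\<dots> = (\<Sum>e\<in>interior_cells \<Omega> \<W> 1. if e facet_of f then G e else 0)"
    by (simp add: sum.inter_filter[OF finite_interior_cells])
  finally show ?thesis .
qed

text \<open>Each row of the constant matrix differentiates \<open>\<phi>\<close> along the face, so
  Green's formula leaves constant vectors on the edges.\<close>

lemma div_face:
  assumes f: "f \<in> interior_cells \<Omega> \<W> 2" and q: "q \<in> polys 0 (face_matrices f)"
  shows "\<exists>a. \<forall>\<phi>\<in>test_fun \<Omega>. (\<chi> i. \<Sum>j\<in>UNIV. face_delta q f (pd j \<phi>) $ i $ j)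
    = (\<Sum>e\<in>interior_cells \<Omega> \<W> 1. flat1 e \<phi> *\<^sub>R (a e :: real^3))"
proof -
  obtain A where A: "A \<in> face_matrices f" "q = (\<lambda>_. A)"
    using q polys_0_iff[OF subspace_face_matrices] by auto
  have fc: "f \<in> cells \<W> 2" by (rule interior_cells_sub[OF f])
  define a where "a e = (if e facet_of f then (\<chi> i. edge_conormal f e \<bullet> A $ i) else 0)" for e
  have "(\<chi> i. \<Sum>j\<in>UNIV. face_delta q f (pd j \<phi>) $ i $ j) = (\<Sum>e\<in>interior_cells \<Omega> \<W> 1. flat1 e \<phi> *\<^sub>R a e)"
    if t: "\<phi> \<in> test_fun \<Omega>" for \<phi>
  proof -
    have C: "C1 \<phi>" by (rule test_fun_C1[OF t])
    have "(\<Sum>j\<in>UNIV. face_delta q f (pd j \<phi>) $ i $ j) = (\<Sum>e\<in>interior_cells \<Omega> \<W> 1. flat1 e \<phi> *\<^sub>R a e) $ i" for i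
    proof -
      have "face_delta q f (pd j \<phi>) = flat2 f (pd j \<phi>) *\<^sub>R A" for j
        unfolding face_delta_def A(2) by (rule flat2_scaleR[OF fc C1_continuous_pd[OF C]])
      then have "(\<Sum>j\<in>UNIV. face_delta q f (pd j \<phi>) $ i $ j) = flat2 f (\<lambda>x. A $ i \<bullet> grad \<phi> x)"
        unfolding flat2_dir[OF fc C] by (simp add: mult.commute)
      also have "\<dots> = (\<Sum>e | e facet_of f. (edge_conormal f e \<bullet> A $ i) * flat1 e \<phi>)"
        by (rule edge_conormal(2)[OF fc C face_matrices_row[OF A(1)]])
      also have "\<dots> = (\<Sum>e\<in>interior_cells \<Omega> \<W> 1. if e facet_of f then (edge_conormal f e \<bullet> A $ i) * flat1 e \<phi> else 0)"
        by (rule sum_edges_interior[OF fc]) (use boundary_cell_zero[OF _ _ test_fun_csupp[OF t]] in \<open>simp add: flat_zero\<close>)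
      also have "\<dots> = (\<Sum>e\<in>interior_cells \<Omega> \<W> 1. (flat1 e \<phi> *\<^sub>R a e) $ i)"
        by (intro sum.cong refl) (simp add: a_def mult.commute)
      finally show ?thesis by simp
    qed
    then show ?thesis by (simp add: vec_eq_iff)
  qed
  then show ?thesis by blast
qed

abbreviation interior_vertices :: "(real^3) set" where
  "interior_vertices \<equiv> {x. {x} \<in> interior_cells \<Omega> \<W> 0}"

lemma finite_interior_vertices: "finite interior_vertices"
proof -
  have "finite ((\<lambda>x. {x}) -` interior_cells \<Omega> \<W> 0)"
    by (rule finite_vimageI[OF finite_interior_cells]) (simp add: inj_def)
  then show ?thesis by (simp add: vimage_def)
qed

text \<open>On an edge the density is an affine function times a fixed dyad. Integrating by parts
  along the edge gives point values at its ends and, from the derivative of the affine factor, a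
  constant density.\<close>

lemma div_edge:
  assumes e: "e \<in> interior_cells \<Omega> \<W> 1" and p: "p \<in> polys 1 (edge_matrices e)"
  shows "\<exists>c b. \<forall>\<phi>\<in>test_fun \<Omega>. (\<chi> i. \<Sum>j\<in>UNIV. edge_delta p e (pd j \<phi>) $ i $ j)
    = (\<Sum>x\<in>interior_vertices. \<phi> x *\<^sub>R (c x :: real^3)) + flat1 e \<phi> *\<^sub>R (b :: real^3)"
proof -
  have ec: "e \<in> cells \<W> 1" by (rule interior_cells_sub[OF e])
  obtain a b where ab: "a \<noteq> b" "e = convex hull {a, b}"
    "\<And>\<psi>. C1 \<psi> \<Longrightarrow> flat1 e (\<lambda>x. (b - a) \<bullet> grad \<psi> x) = mass1 e * (\<psi> b - \<psi> a)"
    by (rule green_edge[OF cells_simplex[OF mesh ec]]; rule that; assumption)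
  let ?E = "outer (b - a) (b - a)"
  obtain C D where CD: "C \<in> edge_matrices e" "\<And>i. D i \<in> edge_matrices e" "p = (\<lambda>x. C + (\<Sum>i\<in>UNIV. x $ i *\<^sub>R D i))"
    using polys_1_affine[OF subspace_edge_matrices p] by auto
  obtain c0 where c0: "C = c0 *\<^sub>R ?E" using edge_matrices_segment[of C a b] CD(1) ab(2) by auto
  have "\<forall>i. \<exists>d. D i = d *\<^sub>R ?E"
    using edge_matrices_segment[of _ a b] CD(2) unfolding ab(2)[symmetric] by blast
  from choice[OF this] obtain d where d: "\<And>i. D i = d i *\<^sub>R ?E" by auto
  define w where "w = (\<chi> i. d i)"
  define s where "s x = c0 + x \<bullet> w" for x
  have s: "C1 s" "grad s = (\<lambda>_. w)" unfolding s_def[abs_def] by (rule C1_affine)+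
  have ps: "p x = s x *\<^sub>R ?E" for x
    by (simp add: CD(3) c0 d s_def w_def inner_vec_def scaleR_add_left scaleR_sum_left)
  \<comment> \<open>Boundary terms at the two end points, with the edge length
    \<open>mass1 e\<close> as factor.\<close>
  define c where "c x = (if x = b then (mass1 e * s b) *\<^sub>R (b - a) else if x = a then - (mass1 e * s a) *\<^sub>R (b - a) else 0)" for x
  define r where "r = - ((b - a) \<bullet> w) *\<^sub>R (b - a)"
  have fin: "{a} face_of e" "{b} face_of e"
    unfolding ab(2) by (simp_all add: face_of_singleton extreme_point_of_segment flip: segment_convex_hull)
  then have vc: "{a} \<in> cells \<W> 0" "{b} \<in> cells \<W> 0" using face_of_cell[OF mesh ec] by auto
  have "(\<chi> i. \<Sum>j\<in>UNIV. edge_delta p e (pd j \<phi>) $ i $ j) = (\<Sum>x\<in>interior_vertices. \<phi> x *\<^sub>R c x) + flat1 e \<phi> *\<^sub>R r"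
    if t: "\<phi> \<in> test_fun \<Omega>" for \<phi>
  proof -
    have C: "C1 \<phi>" by (rule test_fun_C1[OF t])
    have gc: "continuous_on UNIV (\<lambda>x. s x *\<^sub>R grad \<phi> x)"
      by (intro continuous_intros C1_continuous[OF s(1)] C1_continuous_grad[OF C])
    have "edge_delta p e (pd j \<phi>) = (flat1 e (\<lambda>x. s x *\<^sub>R grad \<phi> x) $ j) *\<^sub>R ?E" for j
    proof -
      have "edge_delta p e (pd j \<phi>) = flat1 e (\<lambda>x. (s x * pd j \<phi> x) *\<^sub>R ?E)"
        unfolding edge_delta_def ps by (simp add: mult.commute)
      also have "\<dots> = flat1 e (\<lambda>x. s x * pd j \<phi> x) *\<^sub>R ?E"
        by (intro flat1_scaleR[OF ec] continuous_intros C1_continuous[OF s(1)] C1_continuous_pd[OF C])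
      also have "flat1 e (\<lambda>x. s x * pd j \<phi> x) = flat1 e (\<lambda>x. s x *\<^sub>R grad \<phi> x) $ j"
        using flat1_linear[OF ec bounded_linear_vec_nth gc, of j] by simp
      finally show ?thesis .
    qed
    then have "(\<Sum>j\<in>UNIV. edge_delta p e (pd j \<phi>) $ i $ j) = (b - a) $ i * ((b - a) \<bullet> flat1 e (\<lambda>x. s x *\<^sub>R grad \<phi> x))" for i
      by (simp add: outer_def inner_vec_def sum_distrib_left mult_ac)
    then have "(\<chi> i. \<Sum>j\<in>UNIV. edge_delta p e (pd j \<phi>) $ i $ j) = ((b - a) \<bullet> flat1 e (\<lambda>x. s x *\<^sub>R grad \<phi> x)) *\<^sub>R (b - a)"
      by (simp add: vec_eq_iff)
    also have "(b - a) \<bullet> flat1 e (\<lambda>x. s x *\<^sub>R grad \<phi> x) = mass1 e * (s b * \<phi> b - s a * \<phi> a) - ((b - a) \<bullet> w) * flat1 e \<phi>"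
    proof -
      have "mass1 e * (s b * \<phi> b - s a * \<phi> a) = flat1 e (\<lambda>x. (b - a) \<bullet> grad (\<lambda>x. s x * \<phi> x) x)"
        by (rule ab(3)[OF C1_mult(1)[OF s(1) C], symmetric])
      also have "\<dots> = (b - a) \<bullet> flat1 e (\<lambda>x. s x *\<^sub>R grad \<phi> x + \<phi> x *\<^sub>R w)"
        unfolding C1_mult(2)[OF s(1) C] s(2)
        by (intro flat1_linear[OF ec bounded_linear_inner_right] continuous_intros C1_continuous[OF s(1)] C1_continuous_grad[OF C] C1_continuous[OF C])
      also have "flat1 e (\<lambda>x. s x *\<^sub>R grad \<phi> x + \<phi> x *\<^sub>R w) = flat1 e (\<lambda>x. s x *\<^sub>R grad \<phi> x) + flat1 e (\<lambda>x. \<phi> x *\<^sub>R w)"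
        using cells_simplex[OF mesh ec] aff_dim_simplex compact_simplex
        by (intro flat_integral_add gc continuous_intros C1_continuous[OF C]) auto
      also have "flat1 e (\<lambda>x. \<phi> x *\<^sub>R w) = flat1 e \<phi> *\<^sub>R w" by (rule flat1_scaleR[OF ec C1_continuous[OF C]])
      finally show ?thesis by (simp add: inner_add_right)
    qed
    also have "(mass1 e * (s b * \<phi> b - s a * \<phi> a) - ((b - a) \<bullet> w) * flat1 e \<phi>) *\<^sub>R (b - a)
        = (\<Sum>x\<in>{a, b}. \<phi> x *\<^sub>R c x) + flat1 e \<phi> *\<^sub>R r"
      using ab(1) by (simp add: c_def r_def algebra_simps)
    \<comment> \<open>Passage to all interior vertices: \<open>c\<close> vanishes off the end
      points, and \<open>\<phi>\<close> vanishes at an end point on the boundary.\<close>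
    also have "(\<Sum>x\<in>{a, b}. \<phi> x *\<^sub>R c x) = (\<Sum>x\<in>interior_vertices \<union> {a, b}. \<phi> x *\<^sub>R c x)"
      by (rule sum.mono_neutral_left) (use finite_interior_vertices in \<open>auto simp: c_def\<close>)
    also have "\<dots> = (\<Sum>x\<in>interior_vertices. \<phi> x *\<^sub>R c x)"
    proof (rule sum.mono_neutral_right)
      have "\<phi> x = 0" if "x \<in> {a, b}" "x \<notin> interior_vertices" for x
        using boundary_cell_zero[OF _ _ test_fun_csupp[OF t], of "{x}" 0 x] vc that by auto
      then show "\<forall>x\<in>interior_vertices \<union> {a, b} - interior_vertices. \<phi> x *\<^sub>R c x = 0" by auto
    qed (use finite_interior_vertices in auto)
    finally show ?thesis .
  qed
  then show ?thesis by blast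
qed

theorem ddiv_in_Lag2_star:
  assumes "M \<in> Reg1_star \<Omega> \<W>" shows "ddiv \<Omega> M \<in> Lag2_star \<Omega> \<W>"
proof -
  let ?E = "interior_cells \<Omega> \<W> 1" and ?F = "interior_cells \<Omega> \<W> 2"
  obtain p q where M: "M = on_test \<Omega> (\<lambda>\<phi>. (\<Sum>e\<in>?E. edge_delta (p e) e \<phi>) + (\<Sum>f\<in>?F. face_delta (q f) f \<phi>))"
    and p: "\<forall>e\<in>?E. p e \<in> polys 1 (edge_matrices e)" and q: "\<forall>f\<in>?F. q f \<in> polys 0 (face_matrices f)"
    using assms unfolding Reg1_star_def by blast
  have "\<forall>f\<in>?F. \<exists>a. \<forall>\<phi>\<in>test_fun \<Omega>. (\<chi> i. \<Sum>j\<in>UNIV. face_delta (q f) f (pd j \<phi>) $ i $ j) = (\<Sum>e\<in>?E. flat1 e \<phi> *\<^sub>R (a e :: real^3))"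
    using div_face q by blast
  from bchoice[OF this] obtain a where a: "\<forall>f\<in>?F. \<forall>\<phi>\<in>test_fun \<Omega>.
     (\<chi> i. \<Sum>j\<in>UNIV. face_delta (q f) f (pd j \<phi>) $ i $ j) = (\<Sum>e\<in>?E. flat1 e \<phi> *\<^sub>R (a f e :: real^3))" ..
  have "\<forall>e\<in>?E. \<exists>cb. \<forall>\<phi>\<in>test_fun \<Omega>. (\<chi> i. \<Sum>j\<in>UNIV. edge_delta (p e) e (pd j \<phi>) $ i $ j)
    = (\<Sum>x\<in>interior_vertices. \<phi> x *\<^sub>R (fst cb x :: real^3)) + flat1 e \<phi> *\<^sub>R (snd cb :: real^3)"
  proof
    fix e assume e: "e \<in> ?E"
    obtain c b where "\<forall>\<phi>\<in>test_fun \<Omega>. (\<chi> i. \<Sum>j\<in>UNIV. edge_delta (p e) e (pd j \<phi>) $ i $ j)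
      = (\<Sum>x\<in>interior_vertices. \<phi> x *\<^sub>R (c x :: real^3)) + flat1 e \<phi> *\<^sub>R (b :: real^3)"
      using div_edge[OF e] p e by blast
    then show "\<exists>cb. \<forall>\<phi>\<in>test_fun \<Omega>. (\<chi> i. \<Sum>j\<in>UNIV. edge_delta (p e) e (pd j \<phi>) $ i $ j)
      = (\<Sum>x\<in>interior_vertices. \<phi> x *\<^sub>R (fst cb x :: real^3)) + flat1 e \<phi> *\<^sub>R (snd cb :: real^3)"
      by (intro exI[of _ "(c, b)"]) simp
  qed
  from bchoice[OF this] obtain cb where cb: "\<forall>e\<in>?E. \<forall>\<phi>\<in>test_fun \<Omega>. (\<chi> i. \<Sum>j\<in>UNIV. edge_delta (p e) e (pd j \<phi>) $ i $ j)
    = (\<Sum>x\<in>interior_vertices. \<phi> x *\<^sub>R (fst (cb e) x :: real^3)) + flat1 e \<phi> *\<^sub>R (snd (cb e) :: real^3)" ..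
  \<comment> \<open>The minus signs come from the distributional derivative; all contributions to
    the same vertex or edge are collected.\<close>
  define c where "c x = - (\<Sum>e\<in>?E. fst (cb e) x)" for x
  define r where "r e = - (snd (cb e) + (\<Sum>f\<in>?F. a f e))" for e
  have "ddiv \<Omega> M = on_test \<Omega> (\<lambda>\<phi>. (\<Sum>x\<in>interior_vertices. vertex_delta (c x) x \<phi>) + (\<Sum>e\<in>?E. edge_delta (\<lambda>_. r e) e \<phi>))"
  proof
    fix \<phi>
    show "ddiv \<Omega> M \<phi> = on_test \<Omega> (\<lambda>\<phi>. (\<Sum>x\<in>interior_vertices. vertex_delta (c x) x \<phi>) + (\<Sum>e\<in>?E. edge_delta (\<lambda>_. r e) e \<phi>)) \<phi>"
    proof (cases "\<phi> \<in> test_fun \<Omega>")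
      case False then show ?thesis by (simp add: ddiv_not_test on_test_def)
    next
      case t: True
      have C: "C1 \<phi>" by (rule test_fun_C1[OF t])
      have "M (pd j \<phi>) = (\<Sum>e\<in>?E. edge_delta (p e) e (pd j \<phi>)) + (\<Sum>f\<in>?F. face_delta (q f) f (pd j \<phi>))" for j
        using test_fun_pd[OF t] by (simp add: M on_test_def)
      then have "ddiv \<Omega> M \<phi> = - (\<chi> i. \<Sum>j\<in>UNIV. (\<Sum>e\<in>?E. edge_delta (p e) e (pd j \<phi>) $ i $ j) + (\<Sum>f\<in>?F. face_delta (q f) f (pd j \<phi>) $ i $ j))"
        by (simp add: vec_eq_iff ddiv_nth[OF t])
      also have "\<dots> = - ((\<Sum>e\<in>?E. \<chi> i. \<Sum>j\<in>UNIV. edge_delta (p e) e (pd j \<phi>) $ i $ j) + (\<Sum>f\<in>?F. \<chi> i. \<Sum>j\<in>UNIV. face_delta (q f) f (pd j \<phi>) $ i $ j))"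
        by (simp add: vec_eq_iff sum.distrib sum.swap[of _ UNIV])
      also have "(\<Sum>e\<in>?E. \<chi> i. \<Sum>j\<in>UNIV. edge_delta (p e) e (pd j \<phi>) $ i $ j)
          = (\<Sum>e\<in>?E. (\<Sum>x\<in>interior_vertices. \<phi> x *\<^sub>R fst (cb e) x) + flat1 e \<phi> *\<^sub>R snd (cb e))"
        by (intro sum.cong refl) (use cb t in blast)
      also have "\<dots> = (\<Sum>x\<in>interior_vertices. \<phi> x *\<^sub>R (\<Sum>e\<in>?E. fst (cb e) x)) + (\<Sum>e\<in>?E. flat1 e \<phi> *\<^sub>R snd (cb e))"
        unfolding sum.distrib scaleR_sum_right by (simp only: sum.swap[of _ ?E])
      also have "(\<Sum>f\<in>?F. \<chi> i. \<Sum>j\<in>UNIV. face_delta (q f) f (pd j \<phi>) $ i $ j) = (\<Sum>f\<in>?F. \<Sum>e\<in>?E. flat1 e \<phi> *\<^sub>R a f e)"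
        by (intro sum.cong refl) (use a t in blast)
      also have "\<dots> = (\<Sum>e\<in>?E. flat1 e \<phi> *\<^sub>R (\<Sum>f\<in>?F. a f e))"
        unfolding scaleR_sum_right by (rule sum.swap)
      finally have "ddiv \<Omega> M \<phi> = (\<Sum>x\<in>interior_vertices. \<phi> x *\<^sub>R c x) + (\<Sum>e\<in>?E. flat1 e \<phi> *\<^sub>R r e)"
        by (simp add: c_def r_def sum_negf scaleR_add_right sum.distrib algebra_simps sum_subtractf)
      also have "(\<Sum>e\<in>?E. flat1 e \<phi> *\<^sub>R r e) = (\<Sum>e\<in>?E. edge_delta (\<lambda>_. r e) e \<phi>)"
        by (intro sum.cong refl) (simp add: edge_delta_def flat1_scaleR[OF interior_cells_sub C1_continuous[OF C]])
      finally show ?thesis using t by (simp add: on_test_def vertex_delta_def)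
    qed
  qed
  moreover have "\<forall>e\<in>?E. (\<lambda>_. r e) \<in> polys 0 UNIV"
    using polys_const[OF subspace_UNIV] by blast
  ultimately show ?thesis unfolding Lag2_star_def mem_Collect_eq
    by (intro exI[of _ c] exI[of _ "\<lambda>e _. r e"] conjI)
qed

end

section \<open>The incompatibility operator\<close>

text \<open>The tangent space has dimension 2, so it has a unit normal \<open>N\<close>; by
  dimension it is then the whole hyperplane orthogonal to \<open>N\<close>.\<close>

lemma plane_normal:
  assumes F: "2 simplex (F :: (real^3) set)"
  shows "\<exists>N. N \<bullet> N = 1 \<and> (\<forall>v. v \<in> tangent_space F \<longleftrightarrow> v \<bullet> N = 0) \<and>
    (\<forall>v. (\<forall>u\<in>tangent_space F. v \<bullet> u = 0) \<longrightarrow> v = (v \<bullet> N) *\<^sub>R N)"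
proof -
  have "F \<noteq> {}" using F by auto
  then obtain a where a: "a \<in> F" by blast
  let ?U = "span ((\<lambda>x. x - a) ` F)"
  have "tangent_space F = ?U"
  proof
    show "tangent_space F \<subseteq> ?U"
      unfolding tangent_space_def
    proof (rule span_minimal)
      show "{x - y |x y. x \<in> F \<and> y \<in> F} \<subseteq> ?U"
      proof clarify
        fix x y assume "x \<in> F" "y \<in> F"
        then have "x - a \<in> ?U" "y - a \<in> ?U" by (auto intro: span_base)
        then show "x - y \<in> ?U" using span_diff[of "x - a" _ "y - a"] by simp
      qed
    qed simp
    show "?U \<subseteq> tangent_space F"
      unfolding tangent_space_def by (rule span_mono) (use a in auto)
  qed
  then have "dim (tangent_space F) = dim ((\<lambda>x. x - a) ` F)" by simp
  also have "int \<dots> = aff_dim F" by (rule aff_dim_eq_dim_subtract[OF hull_inc[OF a], symmetric])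
  finally have dim: "dim (tangent_space F) = 2" using aff_dim_simplex[OF F] by simp
  then obtain N0 where N0: "N0 \<noteq> 0" "\<And>y. y \<in> span (tangent_space F) \<Longrightarrow> orthogonal N0 y"
    using orthogonal_to_subspace_exists[of "tangent_space F"] by auto
  define N where "N = (1 / norm N0) *\<^sub>R N0"
  have NN: "N \<bullet> N = 1" using N0(1) by (simp add: N_def dot_square_norm power2_eq_square)
  have Nt: "N \<bullet> y = 0" if "y \<in> tangent_space F" for y
    using N0(2)[OF span_base[OF that]] by (simp add: N_def orthogonal_def)
  have eq: "tangent_space F = {v. N \<bullet> v = 0}"
  proof (rule subspace_dim_equal[OF subspace_tangent subspace_hyperplane])
    show "tangent_space F \<subseteq> {v. N \<bullet> v = 0}" using Nt by blast
    have "N \<noteq> 0" using NN by auto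
    then show "dim {v. N \<bullet> v = 0} \<le> dim (tangent_space F)" using dim by (simp add: dim_hyperplane)
  qed
  have "v = (v \<bullet> N) *\<^sub>R N" if v: "\<forall>u\<in>tangent_space F. v \<bullet> u = 0" for v
  proof -
    let ?z = "v - (v \<bullet> N) *\<^sub>R N"
    have "N \<bullet> ?z = 0" by (simp add: inner_diff_right NN inner_commute)
    then have z: "?z \<in> tangent_space F" using eq by blast
    then have "v \<bullet> ?z = 0" "N \<bullet> ?z = 0" using v Nt by blast+
    then have "?z \<bullet> ?z = 0" by (simp add: inner_diff_left)
    then show ?thesis by simp
  qed
  then show ?thesis using NN eq by (intro exI[of _ N]) (auto simp: inner_commute)
qed

text \<open>The sign is arbitrary. It cancels in the densities, because \<open>jump_n\<close> and
  \<open>rot_normal\<close> each contain one factor \<open>normal F\<close>.\<close>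

definition normal :: "(real^3) set \<Rightarrow> real^3" where
  "normal F = (SOME N. N \<bullet> N = 1 \<and> (\<forall>v. v \<in> tangent_space F \<longleftrightarrow> v \<bullet> N = 0) \<and>
    (\<forall>v. (\<forall>u\<in>tangent_space F. v \<bullet> u = 0) \<longrightarrow> v = (v \<bullet> N) *\<^sub>R N))"

lemma normal:
  assumes "2 simplex F"
  shows "normal F \<bullet> normal F = 1" "v \<in> tangent_space F \<longleftrightarrow> v \<bullet> normal F = 0"
    "(\<And>u. u \<in> tangent_space F \<Longrightarrow> v \<bullet> u = 0) \<Longrightarrow> v = (v \<bullet> normal F) *\<^sub>R normal F"
  using someI_ex[OF plane_normal[OF assms]] unfolding normal_def[symmetric] by blast+

lemma lc_swap13: "lc j m n = - lc n m j"
proof -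
  have "\<forall>j m n. lc j m n = - lc n m j" by (simp add: forall_3 lc_def)
  then show ?thesis by blast
qed

text \<open>Three vectors orthogonal to a nonzero vector lie in a plane, so their determinant
  vanishes.\<close>

lemma triple_product_0:
  assumes \<tau>: "\<tau> \<noteq> 0" and o: "u \<bullet> \<tau> = 0" "v \<bullet> \<tau> = 0" "w \<bullet> \<tau> = 0"
  shows "(\<Sum>j\<in>UNIV. \<Sum>m\<in>UNIV. \<Sum>n\<in>UNIV. lc j m n * (u $ j * v $ m * w $ n)) = 0"
proof -
  let ?d = "u $ 1 * (v $ 2 * w $ 3 - v $ 3 * w $ 2) + u $ 2 * (v $ 3 * w $ 1 - v $ 1 * w $ 3) + u $ 3 * (v $ 1 * w $ 2 - v $ 2 * w $ 1)"
  have e: "(\<Sum>j\<in>UNIV. \<Sum>m\<in>UNIV. \<Sum>n\<in>UNIV. lc j m n * (u $ j * v $ m * w $ n)) = ?d"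
    by (simp add: sum_3 lc_def algebra_simps)
  have o': "u $ 1 * \<tau> $ 1 + u $ 2 * \<tau> $ 2 + u $ 3 * \<tau> $ 3 = 0" "v $ 1 * \<tau> $ 1 + v $ 2 * \<tau> $ 2 + v $ 3 * \<tau> $ 3 = 0"
    "w $ 1 * \<tau> $ 1 + w $ 2 * \<tau> $ 2 + w $ 3 * \<tau> $ 3 = 0"
    using o by (simp_all add: inner_vec_def sum_3)
  \<comment> \<open>Cramer's rule: the determinant times a component of \<open>\<tau>\<close> is a
    combination of the three orthogonality relations.\<close>
  have "?d * \<tau> $ 1 = 0" "?d * \<tau> $ 2 = 0" "?d * \<tau> $ 3 = 0"
    using o' by algebra+
  moreover have "\<tau> $ 1 \<noteq> 0 \<or> \<tau> $ 2 \<noteq> 0 \<or> \<tau> $ 3 \<noteq> 0" using \<tau> by (auto simp: vec_eq_iff forall_3)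
  ultimately have "?d = 0" by (metis mult_eq_0_iff)
  then show ?thesis using e by simp
qed

lemma quad_sum_swap:
  fixes c :: "3 \<Rightarrow> 3 \<Rightarrow> 3 \<Rightarrow> 3 \<Rightarrow> real"
  shows "(\<Sum>m\<in>UNIV. \<Sum>n\<in>UNIV. \<Sum>k\<in>UNIV. \<Sum>l\<in>UNIV. c m n k l * (\<Sum>F\<in>A. G F m n k l))
    = (\<Sum>F\<in>A. \<Sum>m\<in>UNIV. \<Sum>n\<in>UNIV. \<Sum>k\<in>UNIV. \<Sum>l\<in>UNIV. c m n k l * G F m n k l)"
proof -
  have sw: "(\<Sum>i\<in>UNIV. \<Sum>F\<in>A. g i F) = (\<Sum>F\<in>A. \<Sum>i\<in>UNIV. g i F)" for g :: "3 \<Rightarrow> _ \<Rightarrow> real"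
    by (rule sum.swap)
  show ?thesis unfolding sum_distrib_left sw ..
qed

section \<open>Linearity of face and edge integrals; face normals\<close>

context tet_mesh
begin

lemma flat2_add:
  assumes "s \<in> cells \<W> 2" "continuous_on UNIV f" "continuous_on UNIV g"
  shows "flat2 s (\<lambda>x. f x + g x) = flat2 s f + (flat2 s g :: real)"
  by (rule flat_integral_add[OF _ compact_simplex[OF cells_simplex[OF mesh assms(1)]] assms(2,3)])
     (simp add: aff_dim_simplex[OF cells_simplex[OF mesh assms(1)]])

lemma flat2_cmult:
  assumes "s \<in> cells \<W> 2" "continuous_on UNIV f"
  shows "flat2 s (\<lambda>x. c * f x) = c * (flat2 s f :: real)"
  by (rule flat2_linear[OF assms(1) bounded_linear_mult_right assms(2)])

lemma flat2_sum:
  assumes "s \<in> cells \<W> 2" "\<And>i. i \<in> I \<Longrightarrow> continuous_on UNIV (f i)"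
  shows "flat2 s (\<lambda>x. \<Sum>i\<in>I. f i x) = (\<Sum>i\<in>I. flat2 s (f i) :: real)"
  using assms(2)
proof (induction I rule: infinite_finite_induct)
  case (insert i I)
  have "flat2 s (\<lambda>x. f i x + (\<Sum>i\<in>I. f i x)) = flat2 s (f i) + flat2 s (\<lambda>x. \<Sum>i\<in>I. f i x)"
    using insert.prems by (intro flat2_add[OF assms(1)] continuous_on_sum) auto
  then show ?case using insert by simp
qed (simp_all add: flat_zero)

lemma flat1_add:
  assumes "s \<in> cells \<W> 1" "continuous_on UNIV f" "continuous_on UNIV g"
  shows "flat1 s (\<lambda>x. f x + g x) = flat1 s f + (flat1 s g :: real)"
  by (rule flat_integral_add[OF _ compact_simplex[OF cells_simplex[OF mesh assms(1)]] assms(2,3)])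
     (simp add: aff_dim_simplex[OF cells_simplex[OF mesh assms(1)]])

lemma flat1_cmult:
  assumes "s \<in> cells \<W> 1" "continuous_on UNIV f"
  shows "flat1 s (\<lambda>x. c * f x) = c * (flat1 s f :: real)"
  by (rule flat1_linear[OF assms(1) bounded_linear_mult_right assms(2)])

lemma flat1_sum:
  assumes "s \<in> cells \<W> 1" "\<And>i. i \<in> I \<Longrightarrow> continuous_on UNIV (f i)"
  shows "flat1 s (\<lambda>x. \<Sum>i\<in>I. f i x) = (\<Sum>i\<in>I. flat1 s (f i) :: real)"
  using assms(2)
proof (induction I rule: infinite_finite_induct)
  case (insert i I)
  have "flat1 s (\<lambda>x. f i x + (\<Sum>i\<in>I. f i x)) = flat1 s (f i) + flat1 s (\<lambda>x. \<Sum>i\<in>I. f i x)"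
    using insert.prems by (intro flat1_add[OF assms(1)] continuous_on_sum) auto
  then show ?case using insert by simp
qed (simp_all add: flat_zero)

lemma cell_normal:
  assumes "F \<in> cells \<W> 2"
  shows "normal F \<bullet> normal F = 1" "v \<in> tangent_space F \<longleftrightarrow> v \<bullet> normal F = 0"
    "(\<And>u. u \<in> tangent_space F \<Longrightarrow> v \<bullet> u = 0) \<Longrightarrow> v = (v \<bullet> normal F) *\<^sub>R normal F"
  using normal[OF cells_simplex[OF mesh assms]] by blast+

lemma conormal_normal:
  assumes "T \<in> \<W>" "F facet_of T"
  shows "conormal T F = (conormal T F \<bullet> normal F) *\<^sub>R normal F"
  by (rule cell_normal(3)[OF facet_cells[OF assms]]) (rule conormal(1)[OF assms])

end

text \<open>Isolates what the computation of \<open>inc\<close> takes from the field: symmetric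
  affine pieces, and equal bilinear forms on tangent vectors of shared faces, with the projections
  already eliminated.\<close>

locale reg_field = tet_mesh +
  fixes q :: "(real^3) set \<Rightarrow> real^3 \<Rightarrow> real^3^3"
  assumes q: "\<And>T. T \<in> \<W> \<Longrightarrow> q T \<in> polys 1 sym_matrices"
    and tt: "\<And>F T T' x u v. F \<in> interior_cells \<Omega> \<W> 2 \<Longrightarrow> T \<in> \<W> \<Longrightarrow> T' \<in> \<W> \<Longrightarrow> F facet_of T \<Longrightarrow> F facet_of T' \<Longrightarrow>
      x \<in> F \<Longrightarrow> u \<in> tangent_space F \<Longrightarrow> v \<in> tangent_space F \<Longrightarrow> u \<bullet> (q T x *v v) = u \<bullet> (q T' x *v v)"
begin

abbreviation nb :: "(real^3) set \<Rightarrow> (real^3) set set" where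
  "nb F \<equiv> {T. T \<in> \<W> \<and> F facet_of T}"

lemma q_comp: "T \<in> \<W> \<Longrightarrow> (\<lambda>x. q T x $ n $ l) \<in> polys 1 UNIV"
  using polys_linear[OF bounded_linear.linear[OF bounded_linear_nth2] q] by simp

lemma q_sym: "T \<in> \<W> \<Longrightarrow> q T x $ n $ l = q T x $ l $ n"
proof -
  assume "T \<in> \<W>"
  then have "transpose (q T x) = q T x"
    using polys_value[OF subspace_sym q] by (simp add: sym_matrices_def)
  then have "transpose (q T x) $ l $ n = q T x $ l $ n" by simp
  then show ?thesis by (simp add: transpose_def)
qed

lemma poly1_C1:
  assumes "f \<in> polys 1 (UNIV :: real set)"
  shows "C1 f" "\<exists>g. grad f = (\<lambda>_. g)"
proof -
  obtain c d where "f = (\<lambda>x. c + (\<Sum>i\<in>UNIV. x $ i *\<^sub>R d i))" using polys_1_affine[OF subspace_UNIV assms] by auto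
  then have "f = (\<lambda>x. c + x \<bullet> (\<chi> i. d i))" by (simp add: inner_vec_def)
  then show "C1 f" "\<exists>g. grad f = (\<lambda>_. g)" using C1_affine by auto
qed

text \<open>The pieces are affine, so their derivatives are constants and may be read off at the
  origin.\<close>

definition dq :: "(real^3) set \<Rightarrow> 3 \<Rightarrow> 3 \<Rightarrow> 3 \<Rightarrow> real" where
  "dq T k n l = pd k (\<lambda>x. q T x $ n $ l) 0"

lemma q_C1: "T \<in> \<W> \<Longrightarrow> C1 (\<lambda>x. q T x $ n $ l)" by (rule poly1_C1(1)[OF q_comp])

lemma pd_q: "T \<in> \<W> \<Longrightarrow> pd k (\<lambda>x. q T x $ n $ l) x = dq T k n l"
  using poly1_C1(2)[OF q_comp, of T n l] by (auto simp: dq_def simp flip: grad_nth)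

definition moment :: "(real^3 \<Rightarrow> real) \<Rightarrow> 3 \<Rightarrow> 3 \<Rightarrow> 3 \<Rightarrow> 3 \<Rightarrow> real" where
  "moment \<phi> k m n l = (\<Sum>T\<in>\<W>. set_int T (\<lambda>x. pd k (pd m \<phi>) x * q T x $ n $ l))"

text \<open>The entry \<open>(i, j)\<close> of \<open>\<langle>inc \<sigma>, \<phi>\<rangle>\<close>, written so that it makes sense for
  \<open>\<phi>\<close> of class \<open>C\<^sup>2\<close> and can be tested with bump functions.\<close>

definition inc_form :: "(real^3 \<Rightarrow> real) \<Rightarrow> 3 \<Rightarrow> 3 \<Rightarrow> real" where
  "inc_form \<phi> i j = (\<Sum>m\<in>UNIV. \<Sum>n\<in>UNIV. \<Sum>k\<in>UNIV. \<Sum>l\<in>UNIV. lc j m n * lc i k l * moment \<phi> k m n l)"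

text \<open>Exchanging the pairs \<open>(k, l)\<close> and \<open>(m, n)\<close> swaps
  \<open>i\<close> and \<open>j\<close>. The moments are invariant, because the pieces are symmetric
  and second derivatives commute.\<close>

lemma inc_form_sym:
  assumes "C2 \<phi>" shows "inc_form \<phi> i j = inc_form \<phi> j i"
proof -
  have Ys: "moment \<phi> k m n l = moment \<phi> m k l n" for k m n l
    unfolding moment_def by (intro sum.cong refl set_int_cong) (simp add: q_sym pd_commute[OF assms, of k m])
  have sw: "(\<Sum>a\<in>UNIV. \<Sum>b\<in>UNIV. g a b) = (\<Sum>b\<in>UNIV. \<Sum>a\<in>UNIV. g a b)" for g :: "3 \<Rightarrow> 3 \<Rightarrow> real" by (rule sum.swap)
  have "inc_form \<phi> i j = (\<Sum>m\<in>UNIV. \<Sum>k\<in>UNIV. \<Sum>n\<in>UNIV. \<Sum>l\<in>UNIV. lc j m n * lc i k l * moment \<phi> k m n l)"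
    unfolding inc_form_def by (intro sum.cong refl sw)
  also have "\<dots> = (\<Sum>k\<in>UNIV. \<Sum>m\<in>UNIV. \<Sum>l\<in>UNIV. \<Sum>n\<in>UNIV. lc j m n * lc i k l * moment \<phi> k m n l)"
    by (subst sw) (intro sum.cong refl sw)
  also have "\<dots> = (\<Sum>k\<in>UNIV. \<Sum>m\<in>UNIV. \<Sum>l\<in>UNIV. \<Sum>n\<in>UNIV. lc i k l * lc j m n * moment \<phi> m k l n)"
    by (intro sum.cong refl) (subst Ys, simp)
  also have "\<dots> = (\<Sum>k\<in>UNIV. \<Sum>l\<in>UNIV. \<Sum>m\<in>UNIV. \<Sum>n\<in>UNIV. lc i k l * lc j m n * moment \<phi> m k l n)"
    by (intro sum.cong refl sw)
  also have "\<dots> = inc_form \<phi> j i" unfolding inc_form_def ..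
  finally show ?thesis .
qed

lemma moment_faces:
  assumes \<phi>: "C2 \<phi>" "csupp \<Omega> \<phi>"
  shows "moment \<phi> k m n l = (\<Sum>F\<in>interior_cells \<Omega> \<W> 2. \<Sum>T\<in>nb F.
    conormal T F $ k * flat2 F (\<lambda>x. pd m \<phi> x * q T x $ n $ l) - dq T k n l * conormal T F $ m * flat2 F \<phi>)"
proof -
  have C: "C1 \<phi>" "C1 (pd m \<phi>)" using \<phi>(1) C2_C1 C2_C1_pd by auto
  have 1: "C1 (\<lambda>x. pd m \<phi> x * q T x $ n $ l)" if "T \<in> \<W>" for T by (rule C1_mult(1)[OF C(2) q_C1[OF that]])
  have const: "C1 (\<lambda>x. c)" "grad (\<lambda>x. c) = (\<lambda>_. 0)" for c :: real
    using C1_affine[of c 0] by simp_all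
  have 2: "C1 (\<lambda>x. dq T k n l * \<phi> x)" for T by (rule C1_mult(1)[OF const(1) C(1)])
  \<comment> \<open>The integrand is a derivative in direction \<open>k\<close> minus a derivative
    in direction \<open>m\<close> of a constant multiple of \<open>\<phi>\<close>. Green's formula
    applied to both leaves facet terms only.\<close>
  have "moment \<phi> k m n l = (\<Sum>T\<in>\<W>. set_int T (\<lambda>x. axis k 1 \<bullet> grad (\<lambda>x. pd m \<phi> x * q T x $ n $ l) x)
      - set_int T (\<lambda>x. axis m 1 \<bullet> grad (\<lambda>x. dq T k n l * \<phi> x) x))"
    unfolding moment_def
  proof (intro sum.cong refl)
    fix T assume T: "T \<in> \<W>"
    have "set_int T (\<lambda>x. axis k 1 \<bullet> grad (\<lambda>x. pd m \<phi> x * q T x $ n $ l) x) - set_int T (\<lambda>x. axis m 1 \<bullet> grad (\<lambda>x. dq T k n l * \<phi> x) x)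
      = set_int T (\<lambda>x. axis k 1 \<bullet> grad (\<lambda>x. pd m \<phi> x * q T x $ n $ l) x - axis m 1 \<bullet> grad (\<lambda>x. dq T k n l * \<phi> x) x)"
      by (intro set_integral_diff(2)[symmetric] set_integrable_compact mesh_compact T continuous_dir 1 2)
    also have "\<dots> = set_int T (\<lambda>x. pd k (pd m \<phi>) x * q T x $ n $ l)"
    proof (rule set_int_cong)
      fix x
      have "axis k 1 \<bullet> grad (\<lambda>x. pd m \<phi> x * q T x $ n $ l) x = pd m \<phi> x * dq T k n l + pd k (pd m \<phi>) x * q T x $ n $ l"
        by (simp add: inner_axis' pd_mult[OF C(2) q_C1[OF T]] pd_q[OF T])
      moreover have "axis m 1 \<bullet> grad (\<lambda>x. dq T k n l * \<phi> x) x = dq T k n l * pd m \<phi> x"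
        by (simp only: C1_mult(2)[OF const(1) C(1)] const(2)) (simp add: inner_axis')
      ultimately show "axis k 1 \<bullet> grad (\<lambda>x. pd m \<phi> x * q T x $ n $ l) x - axis m 1 \<bullet> grad (\<lambda>x. dq T k n l * \<phi> x) x
        = pd k (pd m \<phi>) x * q T x $ n $ l" by simp
    qed
    finally show "set_int T (\<lambda>x. pd k (pd m \<phi>) x * q T x $ n $ l) = set_int T (\<lambda>x. axis k 1 \<bullet> grad (\<lambda>x. pd m \<phi> x * q T x $ n $ l) x)
      - set_int T (\<lambda>x. axis m 1 \<bullet> grad (\<lambda>x. dq T k n l * \<phi> x) x)" ..
  qed
  also have "\<dots> = (\<Sum>F\<in>cells \<W> 2. \<Sum>T\<in>nb F. conormal T F $ k * flat2 F (\<lambda>x. pd m \<phi> x * q T x $ n $ l))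
     - (\<Sum>F\<in>cells \<W> 2. \<Sum>T\<in>nb F. conormal T F $ m * flat2 F (\<lambda>x. dq T k n l * \<phi> x))"
    using green_mesh[of "\<lambda>T x. pd m \<phi> x * q T x $ n $ l" "axis k 1", OF 1]
      green_mesh[of "\<lambda>T x. dq T k n l * \<phi> x" "axis m 1", OF 2]
    unfolding sum_subtractf by (simp only: inner_axis mult_1_right inner_real_def)
  also have "\<dots> = (\<Sum>F\<in>cells \<W> 2. \<Sum>T\<in>nb F. conormal T F $ k * flat2 F (\<lambda>x. pd m \<phi> x * q T x $ n $ l) - dq T k n l * conormal T F $ m * flat2 F \<phi>)"
    unfolding sum_subtractf[symmetric]
    by (intro sum.cong refl) (simp add: flat2_cmult C1_continuous[OF C(1)])
  also have "\<dots> = (\<Sum>F\<in>interior_cells \<Omega> \<W> 2. \<Sum>T\<in>nb F. conormal T F $ k * flat2 F (\<lambda>x. pd m \<phi> x * q T x $ n $ l) - dq T k n l * conormal T F $ m * flat2 F \<phi>)"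
  proof (rule sum.mono_neutral_right[OF finite_cells[OF mesh]])
    show "\<forall>F\<in>cells \<W> 2 - interior_cells \<Omega> \<W> 2. (\<Sum>T\<in>nb F. conormal T F $ k * flat2 F (\<lambda>x. pd m \<phi> x * q T x $ n $ l) - dq T k n l * conormal T F $ m * flat2 F \<phi>) = 0"
    proof
      fix F assume F: "F \<in> cells \<W> 2 - interior_cells \<Omega> \<W> 2"
      then have "\<phi> x = 0" "pd m \<phi> x = 0" if "x \<in> F" for x
        using boundary_cell_zero[of F 2 _ x] \<phi>(2) csupp_pd[OF \<phi>(2), of m] that by auto
      then show "(\<Sum>T\<in>nb F. conormal T F $ k * flat2 F (\<lambda>x. pd m \<phi> x * q T x $ n $ l) - dq T k n l * conormal T F $ m * flat2 F \<phi>) = 0"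
        by (simp add: flat_zero)
    qed
  qed (use interior_cells_sub in auto)
  finally show ?thesis .
qed

text \<open>The conormals at \<open>F\<close> from its two sides are opposite, so the sum is the jump of the
  cross product of the conormal with the field. Tangential-tangential continuity makes this jump
  normal to \<open>F\<close>, with coefficient \<open>jump_n\<close>.\<close>

definition jump :: "(real^3) set \<Rightarrow> 3 \<Rightarrow> real^3 \<Rightarrow> real^3" where
  "jump F i x = (\<chi> n. \<Sum>T\<in>nb F. \<Sum>k\<in>UNIV. \<Sum>l\<in>UNIV. lc i k l * conormal T F $ k * q T x $ n $ l)"

definition jump_n :: "(real^3) set \<Rightarrow> 3 \<Rightarrow> real^3 \<Rightarrow> real" where
  "jump_n F i x = jump F i x \<bullet> normal F"

text \<open>The cross product of \<open>normal F\<close> with the \<open>j\<close>-th unit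
  vector.\<close>

definition rot_normal :: "(real^3) set \<Rightarrow> 3 \<Rightarrow> real^3" where
  "rot_normal F j = (\<chi> m. \<Sum>n\<in>UNIV. lc j m n * normal F $ n)"

text \<open>The jump of the constant first derivatives across \<open>F\<close>, contracted as in
  \<open>inc\<close>.\<close>

definition jump_deriv :: "(real^3) set \<Rightarrow> 3 \<Rightarrow> 3 \<Rightarrow> real" where
  "jump_deriv F i j = (\<Sum>m\<in>UNIV. \<Sum>n\<in>UNIV. \<Sum>k\<in>UNIV. \<Sum>l\<in>UNIV. lc j m n * lc i k l * (\<Sum>T\<in>nb F. dq T k n l * conormal T F $ m))"

lemma lc_contract_0: "(\<Sum>k\<in>UNIV. \<Sum>l\<in>UNIV. lc i k l * (v $ k * v $ l)) = 0"
  by (rule antisym_sum_0[OF lc_swap(1)]) simp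

text \<open>For tangent \<open>u\<close>, the products of \<open>q T x\<close> with \<open>u\<close>
  from different sides differ by a multiple of the normal, which the cross product with the normal
  removes. So every side contributes the same \<open>Z\<close>, with weights \<open>\<nu> T\<close>
  that sum to 0.\<close>

lemma jump_tangent:
  assumes F: "F \<in> interior_cells \<Omega> \<W> 2" and x: "x \<in> F" and u: "u \<in> tangent_space F"
  shows "jump F i x \<bullet> u = 0"
proof -
  have Fc: "F \<in> cells \<W> 2" by (rule interior_cells_sub[OF F])
  note N = cell_normal[OF Fc]
  define y where "y T = q T x *v u" for T
  define \<nu> where "\<nu> T = conormal T F \<bullet> normal F" for T
  have \<nu>: "conormal T F $ k = \<nu> T * normal F $ k" if "T \<in> nb F" for T k
    using arg_cong[OF conormal_normal[of T F], of "\<lambda>v. v $ k"] that by (simp add: \<nu>_def)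
  have "(\<Sum>T\<in>nb F. conormal T F) \<bullet> normal F = 0" using conormal_sum_0[OF F] by simp
  then have s0: "(\<Sum>T\<in>nb F. \<nu> T) = 0" by (simp add: \<nu>_def inner_sum_left)
  obtain T0 where "T0 \<in> \<W>" "F face_of T0" using Fc by (auto simp: cells_def)
  then have T0: "T0 \<in> \<W>" "F facet_of T0" using cells_facet Fc by auto
  define Z where "Z = (\<Sum>k\<in>UNIV. \<Sum>l\<in>UNIV. lc i k l * (normal F $ k * y T0 $ l))"
  have ZT: "(\<Sum>k\<in>UNIV. \<Sum>l\<in>UNIV. lc i k l * (normal F $ k * y T $ l)) = Z" if T: "T \<in> nb F" for T
  proof -
    have "(y T - y T0) \<bullet> v = 0" if v: "v \<in> tangent_space F" for v
      using tt[OF F _ T0(1) _ T0(2) x v u, of T] T by (simp add: y_def inner_diff_left inner_diff_right inner_commute[of _ v])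
    then obtain \<beta> where "y T - y T0 = \<beta> *\<^sub>R normal F" using N(3) by blast
    then have "y T = y T0 + \<beta> *\<^sub>R normal F" by (simp add: diff_eq_eq add.commute)
    then have yl: "y T $ l = y T0 $ l + \<beta> * normal F $ l" for l by simp
    have "(\<Sum>k\<in>UNIV. \<Sum>l\<in>UNIV. lc i k l * (normal F $ k * y T $ l))
      = Z + \<beta> * (\<Sum>k\<in>UNIV. \<Sum>l\<in>UNIV. lc i k l * (normal F $ k * normal F $ l))"
      unfolding Z_def sum_distrib_left sum.distrib[symmetric] yl
      by (intro sum.cong refl) (simp add: algebra_simps)
    then show ?thesis by (simp add: lc_contract_0)
  qed
  have "jump F i x \<bullet> u = (\<Sum>n\<in>UNIV. \<Sum>T\<in>nb F. \<Sum>k\<in>UNIV. \<Sum>l\<in>UNIV. lc i k l * conormal T F $ k * q T x $ n $ l * u $ n)"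
    by (simp add: jump_def inner_vec_def sum_distrib_right)
  also have "\<dots> = (\<Sum>T\<in>nb F. \<Sum>n\<in>UNIV. \<Sum>k\<in>UNIV. \<Sum>l\<in>UNIV. lc i k l * conormal T F $ k * q T x $ n $ l * u $ n)"
    by (rule sum.swap)
  also have "\<dots> = (\<Sum>T\<in>nb F. \<nu> T * Z)"
  proof (intro sum.cong refl)
    fix T assume T: "T \<in> nb F"
    have "(\<Sum>n\<in>UNIV. \<Sum>k\<in>UNIV. \<Sum>l\<in>UNIV. lc i k l * conormal T F $ k * q T x $ n $ l * u $ n)
      = (\<Sum>k\<in>UNIV. \<Sum>n\<in>UNIV. \<Sum>l\<in>UNIV. lc i k l * conormal T F $ k * q T x $ n $ l * u $ n)"
      by (rule sum.swap)
    also have "\<dots> = (\<Sum>k\<in>UNIV. \<Sum>l\<in>UNIV. \<Sum>n\<in>UNIV. lc i k l * conormal T F $ k * q T x $ n $ l * u $ n)"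
      by (intro sum.cong refl sum.swap)
    also have "\<dots> = (\<Sum>k\<in>UNIV. \<Sum>l\<in>UNIV. \<nu> T * (lc i k l * (normal F $ k * y T $ l)))"
    proof (intro sum.cong refl)
      fix k l
      \<comment> \<open>By symmetry of \<open>q T x\<close>, contracting its first index with
        \<open>u\<close> is the matrix-vector product.\<close>
      have "y T $ l = (\<Sum>n\<in>UNIV. q T x $ n $ l * u $ n)"
        using T by (simp add: y_def matrix_vector_mult_def q_sym[of T x l])
      then show "(\<Sum>n\<in>UNIV. lc i k l * conormal T F $ k * q T x $ n $ l * u $ n) = \<nu> T * (lc i k l * (normal F $ k * y T $ l))"
        by (simp add: \<nu>[OF T] sum_distrib_left mult_ac)
    qed
    also have "\<dots> = \<nu> T * Z" unfolding ZT[OF T, symmetric] sum_distrib_left ..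
    finally show "(\<Sum>n\<in>UNIV. \<Sum>k\<in>UNIV. \<Sum>l\<in>UNIV. lc i k l * conormal T F $ k * q T x $ n $ l * u $ n) = \<nu> T * Z" .
  qed
  also have "\<dots> = 0" using s0 by (simp add: sum_distrib_right[symmetric])
  finally show ?thesis .
qed

lemma jump_normal:
  assumes "F \<in> interior_cells \<Omega> \<W> 2" "x \<in> F"
  shows "jump F i x = jump_n F i x *\<^sub>R normal F"
  unfolding jump_n_def by (rule cell_normal(3)[OF interior_cells_sub[OF assms(1)] jump_tangent[OF assms]])

lemma jump_n_poly: "jump_n F i \<in> polys 1 UNIV"
proof -
  have "(\<lambda>x. \<Sum>n\<in>UNIV. \<Sum>T\<in>nb F. \<Sum>k\<in>UNIV. \<Sum>l\<in>UNIV. (lc i k l * conormal T F $ k * normal F $ n) * q T x $ n $ l) \<in> polys 1 UNIV"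
  proof (intro polys_sum subspace_UNIV)
    fix n T k l assume "T \<in> nb F"
    then show "(\<lambda>x. (lc i k l * conormal T F $ k * normal F $ n) * q T x $ n $ l) \<in> polys 1 UNIV"
      using polys_linear[OF bounded_linear.linear[OF bounded_linear_mult_right[of "lc i k l * conormal T F $ k * normal F $ n"]] q_comp[of T n l], of UNIV] by simp
  qed
  moreover have "jump_n F i = (\<lambda>x. \<Sum>n\<in>UNIV. \<Sum>T\<in>nb F. \<Sum>k\<in>UNIV. \<Sum>l\<in>UNIV. (lc i k l * conormal T F $ k * normal F $ n) * q T x $ n $ l)"
    by (rule ext) (simp add: jump_n_def jump_def inner_vec_def sum_distrib_left sum_distrib_right mult_ac)
  ultimately show ?thesis by simp
qed

lemma jump_n_C1: "C1 (jump_n F i)" by (rule poly1_C1(1)[OF jump_n_poly])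

definition grad_jump_n :: "(real^3) set \<Rightarrow> 3 \<Rightarrow> real^3" where "grad_jump_n F i = grad (jump_n F i) 0"

lemma grad_jump_n_const: "grad (jump_n F i) = (\<lambda>_. grad_jump_n F i)"
  using poly1_C1(2)[OF jump_n_poly, of F i] by (auto simp: grad_jump_n_def)

text \<open>The first term is the derivative that falls on the jump when integrating by parts in the
  face, the second the jump of the first derivatives.\<close>

definition face_coeff :: "(real^3) set \<Rightarrow> 3 \<Rightarrow> 3 \<Rightarrow> real" where
  "face_coeff F i j = - (rot_normal F j \<bullet> grad_jump_n F i) - jump_deriv F i j"

text \<open>Against the normal, the antisymmetric symbol meets the same vector in both
  \<open>m\<close> and \<open>n\<close>.\<close>

lemma rot_normal_tangent: "F \<in> cells \<W> 2 \<Longrightarrow> rot_normal F j \<in> tangent_space F"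
proof -
  assume F: "F \<in> cells \<W> 2"
  have "rot_normal F j \<bullet> normal F = (\<Sum>m\<in>UNIV. \<Sum>n\<in>UNIV. lc j m n * (normal F $ m * normal F $ n))"
    by (simp add: rot_normal_def inner_vec_def sum_distrib_left sum_distrib_right mult_ac)
  then show ?thesis using cell_normal(2)[OF F] by (simp add: lc_contract_0)
qed

text \<open>The jump is a multiple of the normal, so its contraction with \<open>lc j m n\<close>
  leaves the derivative of \<open>\<phi>\<close> along \<open>rot_normal F j\<close>. That direction
  is tangent to \<open>F\<close>, and the derivative can be integrated by parts onto the
  edges.\<close>

lemma face_term:
  assumes F: "F \<in> interior_cells \<Omega> \<W> 2" and \<phi>: "C2 \<phi>"
  shows "(\<Sum>m\<in>UNIV. \<Sum>n\<in>UNIV. \<Sum>k\<in>UNIV. \<Sum>l\<in>UNIV. lc j m n * lc i k l * (\<Sum>T\<in>nb F.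
    conormal T F $ k * flat2 F (\<lambda>x. pd m \<phi> x * q T x $ n $ l) - dq T k n l * conormal T F $ m * flat2 F \<phi>))
    = face_coeff F i j * flat2 F \<phi> + (\<Sum>e | e facet_of F. (edge_conormal F e \<bullet> rot_normal F j) * flat1 e (\<lambda>x. jump_n F i x * \<phi> x))"
proof -
  have Fc: "F \<in> cells \<W> 2" by (rule interior_cells_sub[OF F])
  have C: "C1 \<phi>" "C1 (pd m \<phi>)" for m using \<phi> C2_C1 C2_C1_pd by auto
  have cq: "continuous_on UNIV (\<lambda>x. pd m \<phi> x * q T x $ n $ l)" if "T \<in> nb F" for T m n l
    using that by (intro continuous_intros C1_continuous[OF C(2)] C1_continuous[OF q_C1]) auto
  \<comment> \<open>Summation over the sides of \<open>F\<close> produces the jump, which is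
    replaced by its normal component.\<close>
  have inner: "(\<Sum>k\<in>UNIV. \<Sum>l\<in>UNIV. lc i k l * (\<Sum>T\<in>nb F. conormal T F $ k * flat2 F (\<lambda>x. pd m \<phi> x * q T x $ n $ l)))
      = normal F $ n * flat2 F (\<lambda>x. jump_n F i x * pd m \<phi> x)" for m n
  proof -
    have "(\<Sum>k\<in>UNIV. \<Sum>l\<in>UNIV. lc i k l * (\<Sum>T\<in>nb F. conormal T F $ k * flat2 F (\<lambda>x. pd m \<phi> x * q T x $ n $ l)))
      = (\<Sum>k\<in>UNIV. \<Sum>l\<in>UNIV. \<Sum>T\<in>nb F. flat2 F (\<lambda>x. (lc i k l * conormal T F $ k) * (pd m \<phi> x * q T x $ n $ l)))"
      unfolding sum_distrib_left
    proof (intro sum.cong refl)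
      fix k l T assume T: "T \<in> nb F"
      show "lc i k l * (conormal T F $ k * flat2 F (\<lambda>x. pd m \<phi> x * q T x $ n $ l))
        = flat2 F (\<lambda>x. (lc i k l * conormal T F $ k) * (pd m \<phi> x * q T x $ n $ l))"
        unfolding flat2_cmult[OF Fc cq[OF T]] by (rule mult.assoc[symmetric])
    qed
    also have "\<dots> = flat2 F (\<lambda>x. \<Sum>k\<in>UNIV. \<Sum>l\<in>UNIV. \<Sum>T\<in>nb F. (lc i k l * conormal T F $ k) * (pd m \<phi> x * q T x $ n $ l))"
    proof -
      have c1: "continuous_on UNIV (\<lambda>x. (lc i k l * conormal T F $ k) * (pd m \<phi> x * q T x $ n $ l))" if "T \<in> nb F" for T k l
        by (intro continuous_on_mult continuous_on_const cq[OF that])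
      have c2: "continuous_on UNIV (\<lambda>x. \<Sum>T\<in>nb F. (lc i k l * conormal T F $ k) * (pd m \<phi> x * q T x $ n $ l))" for k l
        by (intro continuous_on_sum c1)
      have c3: "continuous_on UNIV (\<lambda>x. \<Sum>l\<in>UNIV. \<Sum>T\<in>nb F. (lc i k l * conormal T F $ k) * (pd m \<phi> x * q T x $ n $ l))" for k
        by (intro continuous_on_sum c2)
      have "flat2 F (\<lambda>x. \<Sum>k\<in>UNIV. \<Sum>l\<in>UNIV. \<Sum>T\<in>nb F. (lc i k l * conormal T F $ k) * (pd m \<phi> x * q T x $ n $ l))
        = (\<Sum>k\<in>UNIV. flat2 F (\<lambda>x. \<Sum>l\<in>UNIV. \<Sum>T\<in>nb F. (lc i k l * conormal T F $ k) * (pd m \<phi> x * q T x $ n $ l)))"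
        by (rule flat2_sum[OF Fc c3])
      also have "\<dots> = (\<Sum>k\<in>UNIV. \<Sum>l\<in>UNIV. flat2 F (\<lambda>x. \<Sum>T\<in>nb F. (lc i k l * conormal T F $ k) * (pd m \<phi> x * q T x $ n $ l)))"
        by (rule sum.cong[OF refl]) (rule flat2_sum[OF Fc c2])
      also have "\<dots> = (\<Sum>k\<in>UNIV. \<Sum>l\<in>UNIV. \<Sum>T\<in>nb F. flat2 F (\<lambda>x. (lc i k l * conormal T F $ k) * (pd m \<phi> x * q T x $ n $ l)))"
        by (rule sum.cong[OF refl], rule sum.cong[OF refl]) (rule flat2_sum[OF Fc c1])
      finally show ?thesis ..
    qed
    also have "\<dots> = flat2 F (\<lambda>x. normal F $ n * (jump_n F i x * pd m \<phi> x))"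
    proof (rule flat_integral_cong)
      fix x assume x: "x \<in> F"
      have "(\<Sum>k\<in>UNIV. \<Sum>l\<in>UNIV. \<Sum>T\<in>nb F. (lc i k l * conormal T F $ k) * (pd m \<phi> x * q T x $ n $ l)) = pd m \<phi> x * jump F i x $ n"
      proof -
        have "pd m \<phi> x * jump F i x $ n = (\<Sum>T\<in>nb F. \<Sum>k\<in>UNIV. \<Sum>l\<in>UNIV. (lc i k l * conormal T F $ k) * (pd m \<phi> x * q T x $ n $ l))"
          by (simp add: jump_def sum_distrib_left mult_ac)
        also have "\<dots> = (\<Sum>k\<in>UNIV. \<Sum>T\<in>nb F. \<Sum>l\<in>UNIV. (lc i k l * conormal T F $ k) * (pd m \<phi> x * q T x $ n $ l))"
          by (rule sum.swap)
        also have "\<dots> = (\<Sum>k\<in>UNIV. \<Sum>l\<in>UNIV. \<Sum>T\<in>nb F. (lc i k l * conormal T F $ k) * (pd m \<phi> x * q T x $ n $ l))"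
          by (intro sum.cong refl sum.swap)
        finally show ?thesis ..
      qed
      also have "jump F i x $ n = jump_n F i x * normal F $ n" using jump_normal[OF F x, of i] by simp
      finally show "(\<Sum>k\<in>UNIV. \<Sum>l\<in>UNIV. \<Sum>T\<in>nb F. (lc i k l * conormal T F $ k) * (pd m \<phi> x * q T x $ n $ l)) = normal F $ n * (jump_n F i x * pd m \<phi> x)"
        by (simp add: mult_ac)
    qed
    also have "\<dots> = normal F $ n * flat2 F (\<lambda>x. jump_n F i x * pd m \<phi> x)"
      by (intro flat2_cmult[OF Fc] continuous_intros C1_continuous[OF jump_n_C1] C1_continuous[OF C(2)])
    finally show ?thesis .
  qed
  have first: "(\<Sum>m\<in>UNIV. \<Sum>n\<in>UNIV. lc j m n * (\<Sum>k\<in>UNIV. \<Sum>l\<in>UNIV. lc i k l * (\<Sum>T\<in>nb F. conormal T F $ k * flat2 F (\<lambda>x. pd m \<phi> x * q T x $ n $ l))))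
    = (\<Sum>e | e facet_of F. (edge_conormal F e \<bullet> rot_normal F j) * flat1 e (\<lambda>x. jump_n F i x * \<phi> x)) - (rot_normal F j \<bullet> grad_jump_n F i) * flat2 F \<phi>"
  proof -
    have "(\<Sum>m\<in>UNIV. \<Sum>n\<in>UNIV. lc j m n * (\<Sum>k\<in>UNIV. \<Sum>l\<in>UNIV. lc i k l * (\<Sum>T\<in>nb F. conormal T F $ k * flat2 F (\<lambda>x. pd m \<phi> x * q T x $ n $ l))))
      = (\<Sum>m\<in>UNIV. rot_normal F j $ m * flat2 F (\<lambda>x. jump_n F i x * pd m \<phi> x))"
      unfolding inner by (simp add: rot_normal_def sum_distrib_right mult_ac)
    also have "\<dots> = flat2 F (\<lambda>x. \<Sum>m\<in>UNIV. rot_normal F j $ m * (jump_n F i x * pd m \<phi> x))"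
    proof -
      have c: "continuous_on UNIV (\<lambda>x. jump_n F i x * pd m \<phi> x)" for m
        by (intro continuous_intros C1_continuous[OF jump_n_C1] C1_continuous[OF C(2)])
      have c': "continuous_on UNIV (\<lambda>x. rot_normal F j $ m * (jump_n F i x * pd m \<phi> x))" for m
        by (intro continuous_on_mult continuous_on_const c)
      show ?thesis by (subst flat2_sum[OF Fc c']) (simp_all add: flat2_cmult[OF Fc c])
    qed
    \<comment> \<open>Product rule for \<open>jump_n F i x * \<phi> x\<close>; the gradient of the
      affine factor is constant.\<close>
    also have "\<dots> = flat2 F (\<lambda>x. rot_normal F j \<bullet> grad (\<lambda>x. jump_n F i x * \<phi> x) x + (- (rot_normal F j \<bullet> grad_jump_n F i)) * \<phi> x)"
    proof (rule flat_integral_cong)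
      fix x
      have "(\<Sum>m\<in>UNIV. rot_normal F j $ m * (jump_n F i x * pd m \<phi> x)) = jump_n F i x * (rot_normal F j \<bullet> grad \<phi> x)"
        by (simp add: inner_vec_def sum_distrib_left mult_ac)
      then show "(\<Sum>m\<in>UNIV. rot_normal F j $ m * (jump_n F i x * pd m \<phi> x)) = rot_normal F j \<bullet> grad (\<lambda>x. jump_n F i x * \<phi> x) x + (- (rot_normal F j \<bullet> grad_jump_n F i)) * \<phi> x"
        by (simp add: C1_mult(2)[OF jump_n_C1 C(1)] grad_jump_n_const inner_add_right)
    qed
    also have "\<dots> = flat2 F (\<lambda>x. rot_normal F j \<bullet> grad (\<lambda>x. jump_n F i x * \<phi> x) x) + flat2 F (\<lambda>x. (- (rot_normal F j \<bullet> grad_jump_n F i)) * \<phi> x)"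
      by (intro flat2_add[OF Fc] continuous_dir C1_mult(1)[OF jump_n_C1 C(1)] continuous_on_mult continuous_on_const C1_continuous[OF C(1)])
    also have "flat2 F (\<lambda>x. (- (rot_normal F j \<bullet> grad_jump_n F i)) * \<phi> x) = (- (rot_normal F j \<bullet> grad_jump_n F i)) * flat2 F \<phi>"
      by (rule flat2_cmult[OF Fc C1_continuous[OF C(1)]])
    also have "flat2 F (\<lambda>x. rot_normal F j \<bullet> grad (\<lambda>x. jump_n F i x * \<phi> x) x) = (\<Sum>e | e facet_of F. (edge_conormal F e \<bullet> rot_normal F j) * flat1 e (\<lambda>x. jump_n F i x * \<phi> x))"
      by (rule edge_conormal(2)[OF Fc C1_mult(1)[OF jump_n_C1 C(1)] rot_normal_tangent[OF Fc]])
    finally show ?thesis by simp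
  qed
  have "(\<Sum>m\<in>UNIV. \<Sum>n\<in>UNIV. \<Sum>k\<in>UNIV. \<Sum>l\<in>UNIV. lc j m n * lc i k l * (\<Sum>T\<in>nb F.
    conormal T F $ k * flat2 F (\<lambda>x. pd m \<phi> x * q T x $ n $ l) - dq T k n l * conormal T F $ m * flat2 F \<phi>))
    = (\<Sum>m\<in>UNIV. \<Sum>n\<in>UNIV. \<Sum>k\<in>UNIV. \<Sum>l\<in>UNIV. lc j m n * lc i k l * (\<Sum>T\<in>nb F. conormal T F $ k * flat2 F (\<lambda>x. pd m \<phi> x * q T x $ n $ l))
      - lc j m n * lc i k l * (\<Sum>T\<in>nb F. dq T k n l * conormal T F $ m) * flat2 F \<phi>)"
    by (intro sum.cong refl) (simp only: sum_subtractf right_diff_distrib sum_distrib_right mult.assoc)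
  also have "\<dots> = (\<Sum>m\<in>UNIV. \<Sum>n\<in>UNIV. lc j m n * (\<Sum>k\<in>UNIV. \<Sum>l\<in>UNIV. lc i k l * (\<Sum>T\<in>nb F. conormal T F $ k * flat2 F (\<lambda>x. pd m \<phi> x * q T x $ n $ l))))
      - jump_deriv F i j * flat2 F \<phi>"
    unfolding sum_subtractf jump_deriv_def by (simp add: sum_distrib_right sum_distrib_left mult.assoc)
  finally show ?thesis unfolding first by (simp add: face_coeff_def algebra_simps)
qed

text \<open>Collects at \<open>e\<close> the boundary terms of all interior faces. The indices play
  different roles: \<open>i\<close> enters through the jump, \<open>j\<close> through the tangent
  direction.\<close>

definition edge_coeff :: "(real^3) set \<Rightarrow> 3 \<Rightarrow> 3 \<Rightarrow> real^3 \<Rightarrow> real" where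
  "edge_coeff e i j x = (\<Sum>F | F \<in> interior_cells \<Omega> \<W> 2 \<and> e facet_of F. (edge_conormal F e \<bullet> rot_normal F j) * jump_n F i x)"

lemma edge_coeff_poly: "edge_coeff e i j \<in> polys 1 UNIV"
  unfolding edge_coeff_def
proof (intro polys_sum subspace_UNIV)
  fix F
  show "(\<lambda>x. (edge_conormal F e \<bullet> rot_normal F j) * jump_n F i x) \<in> polys 1 UNIV"
    using polys_linear[OF bounded_linear.linear[OF bounded_linear_mult_right[of "edge_conormal F e \<bullet> rot_normal F j"]] jump_n_poly, of UNIV] by simp
qed

lemma edge_coeff_continuous: "continuous_on S (edge_coeff e i j)"
  by (rule polys_continuous[OF subspace_UNIV edge_coeff_poly])

text \<open>Exchanging the sums over faces and over their edges lets each edge gather its adjacent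
  faces. Symmetry of the coefficients is not yet visible.\<close>

lemma inc_form_eq:
  assumes \<phi>: "C2 \<phi>" "csupp \<Omega> \<phi>"
  shows "inc_form \<phi> i j = (\<Sum>F\<in>interior_cells \<Omega> \<W> 2. face_coeff F i j * flat2 F \<phi>)
    + (\<Sum>e\<in>interior_cells \<Omega> \<W> 1. flat1 e (\<lambda>x. \<phi> x * edge_coeff e i j x))"
proof -
  have C: "C1 \<phi>" using \<phi> C2_C1 by auto
  let ?h = "\<lambda>F e. (edge_conormal F e \<bullet> rot_normal F j) * flat1 e (\<lambda>x. jump_n F i x * \<phi> x)"
  have "inc_form \<phi> i j = (\<Sum>F\<in>interior_cells \<Omega> \<W> 2. face_coeff F i j * flat2 F \<phi> + (\<Sum>e | e facet_of F. ?h F e))"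
    unfolding inc_form_def moment_faces[OF \<phi>] by (subst quad_sum_swap) (intro sum.cong refl face_term \<phi>)
  also have "\<dots> = (\<Sum>F\<in>interior_cells \<Omega> \<W> 2. face_coeff F i j * flat2 F \<phi>) + (\<Sum>F\<in>interior_cells \<Omega> \<W> 2. \<Sum>e | e facet_of F. ?h F e)"
    by (rule sum.distrib)
  also have "(\<Sum>F\<in>interior_cells \<Omega> \<W> 2. \<Sum>e | e facet_of F. ?h F e)
      = (\<Sum>F\<in>interior_cells \<Omega> \<W> 2. \<Sum>e\<in>interior_cells \<Omega> \<W> 1. if e facet_of F then ?h F e else 0)"
  proof (rule sum.cong[OF refl])
    fix F assume F: "F \<in> interior_cells \<Omega> \<W> 2"
    show "(\<Sum>e | e facet_of F. ?h F e) = (\<Sum>e\<in>interior_cells \<Omega> \<W> 1. if e facet_of F then ?h F e else 0)"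
    proof (rule sum_edges_interior[OF interior_cells_sub[OF F]])
      fix e assume e: "e \<in> cells \<W> 1" "e \<notin> interior_cells \<Omega> \<W> 1"
      have "flat1 e (\<lambda>x. jump_n F i x * \<phi> x) = 0"
        by (rule flat_zero) (use boundary_cell_zero[OF e \<phi>(2)] in simp)
      then show "?h F e = 0" by simp
    qed
  qed
  also have "\<dots> = (\<Sum>e\<in>interior_cells \<Omega> \<W> 1. \<Sum>F\<in>interior_cells \<Omega> \<W> 2. if e facet_of F then ?h F e else 0)"
    by (rule sum.swap)
  also have "\<dots> = (\<Sum>e\<in>interior_cells \<Omega> \<W> 1. flat1 e (\<lambda>x. \<phi> x * edge_coeff e i j x))"
  proof (intro sum.cong refl)
    fix e assume e: "e \<in> interior_cells \<Omega> \<W> 1"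
    have ec: "e \<in> cells \<W> 1" by (rule interior_cells_sub[OF e])
    have c: "continuous_on UNIV (\<lambda>x. jump_n F i x * \<phi> x)" for F
      by (intro continuous_intros C1_continuous[OF jump_n_C1] C1_continuous[OF C])
    have c': "continuous_on UNIV (\<lambda>x. (edge_conormal F e \<bullet> rot_normal F j) * (jump_n F i x * \<phi> x))" for F
      by (intro continuous_on_mult continuous_on_const c)
    have "(\<Sum>F\<in>interior_cells \<Omega> \<W> 2. if e facet_of F then ?h F e else 0) = (\<Sum>F | F \<in> interior_cells \<Omega> \<W> 2 \<and> e facet_of F. ?h F e)"
      by (rule sum.inter_filter[OF finite_interior_cells, symmetric])
    also have "\<dots> = flat1 e (\<lambda>x. \<Sum>F | F \<in> interior_cells \<Omega> \<W> 2 \<and> e facet_of F. (edge_conormal F e \<bullet> rot_normal F j) * (jump_n F i x * \<phi> x))"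
      by (subst flat1_sum[OF ec c']) (simp_all add: flat1_cmult[OF ec c])
    also have "\<dots> = flat1 e (\<lambda>x. \<phi> x * edge_coeff e i j x)"
      by (intro flat_integral_cong) (simp add: edge_coeff_def sum_distrib_left mult_ac)
    finally show "(\<Sum>F\<in>interior_cells \<Omega> \<W> 2. if e facet_of F then ?h F e else 0) = flat1 e (\<lambda>x. \<phi> x * edge_coeff e i j x)" .
  qed
  finally show ?thesis .
qed

end

text \<open>The vectors \<open>e i\<close> are the projections of the unit vectors to the plane. As
  \<open>A\<close> annihilates the normal on both sides, it is the sum of the dyads of
  \<open>e i\<close> and \<open>e j\<close> with coefficients \<open>A $ i $ j\<close>.\<close>

lemma sym_plane_matrix:
  fixes A :: "real^3^3"
  assumes sym: "\<And>i j. A $ i $ j = A $ j $ i" and N: "N \<bullet> N = 1" "\<And>i. A $ i \<bullet> N = 0"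
    and F: "\<And>v. v \<in> tangent_space F \<longleftrightarrow> v \<bullet> N = 0"
  shows "A \<in> face_matrices F"
proof -
  define e where "e i = axis i (1::real) - N $ i *\<^sub>R N" for i :: 3
  have et: "e i \<in> tangent_space F" for i
    by (simp add: F e_def inner_diff_left inner_axis' N(1))
  have AN: "(\<Sum>j\<in>UNIV. A $ i $ j * N $ j) = 0" for i using N(2)[of i] by (simp add: inner_vec_def)
  have AN': "(\<Sum>i\<in>UNIV. A $ i $ j * N $ i) = 0" for j using AN[of j] by (simp add: sym[of _ j])
  have *: "A $ a $ b = (\<Sum>i\<in>UNIV. \<Sum>j\<in>UNIV. A $ i $ j * (e i $ a * e j $ b))" for a b
  proof -
    have "(\<Sum>j\<in>UNIV. A $ i $ j * (e i $ a * e j $ b)) = A $ i $ b * e i $ a" for i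
    proof -
      have "(\<Sum>j\<in>UNIV. A $ i $ j * (e i $ a * e j $ b))
        = (\<Sum>j\<in>UNIV. if j = b then A $ i $ j * e i $ a else 0) - e i $ a * N $ b * (\<Sum>j\<in>UNIV. A $ i $ j * N $ j)"
        unfolding sum_distrib_left sum_subtractf[symmetric]
        by (intro sum.cong refl) (auto simp: e_def axis_def algebra_simps)
      then show ?thesis by (simp add: AN)
    qed
    then have "(\<Sum>i\<in>UNIV. \<Sum>j\<in>UNIV. A $ i $ j * (e i $ a * e j $ b)) = (\<Sum>i\<in>UNIV. A $ i $ b * e i $ a)" by simp
    also have "\<dots> = (\<Sum>i\<in>UNIV. if i = a then A $ i $ b else 0) - N $ a * (\<Sum>i\<in>UNIV. A $ i $ b * N $ i)"
      unfolding sum_distrib_left sum_subtractf[symmetric]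
      by (intro sum.cong refl) (auto simp: e_def axis_def algebra_simps)
    finally show ?thesis by (simp add: AN')
  qed
  have AB: "A = (\<Sum>i\<in>UNIV. \<Sum>j\<in>UNIV. A $ i $ j *\<^sub>R outer (e i) (e j))" (is "A = ?B")
    unfolding vec_eq_iff
  proof (intro allI)
    fix a b
    have "?B $ a $ b = (\<Sum>i\<in>UNIV. \<Sum>j\<in>UNIV. A $ i $ j * (e i $ a * e j $ b))" by (simp add: outer_def)
    also note *[symmetric]
    finally show "A $ a $ b = ?B $ a $ b" ..
  qed
  \<comment> \<open>Adding the expansion to its transpose symmetrizes the dyads into generators of
    \<open>face_matrices F\<close>.\<close>
  have "(2::real) *\<^sub>R A = A + A" by (rule scaleR_2)
  also have "A + A = ?B + ?B" by (rule arg_cong2[where f="(+)", OF AB AB])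
  also have "(\<Sum>i\<in>UNIV. \<Sum>j\<in>UNIV. A $ i $ j *\<^sub>R outer (e i) (e j)) + (\<Sum>i\<in>UNIV. \<Sum>j\<in>UNIV. A $ i $ j *\<^sub>R outer (e i) (e j))
    = (\<Sum>i\<in>UNIV. \<Sum>j\<in>UNIV. A $ i $ j *\<^sub>R outer (e i) (e j)) + (\<Sum>i\<in>UNIV. \<Sum>j\<in>UNIV. A $ i $ j *\<^sub>R outer (e j) (e i))"
  proof -
    have "(\<Sum>i\<in>UNIV. \<Sum>j\<in>UNIV. A $ i $ j *\<^sub>R outer (e i) (e j)) = (\<Sum>j\<in>UNIV. \<Sum>i\<in>UNIV. A $ i $ j *\<^sub>R outer (e i) (e j))"
      by (rule sum.swap)
    also have "\<dots> = (\<Sum>i\<in>UNIV. \<Sum>j\<in>UNIV. A $ i $ j *\<^sub>R outer (e j) (e i))"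
      by (intro sum.cong refl) (subst sym, rule refl)
    finally show ?thesis by simp
  qed
  also have "\<dots> = (\<Sum>i\<in>UNIV. \<Sum>j\<in>UNIV. A $ i $ j *\<^sub>R (outer (e i) (e j) + outer (e j) (e i)))"
    by (simp add: sum.distrib scaleR_add_right)
  also have "\<dots> \<in> face_matrices F"
    unfolding face_matrices_def by (intro span_sum span_scale span_base) (use et in blast)
  finally have "(1/2::real) *\<^sub>R ((2::real) *\<^sub>R A) \<in> face_matrices F"
    by (rule subspace_scale[OF subspace_face_matrices])
  then show ?thesis by simp
qed

text \<open>Each row is a multiple of \<open>\<tau>\<close>, and by symmetry so is each column. What
  remains is the dyad of \<open>\<tau>\<close>, multiplied by the value of the quadratic form at
  \<open>\<tau>\<close>.\<close>

lemma sym_line_matrix: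
  fixes A :: "real^3^3"
  assumes sym: "\<And>i j. A $ i $ j = A $ j $ i" and \<tau>: "\<tau> \<bullet> \<tau> = 1"
    and u: "\<And>u i. u \<bullet> \<tau> = 0 \<Longrightarrow> A $ i \<bullet> u = 0"
  shows "A $ a $ b = (\<Sum>i\<in>UNIV. \<Sum>j\<in>UNIV. \<tau> $ i * \<tau> $ j * A $ i $ j) * (\<tau> $ a * \<tau> $ b)"
proof -
  have row: "A $ i $ b = (A $ i \<bullet> \<tau>) * \<tau> $ b" for i b
  proof -
    have "(axis b 1 - \<tau> $ b *\<^sub>R \<tau>) \<bullet> \<tau> = 0" by (simp add: inner_diff_left inner_axis' \<tau>)
    then have "A $ i \<bullet> (axis b 1 - \<tau> $ b *\<^sub>R \<tau>) = 0" by (rule u)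
    then show ?thesis by (simp add: inner_diff_right inner_axis)
  qed
  have "A $ a \<bullet> \<tau> = (\<Sum>i\<in>UNIV. A $ i $ a * \<tau> $ i)" by (simp add: inner_vec_def sym[of a])
  also have "\<dots> = (\<Sum>i\<in>UNIV. (A $ i \<bullet> \<tau>) * \<tau> $ i) * \<tau> $ a"
    unfolding sum_distrib_right by (rule sum.cong[OF refl]) (simp only: row[of _ a] mult_ac)
  finally have "A $ a $ b = (\<Sum>i\<in>UNIV. (A $ i \<bullet> \<tau>) * \<tau> $ i) * \<tau> $ a * \<tau> $ b" using row[of a b] by simp
  moreover have "(\<Sum>i\<in>UNIV. (A $ i \<bullet> \<tau>) * \<tau> $ i) = (\<Sum>i\<in>UNIV. \<Sum>j\<in>UNIV. \<tau> $ i * \<tau> $ j * A $ i $ j)"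
    by (simp add: inner_vec_def sum_distrib_left sum_distrib_right mult_ac)
  ultimately show ?thesis by simp
qed

section \<open>Symmetry and values of the densities\<close>

context reg_field
begin

text \<open>A bump isolating \<open>F\<close> from all other cells of dimension at most 2 reduces
  the symmetric \<open>inc_form\<close> to the face coefficient times a positive integral.\<close>

lemma face_coeff_sym:
  assumes F: "F \<in> interior_cells \<Omega> \<W> 2" shows "face_coeff F i j = face_coeff F j i"
proof -
  have Fc: "F \<in> cells \<W> 2" by (rule interior_cells_sub[OF F])
  obtain x where x: "x \<in> rel_interior F" "x \<in> \<Omega>" using interior_cell_point[OF mesh F open_dom] by auto
  obtain r where r: "r > 0" "cball x r \<subseteq> \<Omega>" "\<And>b B. B \<in> cells \<W> b \<Longrightarrow> b \<le> 2 \<Longrightarrow> B \<noteq> F \<Longrightarrow> B \<inter> cball x r = {}"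
    by (rule cell_isolated[OF mesh Fc x open_dom]; rule that; assumption)
  define \<phi> where "\<phi> = bump x r"
  have \<phi>: "C2 \<phi>" "csupp \<Omega> \<phi>" unfolding \<phi>_def using C2_bump csupp_bump[OF r(1,2)] by auto
  have out: "\<phi> y = 0" if "y \<in> B" "B \<inter> cball x r = {}" for y B
    unfolding \<phi>_def by (rule bump_outside[OF r(1)]) (use that ball_subset_cball in blast)
  have pos: "flat2 F \<phi> > 0"
  proof (rule flat2_positive[OF cells_simplex[OF mesh Fc] C1_continuous[OF C2_C1[OF \<phi>(1)]]])
    show "x \<in> F" using x rel_interior_subset by blast
  qed (use r(1) in \<open>auto simp: \<phi>_def bump_nonneg bump_center\<close>)
  have "inc_form \<phi> i j = face_coeff F i j * flat2 F \<phi>" for i j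
  proof -
    have "(\<Sum>G\<in>interior_cells \<Omega> \<W> 2. face_coeff G i j * flat2 G \<phi>) = (\<Sum>G\<in>{F}. face_coeff G i j * flat2 G \<phi>)"
    proof (rule sum.mono_neutral_right[OF finite_interior_cells])
      show "\<forall>G\<in>interior_cells \<Omega> \<W> 2 - {F}. face_coeff G i j * flat2 G \<phi> = 0"
      proof
        fix G assume "G \<in> interior_cells \<Omega> \<W> 2 - {F}"
        then have "G \<inter> cball x r = {}" using r(3)[of G 2] interior_cells_sub by auto
        then show "face_coeff G i j * flat2 G \<phi> = 0" using out by (simp add: flat_zero)
      qed
    qed (use F in auto)
    moreover have "(\<Sum>e\<in>interior_cells \<Omega> \<W> 1. flat1 e (\<lambda>x. \<phi> x * edge_coeff e i j x)) = 0"
    proof (rule sum.neutral, rule ballI)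
      fix e assume e: "e \<in> interior_cells \<Omega> \<W> 1"
      have "e \<noteq> F" using interior_cells_sub[OF e] Fc by (auto simp: cells_def)
      then have "e \<inter> cball x r = {}" using r(3)[OF interior_cells_sub[OF e]] by simp
      then show "flat1 e (\<lambda>x. \<phi> x * edge_coeff e i j x) = 0" using out by (simp add: flat_zero)
    qed
    ultimately show ?thesis unfolding inc_form_eq[OF \<phi>] by simp
  qed
  then show ?thesis using inc_form_sym[OF \<phi>(1), of i j] pos by simp
qed

lemma face_coeff_normal: "(\<Sum>j\<in>UNIV. face_coeff F i j * normal F $ j) = 0" if F: "F \<in> interior_cells \<Omega> \<W> 2"
proof -
  let ?N = "normal F"
  \<comment> \<open>A component of the cross product of the normal with itself.\<close>
  have 1: "(\<Sum>j\<in>UNIV. ?N $ j * rot_normal F j $ m) = 0" for m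
  proof -
    have "(\<Sum>j\<in>UNIV. ?N $ j * rot_normal F j $ m) = (\<Sum>j\<in>UNIV. \<Sum>n\<in>UNIV. lc j m n * (?N $ j * ?N $ n))"
      by (simp add: rot_normal_def sum_distrib_left mult_ac)
    also have "\<dots> = 0"
      by (rule antisym_sum_0[where a="\<lambda>j n. lc j m n", OF lc_swap13]) simp
    finally show ?thesis .
  qed
  have "(\<Sum>j\<in>UNIV. (rot_normal F j \<bullet> grad_jump_n F i) * ?N $ j) = (\<Sum>j\<in>UNIV. \<Sum>m\<in>UNIV. ?N $ j * rot_normal F j $ m * grad_jump_n F i $ m)"
    by (rule sum.cong[OF refl], simp only: inner_vec_def sum_distrib_right inner_real_def, rule sum.cong[OF refl], simp only: mult_ac)
  also have "\<dots> = (\<Sum>m\<in>UNIV. \<Sum>j\<in>UNIV. ?N $ j * rot_normal F j $ m * grad_jump_n F i $ m)"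
    by (rule sum.swap)
  also have "\<dots> = (\<Sum>m\<in>UNIV. (\<Sum>j\<in>UNIV. ?N $ j * rot_normal F j $ m) * grad_jump_n F i $ m)"
    by (simp only: sum_distrib_right)
  finally have a: "(\<Sum>j\<in>UNIV. (rot_normal F j \<bullet> grad_jump_n F i) * ?N $ j) = 0" by (simp add: 1)
  \<comment> \<open>Conormals are multiples of the normal, so the symbol again meets the normal
    twice, now in \<open>j\<close> and \<open>m\<close>.\<close>
  have b: "(\<Sum>j\<in>UNIV. jump_deriv F i j * ?N $ j) = 0"
  proof -
    have c: "conormal T F $ m = (conormal T F \<bullet> ?N) * ?N $ m" if "T \<in> nb F" for T m
      using arg_cong[OF conormal_normal[of T F], of "\<lambda>v. v $ m"] that by simp
    have g: "(\<Sum>T\<in>nb F. dq T k n l * conormal T F $ m) = (\<Sum>T\<in>nb F. dq T k n l * (conormal T F \<bullet> ?N)) * ?N $ m" for k n l m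
      unfolding sum_distrib_right
    proof (rule sum.cong[OF refl])
      fix T assume "T \<in> nb F"
      from c[OF this, of m] show "dq T k n l * conormal T F $ m = dq T k n l * (conormal T F \<bullet> ?N) * ?N $ m"
        by (simp only: mult.assoc)
    qed
    define G where "G n = (\<Sum>k\<in>UNIV. \<Sum>l\<in>UNIV. lc i k l * (\<Sum>T\<in>nb F. dq T k n l * (conormal T F \<bullet> ?N)))" for n
    have "jump_deriv F i j = (\<Sum>m\<in>UNIV. \<Sum>n\<in>UNIV. lc j m n * (G n * ?N $ m))" for j
      unfolding jump_deriv_def g G_def by (simp only: sum_distrib_left sum_distrib_right mult.assoc)
    then have "(\<Sum>j\<in>UNIV. jump_deriv F i j * ?N $ j) = (\<Sum>j\<in>UNIV. \<Sum>m\<in>UNIV. (\<Sum>n\<in>UNIV. lc j m n * (G n * ?N $ m)) * ?N $ j)"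
      by (simp only: sum_distrib_right)
    also have "\<dots> = (\<Sum>j\<in>UNIV. \<Sum>m\<in>UNIV. (\<Sum>n\<in>UNIV. lc j m n * G n) * (?N $ j * ?N $ m))"
      unfolding sum_distrib_right by (intro sum.cong refl) simp
    also have "\<dots> = 0"
    proof (rule antisym_sum_0)
      show "(\<Sum>n\<in>UNIV. lc j m n * G n) = - (\<Sum>n\<in>UNIV. lc m j n * G n)" for j m
        unfolding sum_negf[symmetric] by (rule sum.cong[OF refl]) (simp only: lc_swap(2)[of j m] mult_minus_left)
    qed (rule mult.commute)
    finally show ?thesis .
  qed
  show ?thesis using a b by (simp add: face_coeff_def left_diff_distrib sum_subtractf sum_negf)
qed

lemma face_coeff_face:
  assumes F: "F \<in> interior_cells \<Omega> \<W> 2" shows "(\<chi> i j. face_coeff F i j) \<in> face_matrices F"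
proof (rule sym_plane_matrix)
  note cn = cell_normal[OF interior_cells_sub[OF F]]
  show "normal F \<bullet> normal F = 1" by (rule cn(1))
  show "v \<in> tangent_space F \<longleftrightarrow> v \<bullet> normal F = 0" for v by (rule cn(2))
  show "(\<chi> i j. face_coeff F i j) $ i $ j = (\<chi> i j. face_coeff F i j) $ j $ i" for i j using face_coeff_sym[OF F] by simp
  show "(\<chi> i j. face_coeff F i j) $ i \<bullet> normal F = 0" for i using face_coeff_normal[OF F] by (simp add: inner_vec_def)
qed

text \<open>Edge coefficients are affine rather than constant, so the argument is pointwise: a
  nonzero difference at a relative interior point would be detected by a small bump on which it
  keeps its sign. Faces meet this bump as well, but their coefficients are already symmetric and
  cancel.\<close>

lemma edge_coeff_sym:
  assumes e: "e \<in> interior_cells \<Omega> \<W> 1" and x: "x \<in> e" "x \<in> \<Omega>"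
  shows "edge_coeff e i j x = edge_coeff e j i x"
proof -
  have ec: "e \<in> cells \<W> 1" by (rule interior_cells_sub[OF e])
  define A where "A y = edge_coeff e i j y - edge_coeff e j i y" for y
  have cA: "continuous_on S A" for S unfolding A_def[abs_def] by (intro continuous_intros edge_coeff_continuous)
  have rel: "A y = 0" if y: "y \<in> rel_interior e" "y \<in> \<Omega>" for y
  proof (rule ccontr)
    assume "A y \<noteq> 0"
    define s where "s = sgn (A y)"
    have s: "s * A y > 0" using \<open>A y \<noteq> 0\<close> by (simp add: s_def sgn_mult_self_eq abs_sgn[symmetric] mult.commute)
    obtain r where r: "r > 0" "cball y r \<subseteq> \<Omega>" "\<And>b B. B \<in> cells \<W> b \<Longrightarrow> b \<le> 1 \<Longrightarrow> B \<noteq> e \<Longrightarrow> B \<inter> cball y r = {}"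
      by (rule cell_isolated[OF mesh ec y open_dom]; rule that; assumption)
    have "open {z. s * A z > 0}" by (intro open_Collect_less continuous_intros cA)
    then obtain r' where r': "r' > 0" "ball y r' \<subseteq> {z. s * A z > 0}"
      using s open_contains_ball[of "{z. s * A z > 0}"] by auto
    \<comment> \<open>Small enough both to isolate the edge and to keep the sign of
      \<open>A\<close>.\<close>
    define \<rho> where "\<rho> = min r r'"
    have \<rho>: "\<rho> > 0" "cball y \<rho> \<subseteq> cball y r" "ball y \<rho> \<subseteq> ball y r'" using r(1) r'(1) by (auto simp: \<rho>_def)
    define \<phi> where "\<phi> = bump y \<rho>"
    have "cball y \<rho> \<subseteq> \<Omega>" using \<rho>(2) r(2) by blast
    then have \<phi>: "C2 \<phi>" "csupp \<Omega> \<phi>" unfolding \<phi>_def using C2_bump csupp_bump[OF \<rho>(1)] by auto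
    have c\<phi>: "continuous_on S \<phi>" for S by (rule C1_continuous[OF C2_C1[OF \<phi>(1)]])
    have out: "\<phi> z = 0" if "z \<notin> ball y \<rho>" for z unfolding \<phi>_def by (rule bump_outside[OF \<rho>(1) that])
    have eq: "inc_form \<phi> i j = (\<Sum>F\<in>interior_cells \<Omega> \<W> 2. face_coeff F i j * flat2 F \<phi>) + flat1 e (\<lambda>x. \<phi> x * edge_coeff e i j x)" for i j
    proof -
      have "(\<Sum>e\<in>interior_cells \<Omega> \<W> 1. flat1 e (\<lambda>x. \<phi> x * edge_coeff e i j x)) = (\<Sum>e\<in>{e}. flat1 e (\<lambda>x. \<phi> x * edge_coeff e i j x))"
      proof (rule sum.mono_neutral_right[OF finite_interior_cells])
        show "\<forall>g\<in>interior_cells \<Omega> \<W> 1 - {e}. flat1 g (\<lambda>x. \<phi> x * edge_coeff g i j x) = 0"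
        proof
          fix g assume "g \<in> interior_cells \<Omega> \<W> 1 - {e}"
          then have "g \<inter> cball y r = {}" using r(3)[of g 1] interior_cells_sub by auto
          then have "\<phi> z = 0" if "z \<in> g" for z
            using out[of z] that \<rho>(2) ball_subset_cball[of y \<rho>] by blast
          then show "flat1 g (\<lambda>x. \<phi> x * edge_coeff g i j x) = 0" by (simp add: flat_zero)
        qed
      qed (use e in auto)
      then show ?thesis unfolding inc_form_eq[OF \<phi>] by simp
    qed
    have "flat1 e (\<lambda>x. \<phi> x * edge_coeff e i j x) = flat1 e (\<lambda>x. \<phi> x * edge_coeff e j i x)"
    proof -
      have "(\<Sum>F\<in>interior_cells \<Omega> \<W> 2. face_coeff F i j * flat2 F \<phi>) = (\<Sum>F\<in>interior_cells \<Omega> \<W> 2. face_coeff F j i * flat2 F \<phi>)"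
        by (intro sum.cong refl) (simp add: face_coeff_sym[of _ i j])
      then show ?thesis using eq[of i j] eq[of j i] inc_form_sym[OF \<phi>(1), of i j] by simp
    qed
    moreover have "flat1 e (\<lambda>x. s * (\<phi> x * A x)) = s * (flat1 e (\<lambda>x. \<phi> x * edge_coeff e i j x) + (-1) * flat1 e (\<lambda>x. \<phi> x * edge_coeff e j i x))"
    proof -
      have c1: "continuous_on UNIV (\<lambda>x. \<phi> x * edge_coeff e a b x)" for a b by (intro continuous_intros c\<phi> edge_coeff_continuous)
      have c2: "continuous_on UNIV (\<lambda>x. (-1) * (\<phi> x * edge_coeff e a b x))" for a b by (intro continuous_on_mult continuous_on_const c1)
      have "flat1 e (\<lambda>x. s * (\<phi> x * A x)) = s * flat1 e (\<lambda>x. \<phi> x * A x)"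
        by (intro flat1_cmult[OF ec] continuous_intros c\<phi> cA)
      also have "flat1 e (\<lambda>x. \<phi> x * A x) = flat1 e (\<lambda>x. \<phi> x * edge_coeff e i j x + (-1) * (\<phi> x * edge_coeff e j i x))"
        by (rule flat_integral_cong) (simp add: A_def algebra_simps)
      also have "\<dots> = flat1 e (\<lambda>x. \<phi> x * edge_coeff e i j x) + flat1 e (\<lambda>x. (-1) * (\<phi> x * edge_coeff e j i x))"
        by (rule flat1_add[OF ec c1 c2])
      also have "flat1 e (\<lambda>x. (-1) * (\<phi> x * edge_coeff e j i x)) = (-1) * flat1 e (\<lambda>x. \<phi> x * edge_coeff e j i x)"
        by (rule flat1_cmult[OF ec c1])
      finally show ?thesis .
    qed
    ultimately have "flat1 e (\<lambda>x. s * (\<phi> x * A x)) = 0" by simp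
    moreover have "flat1 e (\<lambda>x. s * (\<phi> x * A x)) > 0"
    proof (rule flat1_positive[OF cells_simplex[OF mesh ec]])
      show "continuous_on UNIV (\<lambda>x. s * (\<phi> x * A x))" by (intro continuous_intros c\<phi> cA)
      show "y \<in> e" using y rel_interior_subset by blast
      have eq: "s * (\<phi> z * A z) = \<phi> z * (s * A z)" for z by simp
      have "\<phi> y > 0" using \<rho>(1) by (simp add: \<phi>_def bump_center)
      then show "s * (\<phi> y * A y) > 0" unfolding eq using s by simp
      show "s * (\<phi> z * A z) \<ge> 0" if "z \<in> e" for z
      proof (cases "z \<in> ball y \<rho>")
        case True
        then have "s * A z > 0" using \<rho>(3) r'(2) by blast
        then show ?thesis unfolding eq using bump_nonneg[of y \<rho> z] by (simp add: \<phi>_def)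
      next
        case False then show ?thesis using out by simp
      qed
    qed
    ultimately show False by simp
  qed
  \<comment> \<open>Continuity extends the result from the dense relative interior to end points of
    \<open>e\<close> inside \<open>\<Omega>\<close>.\<close>
  have "A x = 0"
  proof (rule ccontr)
    assume "A x \<noteq> 0"
    have "open {z. A z \<noteq> 0}" by (intro open_Collect_neq continuous_intros cA)
    then have o: "open ({z. A z \<noteq> 0} \<inter> \<Omega>)" using open_dom by blast
    have "convex e" "closed e" using cells_simplex[OF mesh ec] convex_simplex closed_simplex by auto
    then have "x \<in> closure (rel_interior e)" using x(1) by (simp add: convex_closure_rel_interior)
    then have "({z. A z \<noteq> 0} \<inter> \<Omega>) \<inter> rel_interior e \<noteq> {}"
      using open_Int_closure_eq_empty[OF o, of "rel_interior e"] \<open>A x \<noteq> 0\<close> x(2) by blast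
    then show False using rel by blast
  qed
  then show ?thesis by (simp add: A_def)
qed

text \<open>Each face contributes a multiple of the triple product of \<open>u\<close>,
  \<open>edge_conormal F e\<close> and \<open>normal F\<close>, and all three are orthogonal to the
  edge.\<close>

lemma edge_coeff_orthogonal:
  assumes e: "e \<in> cells \<W> 1" "e = convex hull {a, b}" "a \<noteq> b" and u: "u \<bullet> (b - a) = 0"
  shows "(\<Sum>j\<in>UNIV. edge_coeff e i j x * u $ j) = 0"
proof -
  have "(\<Sum>j\<in>UNIV. edge_coeff e i j x * u $ j) = (\<Sum>j\<in>UNIV. \<Sum>F | F \<in> interior_cells \<Omega> \<W> 2 \<and> e facet_of F. (edge_conormal F e \<bullet> rot_normal F j) * jump_n F i x * u $ j)"
    by (simp add: edge_coeff_def sum_distrib_right)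
  also have "\<dots> = (\<Sum>F | F \<in> interior_cells \<Omega> \<W> 2 \<and> e facet_of F. \<Sum>j\<in>UNIV. (edge_conormal F e \<bullet> rot_normal F j) * jump_n F i x * u $ j)"
    by (rule sum.swap)
  also have "\<dots> = 0"
  proof (rule sum.neutral, rule ballI)
    fix F assume "F \<in> {F. F \<in> interior_cells \<Omega> \<W> 2 \<and> e facet_of F}"
    then have F: "F \<in> cells \<W> 2" "e facet_of F" using interior_cells_sub by auto
    have ba: "b - a \<in> tangent_space e" unfolding e(2) tangent_space_segment by (simp add: span_base)
    have m: "edge_conormal F e \<bullet> (b - a) = 0" by (rule edge_conormal(1)[OF F ba])
    have "e \<subseteq> F" using F(2) facet_of_imp_subset by blast
    then have "tangent_space e \<subseteq> tangent_space F" unfolding tangent_space_def by (intro span_mono) auto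
    then have N: "normal F \<bullet> (b - a) = 0" using cell_normal(2)[OF F(1), of "b - a"] ba by (auto simp: inner_commute)
    have "(\<Sum>j\<in>UNIV. (edge_conormal F e \<bullet> rot_normal F j) * jump_n F i x * u $ j)
      = jump_n F i x * (\<Sum>j\<in>UNIV. \<Sum>m\<in>UNIV. \<Sum>n\<in>UNIV. lc j m n * (u $ j * edge_conormal F e $ m * normal F $ n))"
      by (simp add: rot_normal_def inner_vec_def sum_distrib_left sum_distrib_right mult_ac)
    also have "\<dots> = 0" using triple_product_0[OF _ u m N] e(3) by simp
    finally show "(\<Sum>j\<in>UNIV. (edge_conormal F e \<bullet> rot_normal F j) * jump_n F i x * u $ j) = 0" .
  qed
  finally show ?thesis .
qed

text \<open>Symmetry is available inside \<open>\<Omega>\<close> only, so agreement is claimed only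
  there. The witness, the quadratic form at the unit tangent times the dyad of that tangent, is a
  polynomial on the whole space with values in \<open>edge_matrices e\<close>.\<close>

lemma edge_density:
  assumes e: "e \<in> interior_cells \<Omega> \<W> 1"
  shows "\<exists>p. p \<in> polys 1 (edge_matrices e) \<and> (\<forall>x\<in>e. x \<in> \<Omega> \<longrightarrow> (\<forall>i j. p x $ i $ j = edge_coeff e i j x))"
proof -
  have ec: "e \<in> cells \<W> 1" by (rule interior_cells_sub[OF e])
  obtain a b where ab: "a \<noteq> b" "e = convex hull {a, b}"
    "\<And>\<psi>. C1 \<psi> \<Longrightarrow> flat1 e (\<lambda>x. (b - a) \<bullet> grad \<psi> x) = mass1 e * (\<psi> b - \<psi> a)"
    by (rule green_edge[OF cells_simplex[OF mesh ec]]; rule that; assumption)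
  define \<tau> where "\<tau> = (1 / norm (b - a)) *\<^sub>R (b - a)"
  have \<tau>: "norm \<tau> = 1" "\<tau> \<bullet> \<tau> = 1" using ab(1) by (simp_all add: \<tau>_def dot_square_norm power2_eq_square)
  have \<tau>t: "\<tau> \<in> tangent_space e" unfolding ab(2) tangent_space_segment \<tau>_def by (simp add: span_base span_scale)
  then have E: "outer \<tau> \<tau> \<in> edge_matrices e" unfolding edge_matrices_def using \<tau> by (intro span_base) auto
  define k where "k x = (\<Sum>i\<in>UNIV. \<Sum>j\<in>UNIV. \<tau> $ i * \<tau> $ j * edge_coeff e i j x)" for x
  have kp: "k \<in> polys 1 UNIV"
    unfolding k_def[abs_def]
  proof (intro polys_sum subspace_UNIV)
    fix i j
    show "(\<lambda>x. \<tau> $ i * \<tau> $ j * edge_coeff e i j x) \<in> polys 1 UNIV"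
      using polys_linear[OF bounded_linear.linear[OF bounded_linear_mult_right[of "\<tau> $ i * \<tau> $ j"]] edge_coeff_poly, of UNIV] by simp
  qed
  have "(\<lambda>x. k x *\<^sub>R outer \<tau> \<tau>) \<in> polys 1 (edge_matrices e)"
    by (rule polys_linear[OF bounded_linear.linear[OF bounded_linear_scaleR_left] kp])
       (rule subspace_scale[OF subspace_edge_matrices E])
  moreover have "(k x *\<^sub>R outer \<tau> \<tau>) $ i $ j = edge_coeff e i j x" if x: "x \<in> e" "x \<in> \<Omega>" for x i j
  proof -
    have "(\<chi> i j. edge_coeff e i j x) $ i $ j = (\<Sum>i'\<in>UNIV. \<Sum>j'\<in>UNIV. \<tau> $ i' * \<tau> $ j' * (\<chi> i j. edge_coeff e i j x) $ i' $ j') * (\<tau> $ i * \<tau> $ j)"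
    proof (rule sym_line_matrix[OF _ \<tau>(2)])
      show "(\<chi> i j. edge_coeff e i j x) $ i $ j = (\<chi> i j. edge_coeff e i j x) $ j $ i" for i j using edge_coeff_sym[OF e x] by simp
      fix u :: "real^3" and i assume "u \<bullet> \<tau> = 0"
      then have "u \<bullet> (b - a) = 0" using ab(1) by (simp add: \<tau>_def)
      then show "(\<chi> i j. edge_coeff e i j x) $ i \<bullet> u = 0"
        using edge_coeff_orthogonal[OF ec ab(2,1), of u i x] by (simp add: inner_vec_def)
    qed
    then show ?thesis by (simp add: k_def outer_def)
  qed
  ultimately show ?thesis by blast
qed

end

section \<open>Membership of \<open>inc\<close> in the dual space\<close>

context tet_mesh
begin

theorem dinc_in_Reg1_star:
  assumes "S \<in> Sigma_WF \<Omega> \<W>" shows "dinc \<Omega> S \<in> Reg1_star \<Omega> \<W>"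
proof -
  let ?E = "interior_cells \<Omega> \<W> 1" and ?F = "interior_cells \<Omega> \<W> 2"
  have "S \<in> Reg1 \<Omega> \<W>" using assms by (simp add: Sigma_WF_def)
  then obtain \<sigma> q where H: "S = reg_dist \<Omega> \<sigma> \<and> square_integrable_on \<Omega> \<sigma>
      \<and> (\<forall>T\<in>\<W>. q T \<in> polys 1 sym_matrices \<and> (\<forall>x\<in>interior T. \<sigma> x = q T x))
      \<and> (\<forall>f\<in>?F. \<forall>T\<in>\<W>. \<forall>T'\<in>\<W>. f face_of T \<and> f face_of T' \<longrightarrow>
            (\<forall>x\<in>f. proj_mat f ** q T x ** proj_mat f = proj_mat f ** q T' x ** proj_mat f))"
    unfolding Reg1_def by (elim CollectE exE conjE) (rule that, intro conjI; assumption)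
  have S: "S = reg_dist \<Omega> \<sigma>" and sq: "square_integrable_on \<Omega> \<sigma>" using H by simp_all
  have q1: "\<And>T. T \<in> \<W> \<Longrightarrow> q T \<in> polys 1 sym_matrices" and q2: "\<And>T x. T \<in> \<W> \<Longrightarrow> x \<in> interior T \<Longrightarrow> \<sigma> x = q T x"
    using H by simp_all
  have tt: "proj_mat f ** q T x ** proj_mat f = proj_mat f ** q T' x ** proj_mat f"
    if "f \<in> ?F" "T \<in> \<W>" "T' \<in> \<W>" "f face_of T" "f face_of T'" "x \<in> f" for f T T' x
    using conjunct2[OF conjunct2[OF conjunct2[OF H]], rule_format, of f T T' x] that by simp
  interpret reg_field \<Omega> \<W> q
  proof
    fix F T T' x u v
    assume F: "F \<in> ?F" "T \<in> \<W>" "T' \<in> \<W>" "F facet_of T" "F facet_of T'" "x \<in> F" and uv: "u \<in> tangent_space F" "v \<in> tangent_space F"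
    have "proj_mat F ** q T x ** proj_mat F = proj_mat F ** q T' x ** proj_mat F"
      by (rule tt[OF F(1-3)]) (use F in \<open>auto simp: facet_of_def\<close>)
    then show "u \<bullet> (q T x *v v) = u \<bullet> (q T' x *v v)" using proj_mat_eq_iff uv by blast
  qed (rule q1)
  have m: "set_borel_measurable lebesgue \<Omega> \<sigma>" using sq by (simp add: square_integrable_on_def)
  have qc: "continuous_on K (q T)" if "T \<in> \<W>" for K T by (rule polys_continuous[OF subspace_sym q1[OF that]])
  \<comment> \<open>Second derivatives of a test function are test functions, so their pairing with
    the field is a sum over the polynomial pieces.\<close>
  have SY: "S (pd k (pd m \<phi>)) $ n $ l = moment \<phi> k m n l" if t: "\<phi> \<in> test_fun \<Omega>" for \<phi> k m n l
  proof -
    note t' = test_fun_pd[OF test_fun_pd[OF t], of k m]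
    have "S (pd k (pd m \<phi>)) = (\<Sum>T\<in>\<W>. set_int T (\<lambda>x. pd k (pd m \<phi>) x *\<^sub>R q T x))"
      unfolding S by (rule reg_dist_eq[OF t' m qc q2])
    then have "S (pd k (pd m \<phi>)) $ n $ l = (\<Sum>T\<in>\<W>. set_int T (\<lambda>x. pd k (pd m \<phi>) x *\<^sub>R q T x) $ n $ l)" by simp
    also have "\<dots> = moment \<phi> k m n l"
      unfolding moment_def
    proof (intro sum.cong refl)
      fix T assume T: "T \<in> \<W>"
      have "continuous_on T (\<lambda>x. pd k (pd m \<phi>) x *\<^sub>R q T x)"
        by (intro continuous_intros C1_continuous[OF test_fun_C1[OF t']] qc[OF T])
      from set_int_nth2[OF T this] show "set_int T (\<lambda>x. pd k (pd m \<phi>) x *\<^sub>R q T x) $ n $ l = set_int T (\<lambda>x. pd k (pd m \<phi>) x * q T x $ n $ l)"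
        by simp
    qed
    finally show ?thesis .
  qed
  have "\<forall>e\<in>?E. \<exists>p. p \<in> polys 1 (edge_matrices e) \<and> (\<forall>x\<in>e. x \<in> \<Omega> \<longrightarrow> (\<forall>i j. p x $ i $ j = edge_coeff e i j x))"
    by (intro ballI edge_density)
  from bchoice[OF this] obtain p where p: "\<forall>e\<in>?E. p e \<in> polys 1 (edge_matrices e) \<and> (\<forall>x\<in>e. x \<in> \<Omega> \<longrightarrow> (\<forall>i j. p e x $ i $ j = edge_coeff e i j x))" ..
  define B where "B F = (\<chi> i j. face_coeff F i j)" for F
  have "dinc \<Omega> S = on_test \<Omega> (\<lambda>\<phi>. (\<Sum>e\<in>?E. edge_delta (p e) e \<phi>) + (\<Sum>f\<in>?F. face_delta (\<lambda>_. B f) f \<phi>))"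
  proof
    fix \<phi>
    show "dinc \<Omega> S \<phi> = on_test \<Omega> (\<lambda>\<phi>. (\<Sum>e\<in>?E. edge_delta (p e) e \<phi>) + (\<Sum>f\<in>?F. face_delta (\<lambda>_. B f) f \<phi>)) \<phi>"
    proof (cases "\<phi> \<in> test_fun \<Omega>")
      case False then show ?thesis by (simp add: dinc_not_test on_test_def)
    next
      case t: True
      note C2 = test_fun_C2[OF t] and supp = test_fun_csupp[OF t]
      have c: "continuous_on K \<phi>" for K by (rule C1_continuous[OF test_fun_C1[OF t]])
      have "dinc \<Omega> S \<phi> $ i $ j = (\<Sum>e\<in>?E. edge_delta (p e) e \<phi> $ i $ j) + (\<Sum>f\<in>?F. face_delta (\<lambda>_. B f) f \<phi> $ i $ j)" for i j
      proof -
        have "dinc \<Omega> S \<phi> $ i $ j = inc_form \<phi> i j"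
          unfolding dinc_nth[OF t] inc_form_def SY[OF t] ..
        also have "\<dots> = (\<Sum>F\<in>?F. face_coeff F i j * flat2 F \<phi>) + (\<Sum>e\<in>?E. flat1 e (\<lambda>x. \<phi> x * edge_coeff e i j x))"
          by (rule inc_form_eq[OF C2 supp])
        also have "(\<Sum>F\<in>?F. face_coeff F i j * flat2 F \<phi>) = (\<Sum>f\<in>?F. face_delta (\<lambda>_. B f) f \<phi> $ i $ j)"
        proof (intro sum.cong refl)
          fix F assume F: "F \<in> ?F"
          show "face_coeff F i j * flat2 F \<phi> = face_delta (\<lambda>_. B F) F \<phi> $ i $ j"
            unfolding face_delta_def flat2_scaleR[OF interior_cells_sub[OF F] c] by (simp add: B_def)
        qed
        also have "(\<Sum>e\<in>?E. flat1 e (\<lambda>x. \<phi> x * edge_coeff e i j x)) = (\<Sum>e\<in>?E. edge_delta (p e) e \<phi> $ i $ j)"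
        proof (intro sum.cong refl)
          fix e assume e: "e \<in> ?E"
          have pe: "p e \<in> polys 1 (edge_matrices e)" "\<And>x i j. x \<in> e \<Longrightarrow> x \<in> \<Omega> \<Longrightarrow> p e x $ i $ j = edge_coeff e i j x"
            using p e by auto
          have cp: "continuous_on UNIV (\<lambda>x. \<phi> x *\<^sub>R p e x)"
            by (intro continuous_intros c polys_continuous[OF subspace_edge_matrices pe(1)])
          have "edge_delta (p e) e \<phi> $ i $ j = flat1 e (\<lambda>x. (\<phi> x *\<^sub>R p e x) $ i $ j)"
            unfolding edge_delta_def using flat1_linear[OF interior_cells_sub[OF e] bounded_linear_nth2 cp, of i j] by simp
          \<comment> \<open>Off \<open>\<Omega>\<close> the density and the coefficient may differ,
            but \<open>\<phi>\<close> vanishes there.\<close>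
          also have "\<dots> = flat1 e (\<lambda>x. \<phi> x * edge_coeff e i j x)"
          proof (rule flat_integral_cong)
            fix x assume "x \<in> e"
            then show "(\<phi> x *\<^sub>R p e x) $ i $ j = \<phi> x * edge_coeff e i j x"
              using pe(2)[of x i j] csupp_zero[OF supp, of x] by (cases "x \<in> \<Omega>") simp_all
          qed
          finally show "flat1 e (\<lambda>x. \<phi> x * edge_coeff e i j x) = edge_delta (p e) e \<phi> $ i $ j" ..
        qed
        finally show ?thesis by simp
      qed
      then show ?thesis using t by (simp add: on_test_def vec_eq_iff)
    qed
  qed
  moreover have "\<forall>e\<in>?E. p e \<in> polys 1 (edge_matrices e)" using p by blast
  moreover have "\<forall>f\<in>?F. (\<lambda>_. B f) \<in> polys 0 (face_matrices f)"
    unfolding B_def by (intro ballI polys_const subspace_face_matrices face_coeff_face)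
  ultimately show ?thesis unfolding Reg1_star_def mem_Collect_eq
    by (intro exI[of _ p] exI[of _ "\<lambda>f _. B f"] conjI)
qed

end

theorem theorem4p7:
  fixes \<Omega> :: "(real^3) set" and \<T> \<W> :: "(real^3) set set"
  assumes "bounded \<Omega>" and "polyhedral_domain \<Omega>" and "lipschitz_domain \<Omega>"
    and "tetrahedral_mesh \<Omega> \<T>"
    and "worsey_farin_refinement \<T> \<W>"
  shows "(\<lambda>_. 0) \<in> Upsilon_WF \<Omega> \<W> \<and> ddef \<Omega> (\<lambda>_. 0) = (\<lambda>_. 0)
    \<and> (\<forall>U \<in> Upsilon_WF \<Omega> \<W>. ddef \<Omega> U \<in> Sigma_WF \<Omega> \<W>)
    \<and> (\<forall>S \<in> Sigma_WF \<Omega> \<W>. dinc \<Omega> S \<in> Reg1_star \<Omega> \<W>)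
    \<and> (\<forall>M \<in> Reg1_star \<Omega> \<W>. ddiv \<Omega> M \<in> Lag2_star \<Omega> \<W>)
    \<and> (\<forall>U \<in> Upsilon_WF \<Omega> \<W>. dinc \<Omega> (ddef \<Omega> U) = (\<lambda>_. 0))
    \<and> (\<forall>S \<in> Sigma_WF \<Omega> \<W>. ddiv \<Omega> (dinc \<Omega> S) = (\<lambda>_. 0))"
proof -
  interpret tet_mesh \<Omega> \<W>
    using worsey_farin_mesh[OF assms(4,5)] assms(3) by unfold_locales (auto simp: lipschitz_domain_def)
  have "ddef \<Omega> (\<lambda>_. 0) = (\<lambda>_. 0)"
    by (auto simp: fun_eq_iff vec_eq_iff ddef_def dgrad_def dpd_def on_test_def transpose_def)
  then show ?thesis
    using zero_in_Upsilon ddef_in_Sigma dinc_in_Reg1_star ddiv_in_Lag2_star dinc_ddef ddiv_dinc by (intro conjI ballI)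
qed

end
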